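(* Let $T$ be an arbitrary Calderón–Zygmund operator on $\mathbb{R}^d$ with parameter $\epsilon$. Then there is a constant $c_1$, depending only on $d$ and $\epsilon$, such that for every weight $w\in A_2$, $$\|T\|_{L^2(w)\to L^{2}(w)}\le c_1\,[w]_{A_2}\log(1+[w]_{A_2}).$$
   Context: A weight $w$ on $\mathbb{R}^d$ is an a.e. positive locally integrable function; $L^2(w)=L^2(\mathbb{R}^d,w\,dx)$, $\langle w\rangle_I=|I|^{-1}\int_I w\,dx$. $w\in A_2$ means $[w]_{A_2}:=\sup_I\langle w\rangle_I\langle w^{-1}\rangle_I<\infty$ (supremum over all cubes $I$). A Calderón–Zygmund operator (with parameter $\epsilon>0$) is a linear operator $T$ bounded on $L^2(\mathbb{R}^d,dx)$ (Lebesgue measure) for which there is a kernel $K$ with $(Tf,g)=\iint K(x,y)f(y)g(x)\,dy\,dx$ for all nice $f,g$ with disjoint supports, where $|K(x,y)|\le |x-y|^{-d}$ and $|K(x,y)-K(x',y)|+|K(y,x)-K(y,x')|\le \frac{|x-x'|^{\epsilon}}{|x-y|^{d+\epsilon}}$ whenever $|x-x'|\le\frac12|x-y|$. $\|T\|_{L^2(w)\to L^2(w)}$ is the operator norm of $T$ on $L^2(w)$.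
   Formalization: The constant c_1 depends on d, ε and an upper bound for the norm of T on L^2(dx), not only on d and ε; without this the claim fails for T = m·Id (kernel K = 0) with w = 1 and m large. *)

theory Defs
  imports "HOL-Analysis.Analysis"
begin

text \<open>
  Functions stand for their classes modulo equality almost everywhere. Every Lebesgue measurable
  function agrees almost everywhere with a Borel measurable one, so the classes
  over \<^term>\<open>lborel\<close> are those over Lebesgue measure.
\<close>

definition L2_space :: "'a measure \<Rightarrow> ('a \<Rightarrow> complex) set" where
  "L2_space M = {f \<in> borel_measurable M. integrable M (\<lambda>x. (cmod (f x))\<^sup>2)}"

definition L2_norm :: "'a measure \<Rightarrow> ('a \<Rightarrow> complex) \<Rightarrow> real" where
  "L2_norm M f = sqrt (LINT x|M. (cmod (f x))\<^sup>2)"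

definition weighted :: "('a::euclidean_space \<Rightarrow> real) \<Rightarrow> 'a measure" where
  "weighted w = density lborel (\<lambda>x. ennreal (w x))"

text \<open>
  The operators are given on the unweighted space $L^2(dx)$. Its intersection with $L^2(w)$ is
  dense in $L^2(w)$, so the norm of the operator on $L^2(w)$ is its best bound on that intersection
  (infinite if the set of bounds is empty, that is, if there is no bounded extension).
\<close>

definition L2_opnorm ::
  "'a::euclidean_space measure \<Rightarrow> (('a \<Rightarrow> complex) \<Rightarrow> ('a \<Rightarrow> complex)) \<Rightarrow> ennreal" where
  "L2_opnorm M T = (INF C \<in> {C. 0 \<le> C \<and> (\<forall>f \<in> L2_space lborel \<inter> L2_space M.
      T f \<in> L2_space M \<and> L2_norm M (T f) \<le> C * L2_norm M f)}. ennreal C)"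

definition cubes :: "(real ^ 'd) set set" where
  "cubes = {cbox a (\<chi> i. a $ i + l) | a l. 0 < l}"

definition average :: "(real ^ 'd \<Rightarrow> real) \<Rightarrow> (real ^ 'd) set \<Rightarrow> ennreal" where
  "average w I = (\<integral>\<^sup>+x\<in>I. ennreal (w x) \<partial>lborel) / emeasure lborel I"

definition A2_char :: "(real ^ 'd \<Rightarrow> real) \<Rightarrow> ennreal" where
  "A2_char w = (SUP I\<in>cubes. average w I * average (\<lambda>x. inverse (w x)) I)"

definition is_weight :: "(real ^ 'd \<Rightarrow> real) \<Rightarrow> bool" where
  "is_weight w \<longleftrightarrow> w \<in> borel_measurable lborel \<and> (AE x in lborel. 0 < w x) \<and>
     (\<forall>S. compact S \<longrightarrow> set_integrable lborel S w)"

definition A2_weight :: "(real ^ 'd \<Rightarrow> real) \<Rightarrow> bool" where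
  "A2_weight w \<longleftrightarrow> is_weight w \<and> A2_char w < \<infinity>"

definition supp :: "('a::topological_space \<Rightarrow> complex) \<Rightarrow> 'a set" where
  "supp f = closure {x. f x \<noteq> 0}"

definition linear_on_L2 ::
  "(('a::euclidean_space \<Rightarrow> complex) \<Rightarrow> ('a \<Rightarrow> complex)) \<Rightarrow> bool" where
  "linear_on_L2 T \<longleftrightarrow>
     (\<forall>f \<in> L2_space lborel. \<forall>g \<in> L2_space lborel.
        AE x in lborel. T (\<lambda>y. f y + g y) x = T f x + T g x) \<and>
     (\<forall>a. \<forall>f \<in> L2_space lborel. AE x in lborel. T (\<lambda>y. a * f y) x = a * T f x)"

definition cz_kernel :: "real \<Rightarrow> (real ^ 'd \<Rightarrow> real ^ 'd \<Rightarrow> complex) \<Rightarrow> bool" where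
  "cz_kernel \<epsilon> K \<longleftrightarrow>
     (\<forall>x y. x \<noteq> y \<longrightarrow> cmod (K x y) \<le> 1 / norm (x - y) ^ CARD('d)) \<and>
     (\<forall>x x' y. x \<noteq> y \<and> norm (x - x') \<le> norm (x - y) / 2 \<longrightarrow>
        cmod (K x y - K x' y) + cmod (K y x - K y x')
          \<le> norm (x - x') powr \<epsilon> / norm (x - y) powr (real CARD('d) + \<epsilon>))"

text \<open>
  The test functions are the continuous functions of compact support. The kernel
  bounds make $K$ continuous off the diagonal, so the iterated integral below
  converges absolutely. The pairing is bilinear, without conjugation. Linearity and boundedness
  together imply that $T$ respects equality almost everywhere.

  The kernel bounds do not control the norm of $T$ on $L^2(dx)$: every multiple of the
  identity qualifies, with $K = 0$. Uniform estimates must therefore involve a bound on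
  \<^term>\<open>L2_opnorm lborel T\<close>.
\<close>

definition calderon_zygmund ::
  "real \<Rightarrow> ((real ^ 'd \<Rightarrow> complex) \<Rightarrow> (real ^ 'd \<Rightarrow> complex)) \<Rightarrow> bool" where
  "calderon_zygmund \<epsilon> T \<longleftrightarrow>
     linear_on_L2 T \<and> L2_opnorm lborel T < \<infinity> \<and>
     (\<exists>K. cz_kernel \<epsilon> K \<and>
       (\<forall>f g. continuous_on UNIV f \<and> continuous_on UNIV g \<and>
          compact (supp f) \<and> compact (supp g) \<and> supp f \<inter> supp g = {} \<longrightarrow>
          (LINT x|lborel. T f x * g x) =
          (LINT x|lborel. (LINT y|lborel. K x y * f y * g x))))"

end

theory Submission
  imports Defs
begin

text \<open>
  A Calderon-Zygmund operator is dominated pointwise by a sparse sum, and sparse sums are bounded on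
  \<open>L\<^sup>2(w)\<close> by a multiple of \<open>[w]\<close>, linearly. Since \<open>1 \<le> [w]\<close>, the logarithm is bounded below by
  \<open>ln 2\<close> and the linear bound implies the stated one.

  For a cell \<open>Q\<close> of a dyadic grid let \<open>3Q\<close> be its triple and \<open>A(P)\<close> the average of \<open>\<bar>f\<bar>\<close> over \<open>3P\<close>. The
  domination (\<open>sparse_domination\<close>) reads \<open>\<bar>T(f 1\<^bsub>3Q\<^esub>)\<bar> \<le> C \<Sum> A(P) 1\<^bsub>P\<^esub>\<close> almost everywhere on \<open>Q\<close>, where \<open>P\<close> runs over
  cells that contain pairwise disjoint sets \<open>E(P)\<close> of at least half their measure. It iterates one
  step (\<open>sparse_step\<close>), which follows Lerner and Ombrosi. Remove from \<open>Q\<close> the set where \<open>\<bar>T(f 1\<^bsub>3Q\<^esub>)\<bar>\<close> or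
  the dyadic maximal function of averages over triples exceeds a large multiple of \<open>A(Q)\<close>. Weak type
  estimates (\<open>local_weak_type\<close>, \<open>maximal_weak_type\<close>) make this set so small that the maximal cells
  in which it has a substantial density occupy at most half of \<open>Q\<close>. On such a cell \<open>P\<close> the part
  \<open>T(f 1\<^bsub>3Q - 3P\<^esub>)\<close> is given by the kernel (\<open>kernel_representation\<close>), oscillates by at most a multiple
  of \<open>A(Q)\<close> (\<open>kernel_op_oscillation\<close>) and is of that size at one point of \<open>P\<close>. Only \<open>T(f 1\<^bsub>3P\<^esub>)\<close>
  remains, and \<open>P\<close> is treated like \<open>Q\<close>. The weak type estimate for \<open>T\<close> comes from a Calderon-Zygmund
  decomposition, so the whole argument uses only the bound of \<open>T\<close> on \<open>L\<^sup>2(dx)\<close> and the kernel bounds.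

  For the weighted bound (\<open>sparse_bound\<close>) a finite sparse sum \<open>u\<close> is tested against itself. The
  averages over \<open>3P\<close> with respect to \<open>dx\<close> of \<open>f\<close> and of \<open>u w\<close> are turned into averages of \<open>f w\<close> with
  respect to \<open>w\<^sup>-\<^sup>1 dx\<close> and of \<open>u\<close> with respect to \<open>w dx\<close>; this costs one factor \<open>[w]\<close>. The sets \<open>E(P)\<close>
  then turn the sum into the integral of a product of two maximal functions, and Doob's inequality
  (\<open>laminar_maximal\<close>) bounds a maximal function over a laminar family with a constant that does not
  depend on the measure. The triples of cells are not laminar, but they split into \<open>3\<^sup>d\<close> families
  that are (\<open>triple_laminar\<close>).
\<close>

section \<open>Square integrable functions\<close>

definition sqnorm :: "'a measure \<Rightarrow> ('a \<Rightarrow> complex) \<Rightarrow> ennreal" where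
  "sqnorm M f = (\<integral>\<^sup>+x. ennreal ((cmod (f x))\<^sup>2) \<partial>M)"

lemma L2_space_iff: "f \<in> L2_space M \<longleftrightarrow> f \<in> borel_measurable M \<and> sqnorm M f < \<infinity>"
  unfolding L2_space_def sqnorm_def by (auto simp: integrable_iff_bounded)

lemma L2_spaceD [dest]: "f \<in> L2_space M \<Longrightarrow> f \<in> borel_measurable M"
  by (simp add: L2_space_iff)

lemma sqnorm_eq:
  assumes "f \<in> L2_space M"
  shows "ennreal ((L2_norm M f)\<^sup>2) = sqnorm M f"
proof -
  have i: "integrable M (\<lambda>x. (cmod (f x))\<^sup>2)" using assms by (simp add: L2_space_def)
  have "(L2_norm M f)\<^sup>2 = (LINT x|M. (cmod (f x))\<^sup>2)"
    unfolding L2_norm_def by (intro real_sqrt_pow2 integral_nonneg_AE) auto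
  then show ?thesis unfolding sqnorm_def using nn_integral_eq_integral[OF i] by simp
qed

lemma cmod_add_sq: "(cmod (a + b))\<^sup>2 \<le> 2 * (cmod a)\<^sup>2 + 2 * (cmod b)\<^sup>2"
proof -
  have "(cmod (a + b))\<^sup>2 \<le> (cmod a + cmod b)\<^sup>2" by (intro power_mono norm_triangle_ineq) auto
  also have "\<dots> \<le> 2 * (cmod a)\<^sup>2 + 2 * (cmod b)\<^sup>2"
    using sum_squares_bound[of "cmod a" "cmod b"] by (simp add: power2_sum)
  finally show ?thesis .
qed

lemma sqnorm_add:
  assumes [measurable]: "f \<in> borel_measurable M" "g \<in> borel_measurable M"
  shows "sqnorm M (\<lambda>x. f x + g x) \<le> 2 * sqnorm M f + 2 * sqnorm M g"
proof -
  have "sqnorm M (\<lambda>x. f x + g x) \<le> (\<integral>\<^sup>+x. 2 * ennreal ((cmod (f x))\<^sup>2) + 2 * ennreal ((cmod (g x))\<^sup>2) \<partial>M)"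
    unfolding sqnorm_def
  proof (intro nn_integral_mono)
    fix x
    have "2 * ennreal ((cmod (f x))\<^sup>2) + 2 * ennreal ((cmod (g x))\<^sup>2) = ennreal (2 * (cmod (f x))\<^sup>2 + 2 * (cmod (g x))\<^sup>2)"
      by (simp add: ennreal_mult)
    then show "ennreal ((cmod (f x + g x))\<^sup>2) \<le> 2 * ennreal ((cmod (f x))\<^sup>2) + 2 * ennreal ((cmod (g x))\<^sup>2)"
      using cmod_add_sq[of "f x" "g x"] by (simp only: ennreal_leI)
  qed
  also have "\<dots> = 2 * sqnorm M f + 2 * sqnorm M g"
    unfolding sqnorm_def by (subst nn_integral_add) (auto simp: nn_integral_cmult)
  finally show ?thesis .
qed

lemma sqnorm_scale:
  assumes [measurable]: "f \<in> borel_measurable M"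
  shows "sqnorm M (\<lambda>x. a * f x) = ennreal ((cmod a)\<^sup>2) * sqnorm M f"
  unfolding sqnorm_def by (simp add: norm_mult power_mult_distrib ennreal_mult nn_integral_cmult)

lemma L2_add [intro]:
  assumes "f \<in> L2_space M" "g \<in> L2_space M"
  shows "(\<lambda>x. f x + g x) \<in> L2_space M"
proof -
  have "sqnorm M (\<lambda>x. f x + g x) \<le> 2 * sqnorm M f + 2 * sqnorm M g"
    using assms by (intro sqnorm_add) auto
  also have "\<dots> < \<infinity>" using assms by (simp add: L2_space_iff ennreal_mult_less_top)
  finally show ?thesis using assms by (auto simp: L2_space_iff)
qed

lemma L2_scale [intro]:
  assumes "f \<in> L2_space M"
  shows "(\<lambda>x. a * f x) \<in> L2_space M"
  using assms by (auto simp: L2_space_iff sqnorm_scale ennreal_mult_less_top)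

lemma L2_zero [intro, simp]: "(\<lambda>x. 0) \<in> L2_space M"
  by (simp add: L2_space_iff sqnorm_def)

lemma L2_diff [intro]:
  assumes "f \<in> L2_space M" "g \<in> L2_space M"
  shows "(\<lambda>x. f x - g x) \<in> L2_space M"
  using L2_add[OF assms(1) L2_scale[OF assms(2), of "-1"]] by simp

lemma L2_sum [intro]:
  assumes "\<And>i. i \<in> I \<Longrightarrow> f i \<in> L2_space M"
  shows "(\<lambda>x. \<Sum>i\<in>I. f i x) \<in> L2_space M"
proof (cases "finite I")
  case True
  then show ?thesis using assms by (induction I rule: finite_induct) auto
qed auto

lemma sqnorm_mono:
  assumes "\<And>x. cmod (f x) \<le> cmod (g x)"
  shows "sqnorm M f \<le> sqnorm M g"
  unfolding sqnorm_def by (intro nn_integral_mono ennreal_leI power_mono assms) auto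

lemma L2_mono:
  assumes "g \<in> L2_space M" "f \<in> borel_measurable M" "\<And>x. cmod (f x) \<le> cmod (g x)"
  shows "f \<in> L2_space M"
  using assms sqnorm_mono[of f g M] by (auto simp: L2_space_iff order.strict_trans1)

definition restr :: "'a set \<Rightarrow> ('a \<Rightarrow> complex) \<Rightarrow> 'a \<Rightarrow> complex" where
  "restr S f = (\<lambda>x. indicator S x * f x)"

lemma restr_apply: "restr S f x = (if x \<in> S then f x else 0)"
  by (simp add: restr_def)

lemma restr_measurable [measurable]:
  assumes [measurable]: "S \<in> sets M" "f \<in> borel_measurable M"
  shows "restr S f \<in> borel_measurable M"
  unfolding restr_def by measurable

lemma L2_restr [intro]:
  assumes "f \<in> L2_space M" "S \<in> sets M"
  shows "restr S f \<in> L2_space M"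
  using assms by (intro L2_mono[OF assms(1)]) (auto simp: restr_apply)

lemma L2_bounded:
  assumes [measurable]: "f \<in> borel_measurable M" and "S \<in> sets M" "emeasure M S < \<infinity>"
    and b: "\<And>x. cmod (f x) \<le> B" and z: "\<And>x. x \<in> space M \<Longrightarrow> x \<notin> S \<Longrightarrow> f x = 0"
  shows "f \<in> L2_space M"
proof -
  have "sqnorm M f \<le> (\<integral>\<^sup>+x. ennreal (B\<^sup>2) * indicator S x \<partial>M)"
    unfolding sqnorm_def
  proof (intro nn_integral_mono)
    fix x assume "x \<in> space M"
    then show "ennreal ((cmod (f x))\<^sup>2) \<le> ennreal (B\<^sup>2) * indicator S x"
      using b[of x] z[of x] by (cases "x \<in> S") (auto intro!: ennreal_leI power_mono)
  qed
  also have "\<dots> = ennreal (B\<^sup>2) * emeasure M S" using assms by (simp add: nn_integral_cmult_indicator)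
  also have "\<dots> < \<infinity>" using assms by (simp add: ennreal_mult_less_top)
  finally show ?thesis using assms by (simp add: L2_space_iff)
qed

lemma L2_restr_L1:
  assumes f: "f \<in> L2_space M" and S: "S \<in> sets M"
  shows "(\<integral>\<^sup>+x. ennreal (cmod (f x)) * indicator S x \<partial>M)\<^sup>2 \<le> sqnorm M f * emeasure M S"
proof -
  have [measurable]: "f \<in> borel_measurable M" "S \<in> sets M" using f S by auto
  have "(\<integral>\<^sup>+x. ennreal (cmod (f x)) * indicator S x \<partial>M)\<^sup>2
     \<le> (\<integral>\<^sup>+x. (ennreal (cmod (f x)))\<^sup>2 \<partial>M) * (\<integral>\<^sup>+x. (indicator S x)\<^sup>2 \<partial>M)"
    by (rule Cauchy_Schwarz_nn_integral) auto
  also have "(\<lambda>x. (indicator S x :: ennreal)\<^sup>2) = indicator S" by (auto simp: indicator_def)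
  finally show ?thesis using S by (simp add: sqnorm_def ennreal_power)
qed

lemma L2_integrable_on_finite:
  assumes f: "f \<in> L2_space M" and S: "S \<in> sets M" "emeasure M S < \<infinity>"
  shows "integrable M (restr S f)"
proof -
  have [measurable]: "f \<in> borel_measurable M" "S \<in> sets M" using f S by auto
  have "(\<integral>\<^sup>+x. ennreal (cmod (f x)) * indicator S x \<partial>M)\<^sup>2 < \<infinity>"
    using L2_restr_L1[OF f S(1)] f S by (simp add: L2_space_iff ennreal_mult_less_top order.strict_trans1)
  then have "(\<integral>\<^sup>+x. ennreal (cmod (f x)) * indicator S x \<partial>M) < \<infinity>"
    by (simp add: power_less_top_ennreal)
  moreover have "(\<integral>\<^sup>+x. ennreal (cmod (restr S f x)) \<partial>M) = (\<integral>\<^sup>+x. ennreal (cmod (f x)) * indicator S x \<partial>M)"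
    by (intro nn_integral_cong) (auto simp: restr_apply)
  ultimately show ?thesis unfolding integrable_iff_bounded by auto
qed

text \<open>
  Division of a quadratic inequality by \<open>X\<close>. It fails for \<open>X = \<infinity>\<close>, so each application first has to
  prove that the quantity is finite, usually for a finite family of sets only.
\<close>

lemma ennreal_self_bound:
  fixes X c :: ennreal
  assumes "X < \<infinity>" "X\<^sup>2 \<le> c * X"
  shows "X \<le> c"
proof (cases "X = 0")
  case False
  have "X * X \<le> c * X" using assms(2) by (simp add: power2_eq_square)
  then show ?thesis using False assms(1)
    by (metis ennreal_mult_le_mult_iff infinity_ennreal_def mult.commute less_irrefl)
qed auto

section \<open>Bounded operators on square integrable functions\<close>

text \<open>
  The constant \<open>M\<close> bounds the square of the operator norm, which keeps square roots out of the
  extended nonnegative integrals.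
\<close>

locale L2_operator =
  fixes T :: "('a::euclidean_space \<Rightarrow> complex) \<Rightarrow> 'a \<Rightarrow> complex" and M :: real
  assumes lin: "linear_on_L2 T"
    and M_nonneg: "0 \<le> M"
    and T_L2: "f \<in> L2_space lborel \<Longrightarrow> T f \<in> L2_space lborel"
    and T_bound: "f \<in> L2_space lborel \<Longrightarrow> sqnorm lborel (T f) \<le> ennreal M * sqnorm lborel f"
begin

lemma T_measurable [measurable]: "f \<in> L2_space lborel \<Longrightarrow> T f \<in> borel_measurable borel"
  using T_L2[of f] by auto

lemma T_add:
  assumes "f \<in> L2_space lborel" "g \<in> L2_space lborel"
  shows "AE x in lborel. T (\<lambda>y. f y + g y) x = T f x + T g x"
  using lin assms unfolding linear_on_L2_def by blast

lemma T_scale: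
  assumes "f \<in> L2_space lborel"
  shows "AE x in lborel. T (\<lambda>y. a * f y) x = a * T f x"
  using lin assms unfolding linear_on_L2_def by blast

lemma T_diff:
  assumes "f \<in> L2_space lborel" "g \<in> L2_space lborel"
  shows "AE x in lborel. T (\<lambda>y. f y - g y) x = T f x - T g x"
  using T_add[OF assms(1) L2_scale[OF assms(2), of "-1"]] T_scale[OF assms(2), of "-1"]
  by eventually_elim simp

lemma T_null:
  assumes "f \<in> L2_space lborel" "AE x in lborel. f x = 0"
  shows "AE x in lborel. T f x = 0"
proof -
  have "sqnorm lborel f = (\<integral>\<^sup>+(x::'a). 0 \<partial>lborel)" unfolding sqnorm_def
    by (intro nn_integral_cong_AE eventually_mono[OF assms(2)]) simp
  then have "sqnorm lborel (T f) = 0" using T_bound[OF assms(1)] by simp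
  then show ?thesis unfolding sqnorm_def using T_measurable[OF assms(1)]
    by (subst (asm) nn_integral_0_iff_AE) auto
qed

lemma T_sum:
  assumes "finite I" "\<And>i. i \<in> I \<Longrightarrow> f i \<in> L2_space lborel"
  shows "AE x in lborel. T (\<lambda>y. \<Sum>i\<in>I. f i y) x = (\<Sum>i\<in>I. T (f i) x)"
  using assms
proof (induction I rule: finite_induct)
  case empty
  show ?case using T_null[of "\<lambda>x. 0"] by simp
next
  case (insert i I)
  have "AE x in lborel. T (\<lambda>y. f i y + (\<Sum>i\<in>I. f i y)) x = T (f i) x + T (\<lambda>y. \<Sum>i\<in>I. f i y) x"
    using insert by (intro T_add) auto
  moreover have "AE x in lborel. T (\<lambda>y. \<Sum>i\<in>I. f i y) x = (\<Sum>i\<in>I. T (f i) x)"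
    using insert by auto
  ultimately show ?case by eventually_elim (simp add: insert.hyps)
qed

text \<open>
  Every limit passes through \<open>T\<close> by means of this lemma: convergence of the arguments in the mean
  square sense is inherited by the images, and gives pointwise convergence along a subsequence.
\<close>

lemma T_AE_subseq:
  assumes f: "\<And>k. f k \<in> L2_space lborel" "g \<in> L2_space lborel"
    and lim: "(\<lambda>k. sqnorm lborel (\<lambda>x. f k x - g x)) \<longlonglongrightarrow> 0"
  obtains r where "strict_mono r" "AE x in lborel. (\<lambda>k. T (f (r k)) x) \<longlonglongrightarrow> T g x"
proof -
  define u where "u k x = (cmod (T (\<lambda>x. f k x - g x) x))\<^sup>2" for k x
  have L: "(\<lambda>x. f k x - g x) \<in> L2_space lborel" for k using f by auto
  have int: "integrable lborel (u k)" for k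
    using T_L2[OF L[of k]] unfolding u_def L2_space_def by auto
  have "(\<lambda>k. \<integral>\<^sup>+x. norm (u k x) \<partial>lborel) \<longlonglongrightarrow> 0"
  proof (rule tendsto_sandwich[OF _ _ tendsto_const])
    show "\<forall>\<^sub>F k in sequentially. (\<integral>\<^sup>+x. norm (u k x) \<partial>lborel) \<le> ennreal M * sqnorm lborel (\<lambda>x. f k x - g x)"
      using T_bound[OF L] unfolding u_def sqnorm_def by auto
    show "(\<lambda>k. ennreal M * sqnorm lborel (\<lambda>x. f k x - g x)) \<longlonglongrightarrow> 0"
      using ennreal_tendsto_cmult[OF _ lim, of "ennreal M"] by simp
  qed auto
  moreover have "(\<integral>\<^sup>+x. norm (u k x) \<partial>lborel) = ennreal (LINT x|lborel. norm (u k x))" for k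
    by (intro nn_integral_eq_integral integrable_norm int) auto
  ultimately have "(\<lambda>k. LINT x|lborel. norm (u k x)) \<longlonglongrightarrow> 0"
    by (simp add: ennreal_tendsto_0_iff)
  from tendsto_L1_AE_subseq[OF int this] obtain r where r: "strict_mono r" "AE x in lborel. (\<lambda>k. u (r k) x) \<longlonglongrightarrow> 0"
    by blast
  have "AE x in lborel. \<forall>k. T (\<lambda>x. f k x - g x) x = T (f k) x - T g x"
    using T_diff f by (subst AE_all_countable) auto
  with r(2) have "AE x in lborel. (\<lambda>k. T (f (r k)) x) \<longlonglongrightarrow> T g x"
  proof eventually_elim
    case (elim x)
    then have "(\<lambda>k. sqrt ((cmod (T (f (r k)) x - T g x))\<^sup>2)) \<longlonglongrightarrow> sqrt 0"
      unfolding u_def by (intro tendsto_real_sqrt) simp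
    then have "(\<lambda>k. T (f (r k)) x - T g x) \<longlonglongrightarrow> 0"
      by (simp add: tendsto_norm_zero_iff)
    then show ?case by (simp add: LIM_zero_iff)
  qed
  with r(1) show thesis using that by blast
qed

end

section \<open>Laminar families of sets\<close>

text \<open>
  The rank orders the family so that a set is contained in, or disjoint from, each set of smaller or
  equal rank. Adding the sets by increasing rank, a new set changes the union either not at all or by
  a disjoint piece.
\<close>

lemma laminar_weak_type:
  fixes B :: "'i \<Rightarrow> 'a set" and r :: "'i \<Rightarrow> nat"
  assumes "finite S" and "\<And>i. i \<in> S \<Longrightarrow> B i \<in> sets M"
    and "\<And>i j. \<lbrakk>i \<in> S; j \<in> S; r i \<le> r j\<rbrakk> \<Longrightarrow> B i \<inter> B j = {} \<or> B j \<subseteq> B i"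
    and f [measurable]: "f \<in> borel_measurable M"
    and "\<And>i. i \<in> S \<Longrightarrow> c * emeasure M (B i) \<le> (\<integral>\<^sup>+x. f x * indicator (B i) x \<partial>M)"
  shows "c * emeasure M (\<Union>i\<in>S. B i) \<le> (\<integral>\<^sup>+x. f x * indicator (\<Union>i\<in>S. B i) x \<partial>M)"
  using assms(1,2,3,5)
proof (induction S rule: finite_ranking_induct[where f = r])
  case (insert i S)
  let ?U = "\<Union>j\<in>S. B j"
  have [measurable]: "B i \<in> sets M" "?U \<in> sets M" using insert.prems insert.hyps by auto
  have IH: "c * emeasure M ?U \<le> (\<integral>\<^sup>+x. f x * indicator ?U x \<partial>M)"
    using insert.prems by (intro insert.IH) auto
  show ?case
  proof (cases "\<exists>j\<in>S. B i \<subseteq> B j")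
    case True
    then have "(\<Union>j\<in>insert i S. B j) = ?U" by auto
    then show ?thesis using IH by simp
  next
    case False
    then have dis: "B i \<inter> ?U = {}" using insert.hyps(2) insert.prems(2) by fastforce
    have ind: "(indicator (\<Union>j\<in>insert i S. B j) x :: ennreal) = indicator (B i) x + indicator ?U x" for x
      using dis by (cases "x \<in> B i"; cases "x \<in> ?U") auto
    have "c * emeasure M (\<Union>j\<in>insert i S. B j) = c * emeasure M (B i) + c * emeasure M ?U"
      using dis by (simp add: plus_emeasure[symmetric] distrib_left)
    also have "\<dots> \<le> (\<integral>\<^sup>+x. f x * indicator (B i) x \<partial>M) + (\<integral>\<^sup>+x. f x * indicator ?U x \<partial>M)"
      using IH insert.prems(3) by (intro add_mono) auto
    also have "\<dots> = (\<integral>\<^sup>+x. f x * indicator (\<Union>j\<in>insert i S. B j) x \<partial>M)"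
      unfolding ind by (simp add: distrib_left nn_integral_add)
    finally show ?thesis .
  qed
qed simp

definition laminar_max :: "('i \<Rightarrow> 'a set) \<Rightarrow> ('i \<Rightarrow> real) \<Rightarrow> 'i set \<Rightarrow> 'a \<Rightarrow> real" where
  "laminar_max B a S x = Max (insert 0 ((\<lambda>i. a i * indicator (B i) x) ` S))"

lemma laminar_max_insert:
  assumes "finite S"
  shows "laminar_max B a (insert i S) x = max (a i * indicator (B i) x) (laminar_max B a S x)"
  unfolding laminar_max_def using assms by (simp add: insert_commute[of 0])

lemma laminar_max_nonneg: "finite S \<Longrightarrow> 0 \<le> laminar_max B a S x"
  unfolding laminar_max_def by (intro Max_ge) auto

lemma laminar_max_ge: "finite S \<Longrightarrow> i \<in> S \<Longrightarrow> x \<in> B i \<Longrightarrow> a i \<le> laminar_max B a S x"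
  unfolding laminar_max_def by (intro Max_ge) (auto simp: image_iff intro!: bexI[of _ i])

lemma laminar_max_measurable:
  assumes "finite S" "\<And>i. i \<in> S \<Longrightarrow> B i \<in> sets M"
  shows "laminar_max B a S \<in> borel_measurable M"
  using assms
proof (induction S rule: finite_induct)
  case (insert i S)
  have "(\<lambda>x. max (a i * indicator (B i) x) (laminar_max B a S x)) \<in> borel_measurable M"
    using insert by (intro borel_measurable_max borel_measurable_times borel_measurable_indicator) auto
  then show ?case using laminar_max_insert[OF insert.hyps(1), of B a i] by (simp add: fun_eq_iff cong: measurable_cong)
qed (simp add: laminar_max_def[abs_def])

lemma laminar_max_finite:
  assumes "finite S" "\<And>i. i \<in> S \<Longrightarrow> B i \<in> sets M" "\<And>i. i \<in> S \<Longrightarrow> emeasure M (B i) < \<infinity>"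
  shows "(\<integral>\<^sup>+x. ennreal ((laminar_max B a S x)\<^sup>2) \<partial>M) < \<infinity>"
  using assms
proof (induction S rule: finite_induct)
  case (insert i S)
  have [measurable]: "B i \<in> sets M" using insert by auto
  have [measurable]: "laminar_max B a S \<in> borel_measurable M" using insert by (intro laminar_max_measurable) auto
  have "(\<integral>\<^sup>+x. ennreal ((laminar_max B a (insert i S) x)\<^sup>2) \<partial>M)
     \<le> (\<integral>\<^sup>+x. ennreal ((a i)\<^sup>2) * indicator (B i) x + ennreal ((laminar_max B a S x)\<^sup>2) \<partial>M)"
    by (intro nn_integral_mono)
       (auto simp: laminar_max_insert[OF insert.hyps(1)] max_def indicator_def simp flip: ennreal_plus)
  also have "\<dots> = ennreal ((a i)\<^sup>2) * emeasure M (B i) + (\<integral>\<^sup>+x. ennreal ((laminar_max B a S x)\<^sup>2) \<partial>M)"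
    by (subst nn_integral_add) (auto simp: nn_integral_cmult_indicator)
  also have "\<dots> < \<infinity>" using insert by (auto simp: ennreal_mult_less_top)
  finally show ?case .
qed (simp add: laminar_max_def)

text \<open>
  Doob's inequality without distribution functions. The sets are added by increasing rank. On a new
  set \<open>B\<close> the previous maximal function is a constant \<open>m\<close>, because every earlier set contains \<open>B\<close> or is
  disjoint from it. If the new value \<open>a\<close> exceeds \<open>m\<close>, the left hand side grows by \<open>(a\<^sup>2 - m\<^sup>2) \<mu>(B)\<close>, which
  is at most \<open>2 (a - m) a \<mu>(B)\<close>, while the right hand side grows by \<open>2 (a - m)\<close> times the integral of \<open>h\<close>
  over \<open>B\<close>.
\<close>

lemma laminar_max_square_le:
  fixes B :: "'i \<Rightarrow> 'a set" and r :: "'i \<Rightarrow> nat"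
  assumes "finite S" and "\<And>i. i \<in> S \<Longrightarrow> B i \<in> sets M"
    and "\<And>i j. \<lbrakk>i \<in> S; j \<in> S; r i \<le> r j\<rbrakk> \<Longrightarrow> B i \<inter> B j = {} \<or> B j \<subseteq> B i"
    and h [measurable]: "h \<in> borel_measurable M"
    and "\<And>i. i \<in> S \<Longrightarrow> 0 \<le> a i"
    and "\<And>i. i \<in> S \<Longrightarrow> ennreal (a i) * emeasure M (B i) \<le> (\<integral>\<^sup>+x. h x * indicator (B i) x \<partial>M)"
  shows "(\<integral>\<^sup>+x. ennreal ((laminar_max B a S x)\<^sup>2) \<partial>M) \<le> 2 * (\<integral>\<^sup>+x. h x * ennreal (laminar_max B a S x) \<partial>M)"
  using assms(1,2,3,5,6)
proof (induction S rule: finite_ranking_induct[where f = r])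
  case empty
  show ?case by (simp add: laminar_max_def)
next
  case (insert i S)
  show ?case
  proof (cases "i \<in> S")
    case True
    then show ?thesis using insert.IH insert.prems by (simp add: insert_absorb)
  next
    case False
    have [measurable]: "B i \<in> sets M" using insert.prems by auto
    have m [measurable]: "laminar_max B a S \<in> borel_measurable M"
      using insert by (intro laminar_max_measurable) auto
    have IH: "(\<integral>\<^sup>+x. ennreal ((laminar_max B a S x)\<^sup>2) \<partial>M) \<le> 2 * (\<integral>\<^sup>+x. h x * ennreal (laminar_max B a S x) \<partial>M)"
      using insert.prems by (intro insert.IH) auto
    have const: "laminar_max B a S x = laminar_max B a S y" if "x \<in> B i" "y \<in> B i" for x y
    proof -
      have "(\<lambda>j. a j * indicator (B j) x) ` S = (\<lambda>j. a j * indicator (B j) y) ` S"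
        using insert.hyps(2) insert.prems(2) that by (intro image_cong) (fastforce simp: indicator_def)+
      then show ?thesis unfolding laminar_max_def by simp
    qed
    (* The constant value of the previous maximal function on the new set; any value will do if the
       set is empty. *)
    obtain \<mu> where \<mu>: "0 \<le> \<mu>" "\<And>x. x \<in> B i \<Longrightarrow> laminar_max B a S x = \<mu>"
    proof (cases "B i = {}")
      case True
      then show thesis using that[of 0] by auto
    next
      case False
      then obtain z where "z \<in> B i" by auto
      show thesis
      proof (rule that)
        show "0 \<le> laminar_max B a S z" using insert.hyps(1) by (rule laminar_max_nonneg)
        show "laminar_max B a S x = laminar_max B a S z" if "x \<in> B i" for x
          using that \<open>z \<in> B i\<close> by (rule const)
      qed
    qed
    define e where "e = max 0 (a i - \<mu>)"
    have e0: "0 \<le> e" by (simp add: e_def)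
    have ai: "0 \<le> a i" using insert.prems by auto
    have new: "laminar_max B a (insert i S) x = laminar_max B a S x + e * indicator (B i) x" for x
      using \<mu>(2)[of x] laminar_max_nonneg[OF insert.hyps(1), of B a x]
      by (auto simp: laminar_max_insert[OF insert.hyps(1)] e_def indicator_def max_def)
    have newsq: "(laminar_max B a (insert i S) x)\<^sup>2 = (laminar_max B a S x)\<^sup>2 + (2 * \<mu> * e + e\<^sup>2) * indicator (B i) x" for x
      using \<mu>(2)[of x] unfolding new by (auto simp: indicator_def power2_sum)
    have gain: "2 * \<mu> * e + e\<^sup>2 \<le> 2 * e * a i"
    proof (cases "e = 0")
      case False
      then have "a i = \<mu> + e" by (auto simp: e_def max_def split: if_splits)
      then show ?thesis by (simp add: algebra_simps power2_eq_square)
    qed simp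
    have "(\<integral>\<^sup>+x. ennreal ((laminar_max B a (insert i S) x)\<^sup>2) \<partial>M)
        = (\<integral>\<^sup>+x. ennreal ((laminar_max B a S x)\<^sup>2) + ennreal (2 * \<mu> * e + e\<^sup>2) * indicator (B i) x \<partial>M)"
      using \<mu>(1) e0 by (intro nn_integral_cong) (auto simp: newsq indicator_def simp flip: ennreal_plus)
    also have "\<dots> = (\<integral>\<^sup>+x. ennreal ((laminar_max B a S x)\<^sup>2) \<partial>M) + ennreal (2 * \<mu> * e + e\<^sup>2) * emeasure M (B i)"
      by (subst nn_integral_add) (auto simp: nn_integral_cmult_indicator)
    also have "\<dots> \<le> 2 * (\<integral>\<^sup>+x. h x * ennreal (laminar_max B a S x) \<partial>M) + 2 * (ennreal e * (\<integral>\<^sup>+x. h x * indicator (B i) x \<partial>M))"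
    proof (intro add_mono IH)
      have "ennreal (2 * \<mu> * e + e\<^sup>2) * emeasure M (B i) \<le> ennreal (2 * e * a i) * emeasure M (B i)"
        using gain by (intro mult_right_mono ennreal_leI) auto
      also have "\<dots> = 2 * (ennreal e * (ennreal (a i) * emeasure M (B i)))"
        using e0 ai by (simp add: ennreal_mult mult.assoc)
      also have "\<dots> \<le> 2 * (ennreal e * (\<integral>\<^sup>+x. h x * indicator (B i) x \<partial>M))"
        using insert.prems by (intro mult_left_mono) auto
      finally show "ennreal (2 * \<mu> * e + e\<^sup>2) * emeasure M (B i) \<le> \<dots>" .
    qed
    also have "\<dots> = 2 * (\<integral>\<^sup>+x. h x * ennreal (laminar_max B a S x) + ennreal e * (h x * indicator (B i) x) \<partial>M)"
      by (subst nn_integral_add) (auto simp: nn_integral_cmult distrib_left)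
    also have "(\<integral>\<^sup>+x. h x * ennreal (laminar_max B a S x) + ennreal e * (h x * indicator (B i) x) \<partial>M)
        = (\<integral>\<^sup>+x. h x * ennreal (laminar_max B a (insert i S) x) \<partial>M)"
      using e0 laminar_max_nonneg[OF insert.hyps(1), of B a]
      by (intro nn_integral_cong) (auto simp: new indicator_def ennreal_plus distrib_left mult.commute)
    finally show ?thesis .
  qed
qed

text \<open>
  The constant is the same for all measures. This is what allows maximal functions with respect to
  \<open>w dx\<close> and \<open>w\<^sup>-\<^sup>1 dx\<close> without any loss in the weight.
\<close>

lemma laminar_maximal:
  fixes B :: "'i \<Rightarrow> 'a set" and r :: "'i \<Rightarrow> nat"
  assumes S: "finite S" "\<And>i. i \<in> S \<Longrightarrow> B i \<in> sets M" "\<And>i. i \<in> S \<Longrightarrow> emeasure M (B i) < \<infinity>"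
    and lam: "\<And>i j. \<lbrakk>i \<in> S; j \<in> S; r i \<le> r j\<rbrakk> \<Longrightarrow> B i \<inter> B j = {} \<or> B j \<subseteq> B i"
    and h [measurable]: "h \<in> borel_measurable M"
    and a: "\<And>i. i \<in> S \<Longrightarrow> 0 \<le> a i"
      "\<And>i. i \<in> S \<Longrightarrow> ennreal (a i) * emeasure M (B i) \<le> (\<integral>\<^sup>+x. h x * indicator (B i) x \<partial>M)"
  shows "(\<integral>\<^sup>+x. ennreal ((laminar_max B a S x)\<^sup>2) \<partial>M) \<le> 4 * (\<integral>\<^sup>+x. (h x)\<^sup>2 \<partial>M)"
proof (rule ennreal_self_bound)
  let ?X = "\<integral>\<^sup>+x. ennreal ((laminar_max B a S x)\<^sup>2) \<partial>M"
  show "?X < \<infinity>" using S by (rule laminar_max_finite)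
  have [measurable]: "laminar_max B a S \<in> borel_measurable M"
    using S by (intro laminar_max_measurable) auto
  have "?X\<^sup>2 \<le> (2 * (\<integral>\<^sup>+x. h x * ennreal (laminar_max B a S x) \<partial>M))\<^sup>2"
    by (intro power_mono laminar_max_square_le[OF S(1,2) lam h a]) auto
  also have "\<dots> = 4 * (\<integral>\<^sup>+x. h x * ennreal (laminar_max B a S x) \<partial>M)\<^sup>2"
    by (simp add: power_mult_distrib)
  also have "\<dots> \<le> 4 * ((\<integral>\<^sup>+x. (h x)\<^sup>2 \<partial>M) * (\<integral>\<^sup>+x. (ennreal (laminar_max B a S x))\<^sup>2 \<partial>M))"
    by (intro mult_left_mono Cauchy_Schwarz_nn_integral) auto
  also have "\<dots> = 4 * (\<integral>\<^sup>+x. (h x)\<^sup>2 \<partial>M) * ?X"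
    using laminar_max_nonneg[OF S(1), of B a] by (simp only: ennreal_power mult.assoc)
  finally show "?X\<^sup>2 \<le> 4 * (\<integral>\<^sup>+x. (h x)\<^sup>2 \<partial>M) * ?X" .
qed

section \<open>Dyadic cells and their triples\<close>

text \<open>
  A cell is encoded by its generation and its integer position. Passing to an ancestor is then integer
  division of the position by a power of two, and the nesting of cells is arithmetic.
\<close>

type_synonym 'd cell = "nat \<times> ('d \<Rightarrow> int)"

lemma half_open_box:
  fixes a :: "'d::finite \<Rightarrow> real" and s :: real
  assumes s: "0 \<le> s"
  shows "{x :: real ^ 'd. \<forall>i. a i \<le> x $ i \<and> x $ i < a i + s} \<in> sets borel" (is ?m)
    and "emeasure lborel {x :: real ^ 'd. \<forall>i. a i \<le> x $ i \<and> x $ i < a i + s} = ennreal (s ^ CARD('d))" (is ?e)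
    and "emeasure lborel (cbox (\<chi> i. a i) (\<chi> i. a i + s) :: (real ^ 'd) set) = ennreal (s ^ CARD('d))" (is ?c)
proof -
  let ?S = "{x :: real ^ 'd. \<forall>i. a i \<le> x $ i \<and> x $ i < a i + s}"
  let ?a = "\<chi> i. a i" and ?b = "\<chi> i. a i + s"
  have "?S = (\<Inter>i. {x. a i \<le> x $ i} \<inter> {x. x $ i < a i + s})" by auto
  also have "\<dots> \<in> sets borel"
    by (intro sets.countable_INT'' sets.Int) (auto intro!: borel_closed borel_open closed_Collect_le open_Collect_less continuous_intros)
  finally show m: ?m .
  have ba: "(?b - ?a) \<bullet> b = s" if "b \<in> Basis" for b :: "real ^ 'd"
    using that by (auto simp: Basis_vec_def inner_axis)
  have le: "?a \<bullet> b \<le> ?b \<bullet> b" if "b \<in> Basis" for b :: "real ^ 'd"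
    using ba[OF that] s by (simp add: inner_diff_left)
  have p: "(\<Prod>b\<in>Basis. (?b - ?a) \<bullet> b) = s ^ CARD('d)"
    using ba by (simp cong: prod.cong)
  show c: ?c using le p by (simp add: emeasure_lborel_cbox_eq)
  have o: "emeasure lborel (box ?a ?b) = ennreal (s ^ CARD('d))"
    using le p by (simp add: emeasure_lborel_box_eq)
  have "box ?a ?b \<subseteq> ?S" "?S \<subseteq> cbox ?a ?b" by (auto simp: mem_box_cart less_le)
  then show ?e using c o m
    by (metis (no_types, lifting) antisym emeasure_mono sets_lborel borel_closed closed_cbox)
qed

locale grid =
  fixes L :: real
  assumes L_pos: "0 < L"
begin

text \<open>
  The shift by \<open>1 / 2\<close> centres the cell \<open>(0, 0)\<close> at the origin. In an unshifted dyadic grid no cell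
  contains a neighbourhood of the origin, so that no cell would contain the support of a given
  function.
\<close>

definition coord :: "nat \<Rightarrow> real ^ 'd \<Rightarrow> 'd \<Rightarrow> int" where
  "coord n x i = \<lfloor>2 ^ n * (x $ i / L + 1 / 2)\<rfloor>"

definition side :: "nat \<Rightarrow> real" where "side n = L / 2 ^ n"

definition cell :: "'d cell \<Rightarrow> (real ^ 'd) set" where
  "cell P = {x. coord (fst P) x = snd P}"

definition triple :: "'d cell \<Rightarrow> (real ^ 'd) set" where
  "triple P = {x. \<forall>i. \<bar>coord (fst P) x i - snd P i\<bar> \<le> 1}"

definition anc :: "nat \<Rightarrow> 'd cell \<Rightarrow> 'd cell" where
  "anc k P = (k, \<lambda>i. snd P i div 2 ^ (fst P - k))"

lemma side_pos: "0 < side n" using L_pos by (simp add: side_def)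

lemma side_Suc: "side n = 2 * side (Suc n)" by (simp add: side_def)

lemma side_diff: "k \<le> n \<Longrightarrow> side k = 2 ^ (n - k) * side n"
  by (simp add: side_def power_diff)

lemma fst_anc [simp]: "fst (anc k P) = k" by (simp add: anc_def)

lemma coord_iff: "coord n x i = m \<longleftrightarrow> side n * m - L / 2 \<le> x $ i \<and> x $ i < side n * m - L / 2 + side n"
proof -
  have s: "0 < side n" by (rule side_pos)
  have e: "2 ^ n * (x $ i / L + 1 / 2) = (x $ i + L / 2) / side n"
    using L_pos by (simp add: side_def field_simps)
  show ?thesis unfolding coord_def e floor_eq_iff using s
    by (auto simp: le_divide_eq divide_less_eq algebra_simps)
qed

lemma coord_range: "a \<le> coord n x i \<and> coord n x i < b \<longleftrightarrow> side n * a - L / 2 \<le> x $ i \<and> x $ i < side n * b - L / 2"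
proof -
  have s: "0 < side n" by (rule side_pos)
  have e: "2 ^ n * (x $ i / L + 1 / 2) = (x $ i + L / 2) / side n"
    using L_pos by (simp add: side_def field_simps)
  show ?thesis unfolding coord_def e le_floor_iff floor_less_iff using s
    by (auto simp: le_divide_eq divide_less_eq algebra_simps)
qed

lemma coord_bounds: "side n * coord n x i - L / 2 \<le> x $ i" "x $ i < side n * coord n x i - L / 2 + side n"
  using coord_iff[of n x i "coord n x i"] by auto

lemma cell_eq: "cell P = {x. \<forall>i. side (fst P) * snd P i - L / 2 \<le> x $ i \<and> x $ i < side (fst P) * snd P i - L / 2 + side (fst P)}"
  unfolding cell_def fun_eq_iff coord_iff by simp

lemma triple_eq: "triple (P :: ('d::finite) cell) = {x. \<forall>i. side (fst P) * (snd P i - 1) - L / 2 \<le> x $ i \<and>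
     x $ i < side (fst P) * (snd P i - 1) - L / 2 + 3 * side (fst P)}"
proof -
  have "\<bar>coord n x i - m\<bar> \<le> 1 \<longleftrightarrow> side n * (m - 1) - L / 2 \<le> x $ i \<and> x $ i < side n * (m - 1) - L / 2 + 3 * side n"
    for n and x :: "real ^ 'd" and i m
  proof -
    have "\<bar>coord n x i - m\<bar> \<le> 1 \<longleftrightarrow> m - 1 \<le> coord n x i \<and> coord n x i < m + 2" by auto
    also have "\<dots> \<longleftrightarrow> side n * (m - 1) - L / 2 \<le> x $ i \<and> x $ i < side n * (m - 1) - L / 2 + 3 * side n"
      unfolding coord_range by (simp add: algebra_simps)
    finally show ?thesis .
  qed
  then show ?thesis unfolding triple_def by simp
qed

lemma cell_sets [measurable, simp]: "cell P \<in> sets borel"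
  unfolding cell_eq by (rule half_open_box) (rule less_imp_le[OF side_pos])

lemma triple_sets [measurable, simp]: "triple P \<in> sets borel"
  unfolding triple_eq using less_imp_le[OF side_pos[of "fst P"]] by (intro half_open_box) auto

lemma emeasure_cell: "emeasure lborel (cell P :: (real ^ 'd) set) = ennreal (side (fst P) ^ CARD('d))"
  unfolding cell_eq by (rule half_open_box) (rule less_imp_le[OF side_pos])

lemma emeasure_triple: "emeasure lborel (triple P :: (real ^ 'd) set) = ennreal ((3 * side (fst P)) ^ CARD('d))"
  unfolding triple_eq using less_imp_le[OF side_pos[of "fst P"]] by (intro half_open_box) auto

definition triple_cube :: "'d cell \<Rightarrow> (real ^ 'd) set" where
  "triple_cube P = cbox (\<chi> i. side (fst P) * (snd P i - 1) - L / 2) (\<chi> i. side (fst P) * (snd P i - 1) - L / 2 + 3 * side (fst P))"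

lemma triple_cube_cubes: "triple_cube P \<in> cubes"
proof -
  have "triple_cube P = cbox (\<chi> i. side (fst P) * (snd P i - 1) - L / 2)
     (\<chi> i. (\<chi> i. side (fst P) * (snd P i - 1) - L / 2) $ i + 3 * side (fst P))"
    by (simp add: triple_cube_def)
  then show ?thesis unfolding cubes_def using side_pos[of "fst P"] by fastforce
qed

lemma triple_subset_cube: "triple P \<subseteq> triple_cube P"
  unfolding triple_eq triple_cube_def by (auto simp: mem_box_cart less_le)

lemma emeasure_triple_cube: "emeasure lborel (triple_cube P :: (real ^ 'd) set) = ennreal ((3 * side (fst P)) ^ CARD('d))"
  unfolding triple_cube_def using less_imp_le[OF side_pos[of "fst P"]] by (intro half_open_box) auto

lemma bounded_triple: "bounded (triple P)"
  using triple_subset_cube[of P] bounded_subset[OF bounded_cbox] unfolding triple_cube_def by blast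

lemma cell_subset_triple: "cell P \<subseteq> triple P"
  by (auto simp: cell_def triple_def)

lemma cell_coord: "x \<in> cell (n, coord n x)" by (simp add: cell_def)

lemma cell_coordD: "x \<in> cell P \<Longrightarrow> P = (fst P, coord (fst P) x)" by (simp add: cell_def prod_eq_iff)

lemma coord_anc:
  assumes "k \<le> n"
  shows "coord k x i = coord n x i div 2 ^ (n - k)"
proof -
  have "2 ^ k * (x $ i / L + 1 / 2) = 2 ^ n * (x $ i / L + 1 / 2) / real_of_int (2 ^ (n - k))"
    using assms power_add[of "2::real" k "n - k"] by simp
  then show ?thesis unfolding coord_def by (simp only: floor_divide_real_eq_div zero_le_power zero_le_numeral)
qed

lemma anc_coord: "k \<le> n \<Longrightarrow> anc k (n, coord n x) = (k, coord k x)"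
  by (simp add: anc_def coord_anc[of k n] fun_eq_iff)

lemma cell_anc: "k \<le> fst P \<Longrightarrow> cell P \<subseteq> cell (anc k P)"
  by (auto simp: cell_def anc_def coord_anc[of k "fst P"] fun_eq_iff)

lemma anc_self [simp]: "anc (fst P) P = P" by (simp add: anc_def prod_eq_iff)

lemma cell_nested:
  assumes "x \<in> cell P" "x \<in> cell R" "fst P \<le> fst R"
  shows "anc (fst P) R = P"
  using assms by (metis anc_coord cell_coordD)

lemma int_div_close:
  fixes c m :: int
  assumes "\<bar>c - m\<bar> \<le> 1" "0 < J"
  shows "\<bar>c div J - m div J\<bar> \<le> 1"
proof -
  have "c div J \<le> (m + 1 * J) div J" using assms by (intro zdiv_mono1) auto
  moreover have "m div J \<le> (c + 1 * J) div J" using assms by (intro zdiv_mono1) auto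
  ultimately show ?thesis using assms by simp
qed

lemma triple_anc: "k \<le> fst P \<Longrightarrow> triple P \<subseteq> triple (anc k P)"
  by (auto simp: triple_def anc_def coord_anc[of k "fst P"] intro!: int_div_close)

lemma triple_subset_ancestor:
  assumes "cell R \<subseteq> cell P" "fst P \<le> fst R" "cell R \<noteq> {}"
  shows "triple R \<subseteq> triple P"
proof -
  obtain x where "x \<in> cell R" using assms by auto
  then have "anc (fst P) R = P" using assms by (intro cell_nested[of x]) auto
  then show ?thesis using triple_anc[OF assms(2)] by simp
qed

lemma cell_diff: "x \<in> cell P \<Longrightarrow> y \<in> cell P \<Longrightarrow> \<bar>x $ i - y $ i\<bar> < side (fst P)"
  using coord_bounds[where n = "fst P" and x = x and i = i] coord_bounds[where n = "fst P" and x = y and i = i] by (simp add: cell_def)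

lemma cell_norm_diff:
  assumes "x \<in> cell P" "y \<in> cell P"
  shows "norm (x - y :: real ^ 'd) \<le> CARD('d) * side (fst P)"
proof -
  have "norm (x - y) \<le> (\<Sum>i\<in>UNIV. \<bar>(x - y) $ i\<bar>)" by (rule norm_le_l1_cart)
  also have "\<dots> \<le> (\<Sum>i\<in>(UNIV :: 'd set). side (fst P))"
    using cell_diff[OF assms] by (intro sum_mono) (simp add: less_imp_le)
  finally show ?thesis by simp
qed

text \<open>
  The reason for working with triples: outside of the triple the distance to the cell is at least
  the side length.
\<close>

lemma triple_far:
  assumes "x \<in> cell P" "y \<notin> triple P"
  shows "side (fst P) \<le> norm (x - y)"
proof -
  obtain i where i: "\<not> \<bar>coord (fst P) y i - snd P i\<bar> \<le> 1" using assms(2) by (auto simp: triple_def)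
  have x: "coord (fst P) x i = snd P i" using assms(1) by (simp add: cell_def)
  let ?s = "side (fst P)"
  have s: "0 < ?s" by (rule side_pos)
  have "?s \<le> \<bar>x $ i - y $ i\<bar>"
  proof (cases "coord (fst P) y i \<ge> snd P i + 2")
    case True
    then have "?s * (snd P i + 2) \<le> ?s * coord (fst P) y i" using s by (intro mult_left_mono) linarith+
    then show ?thesis using coord_bounds[where n = "fst P" and x = x and i = i] coord_bounds[where n = "fst P" and x = y and i = i] x by (simp add: algebra_simps)
  next
    case False
    then have "coord (fst P) y i + 2 \<le> snd P i" using i by linarith
    then have "?s * (coord (fst P) y i + 2) \<le> ?s * snd P i" using s by (intro mult_left_mono) linarith+
    then show ?thesis using coord_bounds[where n = "fst P" and x = x and i = i] coord_bounds[where n = "fst P" and x = y and i = i] x by (simp add: algebra_simps)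
  qed
  also have "\<dots> \<le> norm (x - y)" using component_le_norm_cart[of "x - y" i] by simp
  finally show ?thesis .
qed

text \<open>
  The maximal cells with property \<open>Sel\<close> among those of generation at least \<open>n0\<close>.
\<close>

definition stopping :: "nat \<Rightarrow> ('d cell \<Rightarrow> bool) \<Rightarrow> 'd cell set" where
  "stopping n0 Sel = {P. n0 \<le> fst P \<and> Sel P \<and> (\<forall>k. n0 \<le> k \<longrightarrow> k < fst P \<longrightarrow> \<not> Sel (anc k P))}"

lemma stopping_disjoint:
  assumes "P \<in> stopping n0 Sel" "R \<in> stopping n0 Sel" "x \<in> cell P" "x \<in> cell R"
  shows "P = R"
proof -
  have *: "fst P = fst R" if "P \<in> stopping n0 Sel" "R \<in> stopping n0 Sel" "x \<in> cell P" "x \<in> cell R" "fst P \<le> fst R" for P R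
    using that cell_nested[of x P R] by (auto simp: stopping_def order_le_less)
  have "fst P = fst R" using *[of P R] *[of R P] assms by (cases "fst P \<le> fst R") auto
  then show ?thesis using assms(3,4) by (simp add: cell_def prod_eq_iff)
qed

lemma stopping_disjoint_family: "disjoint_family_on cell (stopping n0 Sel)"
  using stopping_disjoint unfolding disjoint_family_on_def by blast

lemma stopping_covers:
  assumes "n0 \<le> n" "Sel (n, coord n x)"
  obtains P where "P \<in> stopping n0 Sel" "x \<in> cell P"
proof -
  define N where "N = (LEAST n. n0 \<le> n \<and> Sel (n, coord n x))"
  have N: "n0 \<le> N \<and> Sel (N, coord N x)" unfolding N_def by (rule LeastI[of _ n]) (use assms in auto)
  have "\<not> Sel (k, coord k x)" if "n0 \<le> k" "k < N" for k
    using not_less_Least[of k "\<lambda>n. n0 \<le> n \<and> Sel (n, coord n x)"] that unfolding N_def by auto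
  then have "(N, coord N x) \<in> stopping n0 Sel" using N by (auto simp: stopping_def anc_coord)
  then show thesis using that cell_coord by blast
qed

text \<open>
  The parent of a stopping cell is not selected, which gives upper bounds on stopping cells.
\<close>

lemma stopping_parent:
  assumes "P \<in> stopping n0 Sel" and "\<And>R. fst R = n0 \<Longrightarrow> cell P \<subseteq> cell R \<Longrightarrow> \<not> Sel R"
  obtains n where "n0 \<le> n" "fst P = Suc n" "\<not> Sel (anc n P)"
proof -
  have P: "n0 \<le> fst P" "Sel P" using assms(1) by (auto simp: stopping_def)
  have "fst P \<noteq> n0" using assms(2)[of P] P by auto
  then obtain n where "fst P = Suc n" "n0 \<le> n" using P by (metis Suc_le_D le_neq_implies_less less_Suc_eq_le Suc_leI)
  then show thesis using that[of n] assms(1) by (auto simp: stopping_def)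
qed

lemma exists_small_cell:
  fixes x :: "real ^ 'd"
  assumes "open U" "x \<in> U"
  obtains n where "n0 \<le> n" "cell (n, coord n x) \<subseteq> U"
proof -
  obtain e where e: "0 < e" "ball x e \<subseteq> U" using assms openE by blast
  obtain n where n: "real CARD('d) * L / e < 2 ^ n" using real_arch_pow[of 2] by auto
  have "cell (n0 + n, coord (n0 + n) x) \<subseteq> ball x e"
  proof
    fix y assume y: "y \<in> cell (n0 + n, coord (n0 + n) x)"
    have "norm (x - y) \<le> CARD('d) * side (n0 + n)" using cell_norm_diff[OF cell_coord y] by simp
    also have "\<dots> \<le> CARD('d) * side n"
      using L_pos by (intro mult_left_mono) (auto simp: side_def intro!: divide_left_mono power_increasing)
    also have "\<dots> < e" using n e by (simp add: side_def field_simps)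
    finally show "y \<in> ball x e" by (simp add: dist_norm)
  qed
  then show thesis using that[of "n0 + n"] e by auto
qed

lemma nn_integral_cells:
  fixes F :: "('d::finite) cell set"
  assumes [measurable]: "f \<in> borel_measurable borel" and "disjoint_family_on cell F"
  shows "(\<integral>\<^sup>+x. f x * indicator (\<Union>P\<in>F. cell P) x \<partial>lborel) = (\<integral>\<^sup>+P. (\<integral>\<^sup>+x. f x * indicator (cell P) x \<partial>lborel) \<partial>count_space F)"
proof -
  have "emeasure (density lborel f) (\<Union>P\<in>F. cell P) = (\<integral>\<^sup>+P. emeasure (density lborel f) (cell P) \<partial>count_space F)"
    using assms by (intro emeasure_UN_countable) auto
  moreover have "(\<Union>P\<in>F. cell P) \<in> sets borel" by (intro sets.countable_UN') auto
  ultimately show ?thesis by (simp add: emeasure_density)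
qed

lemma emeasure_cells:
  fixes F :: "('d::finite) cell set"
  assumes "disjoint_family_on cell F"
  shows "emeasure lborel (\<Union>P\<in>F. cell P) = (\<integral>\<^sup>+P. emeasure lborel (cell P) \<partial>count_space F)"
  using assms by (intro emeasure_UN_countable) auto

lemma cells_sets [measurable, simp]: "(\<Union>P\<in>(F :: ('d::finite) cell set). cell P) \<in> sets borel"
  by (intro sets.countable_UN') auto

text \<open>
  Let \<open>U\<close> be an open set that contains \<open>S\<close> and is hardly larger. The maximal cells that lie in \<open>U\<close> and
  meet \<open>S\<close> are disjoint and cover \<open>S\<close>, and on each of them the average of \<open>f\<close> is at most \<open>c\<close>.
\<close>

lemma dyadic_average_integral:
  fixes f :: "real ^ 'd \<Rightarrow> ennreal"
  assumes [measurable]: "f \<in> borel_measurable borel" and S: "S \<in> sets borel" "emeasure lborel S < \<infinity>"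
    and c: "0 \<le> c"
    and av: "\<And>x n. x \<in> S \<Longrightarrow> n0 \<le> n \<Longrightarrow> (\<integral>\<^sup>+y. f y * indicator (cell (n, coord n x)) y \<partial>lborel)
        \<le> ennreal c * emeasure lborel (cell (n, coord n x) :: (real ^ 'd) set)"
  shows "(\<integral>\<^sup>+x. f x * indicator S x \<partial>lborel) \<le> ennreal c * emeasure lborel S"
proof (rule ennreal_le_epsilon)
  fix e :: real assume e: "0 < e"
  define \<eta> where "\<eta> = e / (c + 1)"
  have \<eta>: "0 < \<eta>" "c * \<eta> \<le> e" using e c by (auto simp: \<eta>_def field_simps)
  obtain U where U: "open U" "S \<subseteq> U" "emeasure lborel (U - S) < ennreal \<eta>"
    using outer_regular_lborel[OF S(1), of \<eta>] \<eta>(1) by blast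
  define Sel where "Sel P \<longleftrightarrow> cell P \<subseteq> U \<and> cell P \<inter> S \<noteq> {}" for P :: "'d cell"
  define F where "F = stopping n0 Sel"
  have dF: "disjoint_family_on cell F" unfolding F_def by (rule stopping_disjoint_family)
  have SF: "S \<subseteq> (\<Union>P\<in>F. cell P)"
  proof
    fix x assume x: "x \<in> S"
    then obtain n where n: "n0 \<le> n" "cell (n, coord n x) \<subseteq> U" using exists_small_cell[OF U(1), of x n0] U(2) by blast
    then have "Sel (n, coord n x)" using x cell_coord[of x n] by (auto simp: Sel_def)
    then show "x \<in> (\<Union>P\<in>F. cell P)" using stopping_covers[of n0 n Sel x] n unfolding F_def by blast
  qed
  have FU: "(\<Union>P\<in>F. cell P) \<subseteq> U" unfolding F_def stopping_def Sel_def by auto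
  have avF: "(\<integral>\<^sup>+y. f y * indicator (cell P) y \<partial>lborel) \<le> ennreal c * emeasure lborel (cell P)" if "P \<in> F" for P
  proof -
    obtain x where x: "x \<in> cell P" "x \<in> S" "n0 \<le> fst P" using \<open>P \<in> F\<close> unfolding F_def stopping_def Sel_def by auto
    then show ?thesis using av[of x "fst P"] cell_coordD[OF x(1)] by metis
  qed
  have "(\<integral>\<^sup>+x. f x * indicator S x \<partial>lborel) \<le> (\<integral>\<^sup>+x. f x * indicator (\<Union>P\<in>F. cell P) x \<partial>lborel)"
    using SF by (intro nn_integral_mono mult_left_mono) (auto simp: indicator_def)
  also have "\<dots> = (\<integral>\<^sup>+P. (\<integral>\<^sup>+x. f x * indicator (cell P) x \<partial>lborel) \<partial>count_space F)"
    using dF by (intro nn_integral_cells) auto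
  also have "\<dots> \<le> (\<integral>\<^sup>+P. ennreal c * emeasure lborel (cell P) \<partial>count_space F)"
    using avF by (intro nn_integral_mono) auto
  also have "\<dots> = ennreal c * emeasure lborel (\<Union>P\<in>F. cell P)"
    by (simp add: nn_integral_cmult emeasure_cells[OF dF])
  also have "\<dots> \<le> ennreal c * emeasure lborel U"
    using FU U(1) by (intro mult_left_mono emeasure_mono) auto
  also have "emeasure lborel U = emeasure lborel S + emeasure lborel (U - S)"
    using U S by (subst plus_emeasure) (auto intro!: arg_cong[where f = "emeasure lborel"])
  also have "ennreal c * \<dots> \<le> ennreal c * (emeasure lborel S + ennreal \<eta>)"
    using U(3) by (intro mult_left_mono add_left_mono) auto
  also have "\<dots> = ennreal c * emeasure lborel S + ennreal (c * \<eta>)" using c \<eta> by (simp add: distrib_left ennreal_mult)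
  also have "\<dots> \<le> ennreal c * emeasure lborel S + ennreal e" using \<eta> by (intro add_left_mono ennreal_leI)
  finally show "(\<integral>\<^sup>+x. f x * indicator S x \<partial>lborel) \<le> ennreal c * emeasure lborel S + ennreal e" .
qed

text \<open>
  The half of Lebesgue's differentiation theorem that the stopping arguments use. For \<open>f = \<bar>F\<bar>\<close> it
  bounds \<open>F\<close> off the stopping cells; for an indicator function it shows that the stopping cells defined
  by a density cover almost all of the set.
\<close>

lemma dyadic_average_AE:
  fixes f :: "real ^ 'd \<Rightarrow> ennreal"
  assumes [measurable]: "f \<in> borel_measurable borel" "S \<in> sets borel"
    and c: "0 \<le> c"
    and av: "\<And>x n. x \<in> S \<Longrightarrow> n0 \<le> n \<Longrightarrow> (\<integral>\<^sup>+y. f y * indicator (cell (n, coord n x)) y \<partial>lborel)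
        \<le> ennreal c * emeasure lborel (cell (n, coord n x) :: (real ^ 'd) set)"
  shows "AE x in lborel. x \<in> S \<longrightarrow> f x \<le> ennreal c"
proof -
  define S' where "S' r = S \<inter> cball 0 (real r) \<inter> {x. ennreal c < f x}" for r
  have [measurable]: "S' r \<in> sets borel" for r unfolding S'_def by measurable
  have fin: "emeasure lborel (S' r) < \<infinity>" for r
  proof -
    have "emeasure lborel (S' r) \<le> emeasure lborel (cball (0 :: real ^ 'd) (real r))"
      by (intro emeasure_mono) (auto simp: S'_def)
    also have "\<dots> < \<infinity>" by (intro emeasure_compact_finite) auto
    finally show ?thesis .
  qed
  have "AE x in lborel. x \<in> S' r \<longrightarrow> f x \<le> ennreal c" for r
  proof -
    have le: "(\<integral>\<^sup>+x. f x * indicator (S' r) x \<partial>lborel) \<le> ennreal c * emeasure lborel (S' r)"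
    proof (rule dyadic_average_integral[where ?n0.0 = n0])
      show "emeasure lborel (S' r) < \<infinity>" by (rule fin)
      fix x n assume "x \<in> S' r" "n0 \<le> n"
      then have "x \<in> S" by (simp add: S'_def)
      then show "(\<integral>\<^sup>+y. f y * indicator (cell (n, coord n x)) y \<partial>lborel)
          \<le> ennreal c * emeasure lborel (cell (n, coord n x) :: (real ^ 'd) set)"
        using \<open>n0 \<le> n\<close> by (rule av)
    qed (use c in auto)
    have "(\<integral>\<^sup>+x. f x * indicator (S' r) x - ennreal c * indicator (S' r) x \<partial>lborel)
      = (\<integral>\<^sup>+x. f x * indicator (S' r) x \<partial>lborel) - (\<integral>\<^sup>+x. ennreal c * indicator (S' r) x \<partial>lborel)"
    proof (rule nn_integral_diff)
      show "(\<integral>\<^sup>+x. ennreal c * indicator (S' r) x \<partial>lborel) \<noteq> \<infinity>"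
        using fin[of r] by (simp add: nn_integral_cmult_indicator ennreal_mult_eq_top_iff)
    qed (auto simp: S'_def indicator_def)
    also have "\<dots> = 0"
    proof -
      have "ennreal c * emeasure lborel (S' r) < top" using fin[of r] by (simp add: ennreal_mult_less_top)
      then show ?thesis using le by (simp add: nn_integral_cmult_indicator diff_eq_0_ennreal order.strict_trans1)
    qed
    finally have "AE x in lborel. f x * indicator (S' r) x - ennreal c * indicator (S' r) x = 0"
      by (subst (asm) nn_integral_0_iff_AE) auto
    then show ?thesis
    proof eventually_elim
      case (elim x)
      then show ?case by (auto simp: diff_eq_0_iff_ennreal)
    qed
  qed
  then have "AE x in lborel. \<forall>r. x \<in> S' r \<longrightarrow> f x \<le> ennreal c" by (subst AE_all_countable) auto
  then show ?thesis
  proof eventually_elim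
    case (elim x)
    obtain r :: nat where "norm x \<le> r" using real_arch_simple by blast
    then show ?case using elim[rule_format, of r] by (auto simp: S'_def not_le[symmetric])
  qed
qed

text \<open>
  In units of the side length a triple starts at the position \<open>m - 1\<close> and has length 3. Halving the unit
  replaces \<open>m - 1\<close> by \<open>2 (m - 1)\<close>, that is by \<open>- (m - 1)\<close> modulo 3. The power of two undoes this sign, so the
  class of a triple agrees with that of the triples of the next generation that tile it.
\<close>

definition lattice_class :: "'d cell \<Rightarrow> 'd \<Rightarrow> int" where
  "lattice_class P i = (2 ^ fst P * (snd P i - 1)) mod 3"

text \<open>
  In each coordinate, measured in the finer unit, the coarser triple is an interval \<open>[\<beta>, \<beta> + 3 J)\<close> and the
  finer one is \<open>[\<alpha>, \<alpha> + 3)\<close>. Equality of the classes means that \<open>3\<close> divides \<open>\<alpha> - \<beta>\<close>, so the finer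
  interval is one of the \<open>J\<close> tiles of the coarser one or disjoint from it.
\<close>

lemma triple_laminar:
  assumes cl: "lattice_class P = lattice_class R" and le: "fst P \<le> fst R" and ne: "triple P \<inter> triple R \<noteq> {}"
  shows "triple R \<subseteq> triple P"
proof
  fix z assume z: "z \<in> triple R"
  obtain y where y: "y \<in> triple P" "y \<in> triple R" using ne by auto
  define j where "j = fst R - fst P"
  define J :: int where "J = 2 ^ j"
  have J: "0 < J" by (simp add: J_def)
  have "\<bar>coord (fst P) z i - snd P i\<bar> \<le> 1" for i
  proof -
    define p q c e where "p = snd P i" and "q = snd R i" and "c = coord (fst R) y i" and "e = coord (fst R) z i"
    have cq: "\<bar>c - q\<bar> \<le> 1" and eq: "\<bar>e - q\<bar> \<le> 1" using y z by (auto simp: triple_def p_def q_def c_def e_def)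
    have cp: "\<bar>c div J - p\<bar> \<le> 1" using y le by (auto simp: triple_def p_def c_def J_def j_def coord_anc[of "fst P" "fst R"])
    have "(2 ^ fst P * (p - 1)) mod 3 = (2 ^ fst R * (q - 1)) mod 3"
      using cl unfolding lattice_class_def p_def q_def by metis
    moreover have "(2::int) ^ fst R = 2 ^ fst P * J" using le by (simp add: J_def j_def power_add[symmetric])
    ultimately have "(3::int) dvd 2 ^ fst P * (p - 1) - 2 ^ fst P * J * (q - 1)"
      by (metis mod_eq_dvd_iff)
    then have "(3::int) dvd 2 ^ fst P * ((p - 1) - J * (q - 1))" by (simp add: algebra_simps)
    moreover have "coprime (3::int) (2 ^ fst P)" by simp
    ultimately have d1: "(3::int) dvd (p - 1) - J * (q - 1)" by (simp add: coprime_dvd_mult_right_iff)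
    (* The inverse of J modulo 3 is J itself, since J is a power of two. *)
    have "(3::int) dvd 4 ^ j - 1"
    proof (induction j)
      case (Suc j)
      have "(4::int) ^ Suc j - 1 = 4 * (4 ^ j - 1) + 3" by simp
      then show ?case using Suc by (metis dvd_add dvd_mult dvd_refl)
    qed simp
    then have d2: "(3::int) dvd J * J - 1" by (simp add: J_def power_mult_distrib[symmetric])
    have "(q - 1) - J * (p - 1) = - (J * J - 1) * (q - 1) - J * ((p - 1) - J * (q - 1))" by (simp add: algebra_simps)
    then have "(3::int) dvd (q - 1) - J * (p - 1)" using d1 d2 by (metis dvd_diff dvd_mult dvd_mult2 dvd_minus_iff)
    then obtain s where s: "q - 1 = J * (p - 1) + 3 * s" by (metis dvdE diff_eq_eq add.commute)
    have "c = J * (c div J) + c mod J" "0 \<le> c mod J" "c mod J < J" using J by simp_all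
    then have "J * (c div J) \<le> c" "c < J * (c div J) + J" by linarith+
    moreover have "J * (p - 1) \<le> J * (c div J)" "J * (c div J) \<le> J * (p + 1)" using cp J by (auto intro!: mult_left_mono)
    ultimately have "J * (p - 1) \<le> c" "c < J * (p - 1) + 3 * J" by (auto simp: algebra_simps)
    then have "0 \<le> s" "s < J" using cq s by linarith+
    then have "J * (p - 1) \<le> e" "e < J * (p - 1) + 3 * J" using eq s by linarith+
    moreover have "e = J * (e div J) + e mod J" "0 \<le> e mod J" "e mod J < J" using J by simp_all
    moreover have "J * (p + 2) = J * (p - 1) + 3 * J" by (simp add: algebra_simps)
    moreover have "J * (e div J + 1) = J * (e div J) + J" by (simp add: algebra_simps)
    ultimately have "J * (p - 1) < J * (e div J + 1)" "J * (e div J) < J * (p + 2)" by linarith+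
    then have "p - 1 < e div J + 1" "e div J < p + 2" using J by (simp_all add: mult_less_cancel_left_pos)
    then show ?thesis using le by (auto simp: e_def p_def J_def j_def coord_anc[of "fst P" "fst R"])
  qed
  then show "z \<in> triple P" by (simp add: triple_def)
qed

definition lattice_classes :: "('d \<Rightarrow> int) set" where
  "lattice_classes = (UNIV :: 'd set) \<rightarrow>\<^sub>E {0, 1, 2}"

lemma lattice_class_in: "lattice_class (P :: ('d::finite) cell) \<in> lattice_classes"
proof -
  have "lattice_class P i \<in> {0, 1, 2}" for i
  proof -
    have "0 \<le> lattice_class P i" "lattice_class P i < 3" by (auto simp: lattice_class_def)
    then show ?thesis by auto
  qed
  then show ?thesis by (auto simp: lattice_classes_def PiE_def)
qed

lemma finite_lattice_classes: "finite (lattice_classes :: (('d::finite) \<Rightarrow> int) set)"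
  unfolding lattice_classes_def by (intro finite_PiE) auto

lemma card_lattice_classes: "card (lattice_classes :: (('d::finite) \<Rightarrow> int) set) = 3 ^ CARD('d)"
  unfolding lattice_classes_def by (subst card_PiE) (auto simp: numeral_3_eq_3)

end

section \<open>Calderon-Zygmund kernels\<close>

lemma cz_kernel_transpose: "cz_kernel \<epsilon> K \<Longrightarrow> cz_kernel \<epsilon> (\<lambda>x y. K y x)"
  unfolding cz_kernel_def by (metis (no_types, lifting) add.commute norm_minus_commute)

lemma cz_kernel_size:
  fixes x y :: "real ^ 'd"
  assumes "cz_kernel \<epsilon> K" "0 < \<delta>" "\<delta> \<le> norm (x - y)"
  shows "cmod (K x y) \<le> 1 / \<delta> ^ CARD('d)"
proof -
  have "x \<noteq> y" using assms by auto
  then have "cmod (K x y) \<le> 1 / norm (x - y) ^ CARD('d)" using assms(1) unfolding cz_kernel_def by blast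
  also have "\<dots> \<le> 1 / \<delta> ^ CARD('d)" using assms by (intro divide_left_mono power_mono mult_pos_pos zero_less_power) auto
  finally show ?thesis .
qed

text \<open>
  Where the smoothness condition does not apply, \<open>norm (x - x') / \<delta>\<close> is at least \<open>1 / 2\<close> and the size
  condition suffices. The estimate thus holds without the restriction on \<open>norm (x - x')\<close>.
\<close>

lemma cz_kernel_diff:
  fixes x x' y :: "real ^ 'd"
  assumes K: "cz_kernel \<epsilon> K" and e: "0 < \<epsilon>" and d: "0 < \<delta>" "\<delta> \<le> norm (x - y)" "\<delta> \<le> norm (x' - y)"
  shows "cmod (K x y - K x' y) \<le> 2 powr (1 + \<epsilon>) * (norm (x - x') / \<delta>) powr \<epsilon> / \<delta> ^ CARD('d)"
proof (cases "norm (x - x') \<le> norm (x - y) / 2")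
  case True
  have "x \<noteq> y" using d by auto
  then have "cmod (K x y - K x' y) + cmod (K y x - K y x')
      \<le> norm (x - x') powr \<epsilon> / norm (x - y) powr (real CARD('d) + \<epsilon>)"
    using K True unfolding cz_kernel_def by blast
  then have "cmod (K x y - K x' y) \<le> norm (x - x') powr \<epsilon> / norm (x - y) powr (real CARD('d) + \<epsilon>)"
    using norm_ge_zero[of "K y x - K y x'"] by linarith
  also have "\<dots> \<le> norm (x - x') powr \<epsilon> / \<delta> powr (real CARD('d) + \<epsilon>)"
    using d e by (intro divide_left_mono powr_mono2 mult_pos_pos) (auto simp: powr_gt_zero)
  also have "\<dots> = (norm (x - x') / \<delta>) powr \<epsilon> / \<delta> ^ CARD('d)"
    using d by (simp add: powr_add powr_divide powr_realpow)
  also have "\<dots> \<le> 2 powr (1 + \<epsilon>) * ((norm (x - x') / \<delta>) powr \<epsilon> / \<delta> ^ CARD('d))"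
  proof -
    have "1 \<le> (2::real) powr (1 + \<epsilon>)" using e by (intro ge_one_powr_ge_zero) auto
    then show ?thesis using d mult_right_mono[of 1 "2 powr (1 + \<epsilon>)" "(norm (x - x') / \<delta>) powr \<epsilon> / \<delta> ^ CARD('d)"] by simp
  qed
  finally show ?thesis by simp
next
  case False
  then have far: "\<delta> \<le> 2 * norm (x - x')" using d by linarith
  have "cmod (K x y - K x' y) \<le> cmod (K x y) + cmod (K x' y)" by (rule norm_triangle_ineq4)
  also have "\<dots> \<le> 1 / \<delta> ^ CARD('d) + 1 / \<delta> ^ CARD('d)"
    using d by (intro add_mono cz_kernel_size[OF K]) auto
  also have "\<dots> = 2 * (1 / \<delta> ^ CARD('d))" by simp
  also have "\<dots> \<le> 2 * ((2 * (norm (x - x') / \<delta>)) powr \<epsilon> / \<delta> ^ CARD('d))"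
  proof -
    have "1 \<le> (2 * (norm (x - x') / \<delta>)) powr \<epsilon>" using e far d by (intro ge_one_powr_ge_zero) (auto simp: field_simps)
    then show ?thesis using d by (intro mult_left_mono divide_right_mono) auto
  qed
  also have "\<dots> = 2 powr (1 + \<epsilon>) * (norm (x - x') / \<delta>) powr \<epsilon> / \<delta> ^ CARD('d)"
  proof -
    have "(2 * (norm (x - x') / \<delta>)) powr \<epsilon> = 2 powr \<epsilon> * (norm (x - x') / \<delta>) powr \<epsilon>"
      using d by (subst powr_mult) simp_all
    then show ?thesis using d by (simp add: powr_add)
  qed
  finally show ?thesis .
qed

lemma two_powr_minus_less_one: "0 < \<epsilon> \<Longrightarrow> 2 powr - \<epsilon> < (1::real)"
  using powr_less_mono[of "- \<epsilon>" 0 "2::real"] by simp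

definition osc_const :: "real \<Rightarrow> 'd itself \<Rightarrow> real" where
  "osc_const \<epsilon> TYPE('d) = 2 powr (1 + \<epsilon>) * real CARD('d) powr \<epsilon>"

lemma osc_const_nonneg: "0 \<le> osc_const \<epsilon> TYPE('d)" by (simp add: osc_const_def)

definition tail_const :: "real \<Rightarrow> 'd itself \<Rightarrow> real" where
  "tail_const \<epsilon> TYPE('d) = osc_const \<epsilon> TYPE('d) * 6 ^ CARD('d) / (1 - 2 powr - \<epsilon>)"

lemma tail_const_nonneg: "0 < \<epsilon> \<Longrightarrow> 0 \<le> tail_const \<epsilon> TYPE('d)"
  unfolding tail_const_def
  by (intro divide_nonneg_nonneg mult_nonneg_nonneg osc_const_nonneg) (auto simp: less_imp_le two_powr_minus_less_one)

context grid
begin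

text \<open>
  A bound for the oscillation of \<open>K\<close> over the cell \<open>P\<close> in one variable, as a function of the other. Its
  \<open>j\<close>-th term accounts for the points of the triple of the ancestor of generation \<open>j\<close> that are not in
  the triple of the next smaller ancestor, at distance at least \<open>side (Suc j)\<close>; the side of \<open>P\<close> over this
  distance is a power of \<open>1 / 2\<close>, which the smoothness of the kernel turns into a geometric factor.
\<close>

definition kernel_majorant :: "real \<Rightarrow> nat \<Rightarrow> ('d::finite) cell \<Rightarrow> real ^ 'd \<Rightarrow> real" where
  "kernel_majorant \<epsilon> n0 P y = (\<Sum>j\<in>{n0..<fst P}. osc_const \<epsilon> TYPE('d) * (2 powr - \<epsilon>) ^ (fst P - Suc j)
      / side (Suc j) ^ CARD('d) * indicator (triple (anc j P)) y)"

lemma kernel_majorant_nonneg: "0 \<le> kernel_majorant \<epsilon> n0 P y"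
  unfolding kernel_majorant_def
  using less_imp_le[OF side_pos] by (intro sum_nonneg mult_nonneg_nonneg divide_nonneg_nonneg osc_const_nonneg) auto

lemma kernel_majorant_measurable [measurable]: "kernel_majorant \<epsilon> n0 P \<in> borel_measurable borel"
  unfolding kernel_majorant_def[abs_def] by measurable

lemma kernel_osc:
  fixes P :: "('d::finite) cell"
  assumes K: "cz_kernel \<epsilon> K" and e: "0 < \<epsilon>" and x: "x \<in> cell P" "x' \<in> cell P"
    and y: "y \<in> triple (anc n0 P)" "y \<notin> triple P" and n0: "n0 \<le> fst P"
  shows "cmod (K x y - K x' y) \<le> kernel_majorant \<epsilon> n0 P y"
proof -
  define G where "G j \<longleftrightarrow> j \<le> fst P \<and> y \<in> triple (anc j P)" for j
  (* The smallest ancestor of P whose triple contains y. *)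
  define j where "j = (GREATEST j. G j)"
  have "G n0" using n0 y by (simp add: G_def)
  have bd: "\<And>i. G i \<Longrightarrow> i \<le> fst P" by (simp add: G_def)
  have Gj: "G j" unfolding j_def by (rule GreatestI_nat[of G n0 "fst P"]) (use \<open>G n0\<close> bd in auto)
  have jn0: "n0 \<le> j" unfolding j_def by (rule Greatest_le_nat[of G n0 "fst P"]) (use \<open>G n0\<close> bd in auto)
  have "j \<noteq> fst P" using Gj y(2) by (auto simp: G_def)
  then have jP: "j < fst P" using Gj by (simp add: G_def)
  have "\<not> G (Suc j)" using Greatest_le_nat[of G "Suc j" "fst P"] bd unfolding j_def by fastforce
  then have yn: "y \<notin> triple (anc (Suc j) P)" using jP by (simp add: G_def)
  have xc: "x \<in> cell (anc (Suc j) P)" "x' \<in> cell (anc (Suc j) P)" using x cell_anc[of "Suc j" P] jP by auto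
  let ?s = "side (Suc j)"
  have s: "0 < ?s" by (rule side_pos)
  have "cmod (K x y - K x' y) \<le> 2 powr (1 + \<epsilon>) * (norm (x - x') / ?s) powr \<epsilon> / ?s ^ CARD('d)"
    using triple_far[OF xc(1) yn] triple_far[OF xc(2) yn] s by (intro cz_kernel_diff[OF K e]) auto
  also have "\<dots> \<le> 2 powr (1 + \<epsilon>) * (real CARD('d) powr \<epsilon> * (2 powr - \<epsilon>) ^ (fst P - Suc j)) / ?s ^ CARD('d)"
  proof -
    have "norm (x - x') / ?s \<le> real CARD('d) * side (fst P) / ?s"
      using cell_norm_diff[OF x] s by (intro divide_right_mono) auto
    also have "\<dots> = real CARD('d) * (1 / 2) ^ (fst P - Suc j)"
      using side_diff[of "Suc j" "fst P"] jP side_pos[of "fst P"] by (simp add: power_one_over)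
    finally have "(norm (x - x') / ?s) powr \<epsilon> \<le> (real CARD('d) * (1 / 2) ^ (fst P - Suc j)) powr \<epsilon>"
      using e s by (intro powr_mono2) auto
    also have "\<dots> = real CARD('d) powr \<epsilon> * (2 powr - \<epsilon>) ^ (fst P - Suc j)"
      by (simp add: powr_mult powr_powr powr_minus_divide flip: powr_realpow power_one_over)
         (simp add: powr_powr powr_divide mult.commute powr_realpow flip: powr_realpow)
    finally show ?thesis using s by (intro divide_right_mono mult_left_mono) auto
  qed
  also have "\<dots> = osc_const \<epsilon> TYPE('d) * (2 powr - \<epsilon>) ^ (fst P - Suc j)
      / side (Suc j) ^ CARD('d) * indicator (triple (anc j P)) y"
    using Gj by (simp add: G_def osc_const_def)
  also have "\<dots> \<le> kernel_majorant \<epsilon> n0 P y"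
    unfolding kernel_majorant_def using jn0 jP less_imp_le[OF side_pos]
    by (intro member_le_sum mult_nonneg_nonneg divide_nonneg_nonneg osc_const_nonneg) auto
  finally show ?thesis .
qed

lemma kernel_majorant_integral:
  fixes P :: "('d::finite) cell"
  assumes e: "0 < \<epsilon>" and [measurable]: "h \<in> borel_measurable borel" and A: "0 \<le> A"
    and av: "\<And>j. n0 \<le> j \<Longrightarrow> j < fst P \<Longrightarrow> (\<integral>\<^sup>+y. h y * indicator (triple (anc j P)) y \<partial>lborel)
        \<le> ennreal A * emeasure lborel (triple (anc j P))"
  shows "(\<integral>\<^sup>+y. ennreal (kernel_majorant \<epsilon> n0 P y) * h y \<partial>lborel) \<le> ennreal (tail_const \<epsilon> TYPE('d) * A)"
proof -
  let ?\<rho> = "2 powr - \<epsilon> :: real" and ?c = "osc_const \<epsilon> TYPE('d)" and ?n = "fst P"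
  define a where "a j = ?c * ?\<rho> ^ (?n - Suc j) / side (Suc j) ^ CARD('d)" for j
  have a0: "0 \<le> a j" for j unfolding a_def using less_imp_le[OF side_pos]
    by (intro mult_nonneg_nonneg divide_nonneg_nonneg osc_const_nonneg) auto
  have \<rho>: "0 < ?\<rho>" "?\<rho> < 1" using e two_powr_minus_less_one by auto
  have "(\<integral>\<^sup>+y. ennreal (kernel_majorant \<epsilon> n0 P y) * h y \<partial>lborel)
      = (\<integral>\<^sup>+y. (\<Sum>j\<in>{n0..<?n}. ennreal (a j) * (h y * indicator (triple (anc j P)) y)) \<partial>lborel)"
  proof (intro nn_integral_cong)
    fix y
    have "ennreal (kernel_majorant \<epsilon> n0 P y) = (\<Sum>j\<in>{n0..<?n}. ennreal (a j * indicator (triple (anc j P)) y))"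
      unfolding kernel_majorant_def a_def[symmetric] using a0 by (subst sum_ennreal) auto
    also have "\<dots> = (\<Sum>j\<in>{n0..<?n}. ennreal (a j) * indicator (triple (anc j P)) y)"
      using a0 by (intro sum.cong) (auto simp: indicator_def)
    finally have eq: "ennreal (kernel_majorant \<epsilon> n0 P y) = \<dots>" .
    show "ennreal (kernel_majorant \<epsilon> n0 P y) * h y
        = (\<Sum>j\<in>{n0..<?n}. ennreal (a j) * (h y * indicator (triple (anc j P)) y))"
      unfolding eq sum_distrib_right by (intro sum.cong refl) (simp only: mult_ac)
  qed
  also have "\<dots> = (\<Sum>j\<in>{n0..<?n}. ennreal (a j) * (\<integral>\<^sup>+y. h y * indicator (triple (anc j P)) y \<partial>lborel))"
    by (subst nn_integral_sum) (auto simp: nn_integral_cmult)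
  also have "\<dots> \<le> (\<Sum>j\<in>{n0..<?n}. ennreal (?c * 6 ^ CARD('d) * A * ?\<rho> ^ (?n - Suc j)))"
  proof (intro sum_mono)
    fix j assume j: "j \<in> {n0..<?n}"
    have "ennreal (a j) * (\<integral>\<^sup>+y. h y * indicator (triple (anc j P)) y \<partial>lborel)
        \<le> ennreal (a j) * (ennreal A * ennreal ((3 * side j) ^ CARD('d)))"
      using av[of j] j by (intro mult_left_mono) (auto simp: emeasure_triple)
    also have "\<dots> = ennreal (a j * (A * (3 * side j) ^ CARD('d)))"
      using A a0 less_imp_le[OF side_pos] by (simp add: ennreal_mult)
    also have "a j * (A * (3 * side j) ^ CARD('d)) = ?c * 6 ^ CARD('d) * A * ?\<rho> ^ (?n - Suc j)"
    proof -
      have "(3 * side j) ^ CARD('d) = 6 ^ CARD('d) * side (Suc j) ^ CARD('d)"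
        unfolding side_Suc[of j] mult.assoc[symmetric] power_mult_distrib[symmetric] by simp
      then show ?thesis using side_pos[of "Suc j"] by (simp add: a_def)
    qed
    finally show "ennreal (a j) * (\<integral>\<^sup>+y. h y * indicator (triple (anc j P)) y \<partial>lborel)
        \<le> ennreal (?c * 6 ^ CARD('d) * A * ?\<rho> ^ (?n - Suc j))" .
  qed
  also have "\<dots> = ennreal (\<Sum>j\<in>{n0..<?n}. ?c * 6 ^ CARD('d) * A * ?\<rho> ^ (?n - Suc j))"
    using A by (intro sum_ennreal mult_nonneg_nonneg osc_const_nonneg) auto
  also have "\<dots> \<le> ennreal (tail_const \<epsilon> TYPE('d) * A)"
  proof (intro ennreal_leI)
    have "(\<Sum>j\<in>{n0..<?n}. ?\<rho> ^ (?n - Suc j)) \<le> (\<Sum>j\<in>{0..<?n}. ?\<rho> ^ (?n - Suc j))"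
      using \<rho> by (intro sum_mono2) auto
    also have "\<dots> = (\<Sum>j<?n. ?\<rho> ^ j)" using sum.nat_diff_reindex[of "\<lambda>j. ?\<rho> ^ j" ?n] by (simp add: lessThan_atLeast0)
    also have "\<dots> \<le> 1 / (1 - ?\<rho>)"
    proof -
      have "(\<Sum>j<?n. ?\<rho> ^ j) = (1 - ?\<rho> ^ ?n) / (1 - ?\<rho>)" using \<rho> e by (simp add: sum_gp_strict)
      then show ?thesis using \<rho> by (simp add: divide_right_mono)
    qed
    finally have "(?c * 6 ^ CARD('d) * A) * (\<Sum>j\<in>{n0..<?n}. ?\<rho> ^ (?n - Suc j)) \<le> (?c * 6 ^ CARD('d) * A) * (1 / (1 - ?\<rho>))"
      using A by (intro mult_left_mono mult_nonneg_nonneg osc_const_nonneg) auto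
    then show "(\<Sum>j\<in>{n0..<?n}. ?c * 6 ^ CARD('d) * A * ?\<rho> ^ (?n - Suc j)) \<le> tail_const \<epsilon> TYPE('d) * A"
      by (simp add: sum_distrib_left tail_const_def)
  qed
  finally show ?thesis .
qed

end

section \<open>Representation by the kernel away from the support\<close>

lemma compact_inner:
  fixes A :: "'a::euclidean_space set"
  assumes A: "A \<in> sets borel" "bounded A" and e: "0 < e"
  obtains C where "compact C" "C \<subseteq> A" "emeasure lborel (A - C) < ennreal e"
proof -
  obtain r where r: "A \<subseteq> cball 0 r" using bounded_subset_ballD[OF A(2), of 0] ball_subset_cball by blast
  obtain U where U: "open U" "cball 0 r - A \<subseteq> U" "emeasure lborel (U - (cball 0 r - A)) < ennreal e"
    using outer_regular_lborel[of "cball 0 r - A" e] A e by auto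
  have "compact (cball 0 r - U)" using U(1) by (intro compact_diff) auto
  moreover have "cball 0 r - U \<subseteq> A" using U(2) by auto
  moreover have "emeasure lborel (A - (cball 0 r - U)) \<le> emeasure lborel (U - (cball 0 r - A))"
    using r U A by (intro emeasure_mono) auto
  ultimately show thesis using that U(3) by (meson order.strict_trans1)
qed

lemma compact_positive:
  fixes A :: "'a::euclidean_space set"
  assumes A: "A \<in> sets borel" "emeasure lborel A \<noteq> 0"
  obtains C where "compact C" "C \<subseteq> A" "emeasure lborel C \<noteq> 0"
proof -
  have "\<exists>r::nat. emeasure lborel (A \<inter> cball 0 r) \<noteq> 0"
  proof (rule ccontr)
    assume "\<nexists>r::nat. emeasure lborel (A \<inter> cball 0 r) \<noteq> 0"
    then have "(\<Union>r::nat. A \<inter> cball 0 r) \<in> null_sets lborel" using A by (intro null_sets_UN) (auto intro!: null_setsI)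
    moreover have "(\<Union>r::nat. A \<inter> cball 0 r) = A" by (auto simp: real_arch_simple)
    ultimately show False using A by auto
  qed
  then obtain r :: nat where r: "emeasure lborel (A \<inter> cball 0 r) \<noteq> 0" by blast
  have "emeasure lborel (A \<inter> cball 0 r) \<le> emeasure lborel (cball (0::'a) r)" using A by (intro emeasure_mono) auto
  also have "\<dots> < \<infinity>" by (intro emeasure_compact_finite) auto
  finally obtain e where e: "emeasure lborel (A \<inter> cball 0 r) = ennreal e" "0 \<le> e" by (cases "emeasure lborel (A \<inter> cball 0 r)") auto
  then have "0 < e" using r by (cases "e = 0") auto
  then obtain C where C: "compact C" "C \<subseteq> A \<inter> cball 0 r" "emeasure lborel (A \<inter> cball 0 r - C) < ennreal e"
    using compact_inner[of "A \<inter> cball 0 r" e] A by auto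
  have "emeasure lborel (A \<inter> cball 0 r) = emeasure lborel C + emeasure lborel (A \<inter> cball 0 r - C)"
    using C A by (subst plus_emeasure) (auto intro!: arg_cong[where f = "emeasure lborel"] simp: compact_imp_closed borel_closed)
  then have "emeasure lborel C \<noteq> 0" using C(3) e by auto
  then show thesis using that C by auto
qed

lemma supp_zero: "x \<notin> supp f \<Longrightarrow> f x = 0"
  unfolding supp_def using closure_subset[of "{x. f x \<noteq> 0}"] by auto

text \<open>
  The value \<open>0\<close> on the diagonal makes the kernel Borel measurable on the whole product space; it is
  continuous off the diagonal.
\<close>

locale cz_operator = L2_operator T M for T :: "(real ^ 'd \<Rightarrow> complex) \<Rightarrow> real ^ 'd \<Rightarrow> complex" and M +
  fixes \<epsilon> :: real and K :: "real ^ 'd \<Rightarrow> real ^ 'd \<Rightarrow> complex"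
  assumes eps: "0 < \<epsilon>" and kernel: "cz_kernel \<epsilon> K" and diag: "K x x = 0"
    and rep: "\<lbrakk>continuous_on UNIV f; continuous_on UNIV g; compact (supp f); compact (supp g); supp f \<inter> supp g = {}\<rbrakk>
      \<Longrightarrow> (LINT x|lborel. T f x * g x) = (LINT x|lborel. (LINT y|lborel. K x y * f y * g x))"
begin

definition kernel_op :: "(real ^ 'd \<Rightarrow> complex) \<Rightarrow> real ^ 'd \<Rightarrow> complex" where
  "kernel_op f x = (LINT y|lborel. K x y * f y)"

lemma K_tendsto:
  assumes "x \<noteq> y"
  shows "((\<lambda>p. K (fst p) (snd p)) \<longlongrightarrow> K x y) (at (x, y))"
proof -
  define \<delta> where "\<delta> = norm (x - y) / 2"
  have d: "0 < \<delta>" using assms by (simp add: \<delta>_def)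
  let ?b = "\<lambda>u. 2 powr (1 + \<epsilon>) * (u / \<delta>) powr \<epsilon> / \<delta> ^ CARD('d)"
  have "((\<lambda>p. K (fst p) (snd p) - K x y) \<longlongrightarrow> 0) (at (x, y))"
  proof (rule Lim_null_comparison)
    have "eventually (\<lambda>p. dist p (x, y) < \<delta> / 2) (at (x, y))" using d by (auto simp: eventually_at intro!: exI[of _ "\<delta> / 2"])
    then show "\<forall>\<^sub>F p in at (x, y). norm (K (fst p) (snd p) - K x y) \<le> ?b (norm (fst p - x)) + ?b (norm (snd p - y))"
    proof eventually_elim
      case (elim p)
      have 1: "norm (fst p - x) < \<delta> / 2" "norm (snd p - y) < \<delta> / 2"
        using elim dist_fst_le[of p "(x, y)"] dist_snd_le[of p "(x, y)"] by (auto simp: dist_norm)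
      have t1: "norm (x - y) \<le> norm (fst p - y) + norm (fst p - x)"
        using norm_triangle_ineq4[of "fst p - y" "fst p - x"] by simp
      have t2: "norm (fst p - y) \<le> norm (snd p - fst p) + norm (snd p - y)"
        using norm_triangle_ineq4[of "snd p - y" "snd p - fst p"] by simp
      have n: "norm (x - y) = 2 * \<delta>" by (simp add: \<delta>_def)
      have far: "\<delta> \<le> norm (fst p - y)" "\<delta> \<le> norm (x - y)" "\<delta> \<le> norm (snd p - fst p)" "\<delta> \<le> norm (y - fst p)"
        using 1 t1 t2 n d by (auto simp: norm_minus_commute[of y])
      have "norm (K (fst p) (snd p) - K x y) \<le> norm (K (fst p) (snd p) - K (fst p) y) + norm (K (fst p) y - K x y)"
        using norm_triangle_ineq[of "K (fst p) (snd p) - K (fst p) y" "K (fst p) y - K x y"] by simp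
      also have "\<dots> \<le> ?b (norm (snd p - y)) + ?b (norm (fst p - x))"
        using far d by (intro add_mono cz_kernel_diff[OF kernel eps] cz_kernel_diff[OF cz_kernel_transpose[OF kernel] eps]) auto
      finally show ?case by simp
    qed
    have lim: "((\<lambda>p. norm (fst p - x)) \<longlongrightarrow> 0) (at (x, y))" "((\<lambda>p. norm (snd p - y)) \<longlongrightarrow> 0) (at (x, y))"
      by (auto intro!: tendsto_eq_intros)
    have b: "((\<lambda>p. ?b (norm (u p))) \<longlongrightarrow> 0) (at (x, y))"
      if u: "((\<lambda>p. norm (u p)) \<longlongrightarrow> 0) (at (x, y))" for u :: "(real ^ 'd) \<times> (real ^ 'd) \<Rightarrow> real ^ 'd"
    proof -
      have "((\<lambda>p. norm (u p) / \<delta>) \<longlongrightarrow> 0) (at (x, y))" using tendsto_divide[OF u tendsto_const, of \<delta>] d by simp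
      then have "((\<lambda>p. (norm (u p) / \<delta>) powr \<epsilon>) \<longlongrightarrow> 0) (at (x, y))"
        using d eps by (intro tendsto_zero_powrI[where b = \<epsilon>]) auto
      from tendsto_divide[OF tendsto_mult[OF tendsto_const this] tendsto_const] show ?thesis using d by simp
    qed
    from tendsto_add[OF b[OF lim(1)] b[OF lim(2)]]
    show "((\<lambda>p. ?b (norm (fst p - x)) + ?b (norm (snd p - y))) \<longlongrightarrow> 0) (at (x, y))" by simp
  qed
  then show ?thesis by (simp add: LIM_zero_iff)
qed

lemma K_measurable_pair: "(\<lambda>p. K (fst p) (snd p)) \<in> borel_measurable borel"
proof -
  have "(\<lambda>p. if p \<in> {p. fst p \<noteq> snd p} then K (fst p) (snd p) else 0) \<in> borel_measurable borel"
  proof (rule borel_measurable_continuous_on_if)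
    have "open {p :: (real ^ 'd) \<times> (real ^ 'd). fst p \<noteq> snd p}" by (intro open_Collect_neq continuous_intros)
    then show "{p :: (real ^ 'd) \<times> (real ^ 'd). fst p \<noteq> snd p} \<in> sets borel" by auto
    show "continuous_on {p. fst p \<noteq> snd p} (\<lambda>p. K (fst p) (snd p))"
    proof (rule continuous_at_imp_continuous_on, safe)
      fix a b :: "real ^ 'd" assume "fst (a, b) \<noteq> snd (a, b)"
      then show "isCont (\<lambda>p. K (fst p) (snd p)) (a, b)" using K_tendsto[of a b] by (simp add: isCont_def)
    qed
  qed auto
  moreover have "(\<lambda>p. if p \<in> {p. fst p \<noteq> snd p} then K (fst p) (snd p) else 0) = (\<lambda>p. K (fst p) (snd p))"
    using diag by (auto simp: fun_eq_iff)
  ultimately show ?thesis by simp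
qed

lemma K_measurable [measurable]: "(\<lambda>p. K (fst p) (snd p)) \<in> borel_measurable (lborel \<Otimes>\<^sub>M lborel)"
  using K_measurable_pair by (simp add: lborel_prod)

lemma K_measurable2 [measurable]: "K x \<in> borel_measurable borel"
proof -
  have "(\<lambda>y. (x, y)) \<in> borel_measurable borel" by (intro borel_measurable_continuous_onI continuous_intros)
  from measurable_compose[OF this K_measurable_pair] show ?thesis by simp
qed

lemma kernel_op_measurable [measurable]:
  assumes [measurable]: "f \<in> borel_measurable borel"
  shows "kernel_op f \<in> borel_measurable borel"
proof -
  have "(\<lambda>p. K (fst p) (snd p) * f (snd p)) \<in> borel_measurable (lborel \<Otimes>\<^sub>M lborel)"
    by measurable
  then have "(\<lambda>x. LINT y|lborel. K x y * f y) \<in> borel_measurable lborel"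
    by (intro lborel.borel_measurable_lebesgue_integral) (simp add: case_prod_unfold)
  then show ?thesis by (simp add: kernel_op_def[abs_def])
qed

lemma kernel_op_integrable:
  assumes "integrable lborel f" and \<eta>: "0 < \<eta>" "\<And>y. f y \<noteq> 0 \<Longrightarrow> \<eta> \<le> dist x y"
  shows "integrable lborel (\<lambda>y. K x y * f y)"
    and "cmod (kernel_op f x) \<le> (LINT y|lborel. cmod (f y)) / \<eta> ^ CARD('d)"
proof -
  have [measurable]: "f \<in> borel_measurable borel" using assms by auto
  have b: "cmod (K x y * f y) \<le> cmod (f y) / \<eta> ^ CARD('d)" for y
  proof (cases "f y = 0")
    case False
    then have "cmod (K x y) * cmod (f y) \<le> 1 / \<eta> ^ CARD('d) * cmod (f y)"
      using \<eta> by (intro mult_right_mono cz_kernel_size[OF kernel]) (auto simp: dist_norm)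
    then show ?thesis by (simp add: norm_mult)
  qed simp
  have i: "integrable lborel (\<lambda>y. cmod (f y) / \<eta> ^ CARD('d))" using assms by auto
  show 1: "integrable lborel (\<lambda>y. K x y * f y)" using \<eta>(1)
    by (intro Bochner_Integration.integrable_bound[OF i]) (auto intro!: AE_I2 order.trans[OF b])
  have "cmod (kernel_op f x) \<le> (LINT y|lborel. cmod (K x y * f y))" unfolding kernel_op_def by (rule integral_norm_bound)
  also have "\<dots> \<le> (LINT y|lborel. cmod (f y) / \<eta> ^ CARD('d))" using 1 i b by (intro integral_mono) auto
  finally show "cmod (kernel_op f x) \<le> (LINT y|lborel. cmod (f y)) / \<eta> ^ CARD('d)" by simp
qed

end

text \<open>
  Continuous functions that decrease to the indicator function of a closed set, with supports that
  shrink to it.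
\<close>

definition bump :: "'a::euclidean_space set \<Rightarrow> nat \<Rightarrow> 'a \<Rightarrow> real" where
  "bump C k x = max 0 (1 - real k * infdist x C)"

lemma bump_bounds: "0 \<le> bump C k x" "bump C k x \<le> 1"
  using infdist_nonneg[of x C] by (auto simp: bump_def)

lemma bump_continuous [continuous_intros]: "continuous_on UNIV (bump C k)"
  unfolding bump_def by (intro continuous_intros)

lemma bump_measurable [measurable]: "bump C k \<in> borel_measurable borel"
  by (intro borel_measurable_continuous_onI bump_continuous)

lemma bump_tendsto:
  assumes "closed C" "C \<noteq> {}"
  shows "(\<lambda>k. bump C k x) \<longlonglongrightarrow> indicator C x"
proof (cases "x \<in> C")
  case True
  then show ?thesis by (simp add: bump_def)
next
  case False
  then have p: "0 < infdist x C"
    using assms in_closed_iff_infdist_zero[of C x] infdist_nonneg[of x C] by (simp add: less_le)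
  obtain N :: nat where N: "1 / infdist x C \<le> N" using real_arch_simple by blast
  have "bump C k x = 0" if "N \<le> k" for k
  proof -
    have "1 / infdist x C \<le> real k" using N that by simp
    then have "1 \<le> real k * infdist x C" using p by (simp add: field_simps)
    then show ?thesis by (simp add: bump_def)
  qed
  then have "eventually (\<lambda>k. bump C k x = indicator C x) sequentially"
    using False unfolding eventually_sequentially by auto
  then show ?thesis by (rule tendsto_eventually)
qed

lemma bump_support:
  assumes "0 < \<eta>" "1 / \<eta> < real k" "bump C k x \<noteq> 0"
  shows "infdist x C \<le> \<eta>"
proof -
  have "real k * infdist x C < 1" using assms(3) by (auto simp: bump_def max_def split: if_splits)
  moreover have "1 < real k * \<eta>" using assms by (simp add: field_simps)
  moreover have "0 < real k" using assms by (meson divide_pos_pos less_trans zero_less_one)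
  ultimately have "real k * infdist x C < real k * \<eta>" by linarith
  then show ?thesis using \<open>0 < real k\<close> by simp
qed

lemma infdist_near:
  assumes "C \<noteq> {}" "infdist x C \<le> \<eta>" "0 < e"
  obtains a where "a \<in> C" "dist x a < \<eta> + e"
proof -
  have "infdist x C < \<eta> + e" using assms by simp
  then show thesis using that infdist_le assms(1) unfolding infdist_def
    by (auto simp: cINF_less_iff bdd_below_image_dist)
qed

lemma compact_infdist_le:
  assumes "compact (C :: 'a::euclidean_space set)" "C \<noteq> {}"
  shows "compact {x. infdist x C \<le> \<eta>}"
proof -
  have "closed {x. infdist x C \<le> \<eta>}" by (intro closed_Collect_le continuous_intros)
  moreover have "bounded {x. infdist x C \<le> \<eta>}"
  proof -
    obtain r where r: "C \<subseteq> ball 0 r" using bounded_subset_ballD[OF compact_imp_bounded[OF assms(1)], of 0] by blast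
    have "{x. infdist x C \<le> \<eta>} \<subseteq> ball 0 (r + \<eta> + 1)"
    proof safe
      fix x assume "infdist x C \<le> \<eta>"
      then obtain a where a: "a \<in> C" "dist x a < \<eta> + 1" using infdist_near[OF assms(2), of x \<eta> 1] by auto
      then have "norm a < r" using r by auto
      then show "x \<in> ball 0 (r + \<eta> + 1)" using a norm_triangle_sub[of x a] by (simp add: dist_norm)
    qed
    then show ?thesis using bounded_ball bounded_subset by blast
  qed
  ultimately show ?thesis by (simp add: compact_eq_bounded_closed)
qed

lemma supp_subset_closed: "closed S \<Longrightarrow> (\<And>x. f x \<noteq> 0 \<Longrightarrow> x \<in> S) \<Longrightarrow> supp f \<subseteq> S"
  unfolding supp_def by (intro closure_minimal) auto

lemma supp_compact: "compact (S :: 'a::t2_space set) \<Longrightarrow> (\<And>x. f x \<noteq> 0 \<Longrightarrow> x \<in> S) \<Longrightarrow> compact (supp f)"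
  using supp_subset_closed[of S f] compact_imp_closed[of S] compact_Int_closed[of S "supp f"]
  by (simp add: Int_absorb1 supp_def)

lemma L2_compact_continuous:
  fixes f :: "'a::euclidean_space \<Rightarrow> complex"
  assumes "continuous_on UNIV f" "compact (supp f)"
  shows "f \<in> L2_space lborel"
proof -
  have "compact (f ` supp f)" using assms by (intro compact_continuous_image) (auto intro: continuous_on_subset)
  then obtain B where B: "\<And>y. y \<in> f ` supp f \<Longrightarrow> norm y \<le> B" "0 < B"
    using compact_imp_bounded bounded_pos by metis
  have "cmod (f x) \<le> B" for x using B supp_zero[of x f] by (cases "x \<in> supp f") auto
  then show ?thesis
    using assms emeasure_compact_finite[of "supp f"] supp_zero[of _ f]
    by (intro L2_bounded[of _ _ "supp f"]) (auto simp: compact_imp_closed borel_closed borel_measurable_continuous_onI)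
qed

lemma L2_integrable_support:
  fixes f :: "'a::euclidean_space \<Rightarrow> complex"
  assumes f: "f \<in> L2_space lborel" and W: "W \<in> sets borel" "bounded W" "\<And>x. x \<notin> W \<Longrightarrow> f x = 0"
  shows "integrable lborel f"
proof -
  have "integrable lborel (restr W f)" using f W emeasure_bounded_finite[of W] by (intro L2_integrable_on_finite) auto
  moreover have "restr W f = f" using W(3) by (auto simp: restr_apply fun_eq_iff)
  ultimately show ?thesis by simp
qed

context cz_operator
begin

text \<open>
  The hypothesis on \<open>T\<close> is tested against bump functions of \<open>C\<close>, whose supports are eventually at a
  positive distance from that of \<open>f\<close>. Both sides converge by dominated convergence.
\<close>

lemma rep_on_compact:
  assumes f: "continuous_on UNIV f" "compact (supp f)" and C: "compact C" "C \<noteq> {}" "C \<inter> supp f = {}"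
  shows "integrable lborel (\<lambda>x. indicator C x *\<^sub>R (T f x - kernel_op f x))"
    and "(LINT x|lborel. indicator C x *\<^sub>R (T f x - kernel_op f x)) = 0"
proof -
  have fL: "f \<in> L2_space lborel" using f by (rule L2_compact_continuous)
  have [measurable]: "f \<in> borel_measurable borel" "T f \<in> borel_measurable borel" using fL by auto
  obtain \<eta> where \<eta>: "0 < \<eta>" "\<And>x y. x \<in> C \<Longrightarrow> y \<in> supp f \<Longrightarrow> \<eta> \<le> dist x y"
    using separate_compact_closed[OF C(1) compact_imp_closed[OF f(2)] C(3)] by auto
  define N where "N = {x. infdist x C \<le> \<eta> / 4}"
  have N: "compact N" unfolding N_def using C by (intro compact_infdist_le) auto
  have Nm [measurable]: "N \<in> sets borel" using N by (simp add: compact_imp_closed)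
  have Cm [measurable]: "C \<in> sets borel" using C by (simp add: compact_imp_closed)
  have CN: "C \<subseteq> N" using \<eta>(1) by (auto simp: N_def)
  have far: "\<eta> / 4 \<le> dist x y" if x: "x \<in> N" and y: "y \<in> supp f" for x y
  proof -
    obtain a where a: "a \<in> C" "dist x a < \<eta> / 4 + \<eta> / 4"
      using infdist_near[OF C(2), of x "\<eta> / 4" "\<eta> / 4"] x \<eta> by (auto simp: N_def)
    then show ?thesis using \<eta>(1) \<eta>(2)[OF a(1) y] dist_triangle[of a y x] by (simp add: dist_commute)
  qed
  have fint: "integrable lborel f"
    using fL f supp_zero[of _ f] by (intro L2_integrable_support[of f "supp f"]) (auto simp: compact_imp_closed compact_imp_bounded)
  define B where "B = (LINT y|lborel. cmod (f y)) / (\<eta> / 4) ^ CARD('d)"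
  have KB: "cmod (kernel_op f x) \<le> B" if "x \<in> N" for x
    unfolding B_def using far[OF that] supp_zero[of _ f] \<eta>(1) by (intro kernel_op_integrable(2)[OF fint]) auto
  have B0: "0 \<le> B" unfolding B_def using \<eta> by (intro divide_nonneg_nonneg integral_nonneg_AE) auto
  have iT: "integrable lborel (\<lambda>x. indicator N x * cmod (T f x))"
  proof -
    have "integrable lborel (restr N (T f))"
      using T_L2[OF fL] emeasure_compact_finite[OF N] by (intro L2_integrable_on_finite) auto
    moreover have "cmod (restr N (T f) x) = indicator N x * cmod (T f x)" for x by (simp add: restr_apply indicator_def)
    ultimately show ?thesis using integrable_norm[of lborel "restr N (T f)"] by simp
  qed
  have iK: "integrable lborel (\<lambda>x. indicator N x * B)"
    using emeasure_compact_finite[OF N] by (intro integrable_mult_left integrable_real_indicator) auto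
  have dT: "cmod (T f x * complex_of_real (indicator C x)) \<le> indicator N x * cmod (T f x)"
    "cmod (kernel_op f x * complex_of_real (indicator C x)) \<le> indicator N x * B" for x
    using CN KB[of x] B0 by (auto simp: indicator_def)
  have iTC: "integrable lborel (\<lambda>x. T f x * complex_of_real (indicator C x))"
    by (rule Bochner_Integration.integrable_bound[OF iT]) (auto intro!: AE_I2 order.trans[OF dT(1)])
  have iKC: "integrable lborel (\<lambda>x. kernel_op f x * complex_of_real (indicator C x))"
    by (rule Bochner_Integration.integrable_bound[OF iK]) (use B0 in \<open>auto intro!: AE_I2 order.trans[OF dT(2)]\<close>)
  obtain k0 :: nat where k0: "1 / (\<eta> / 4) < k0" using reals_Archimedean2 by blast
  define g where "g k x = complex_of_real (bump C (k + k0) x)" for k x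
  have gN: "x \<in> N" if "g k x \<noteq> 0" for k x
    using bump_support[of "\<eta> / 4" "k + k0" C x] that k0 \<eta> by (auto simp: g_def N_def)
  have g1: "cmod (g k x) \<le> indicator N x" for k x
    using gN[of k x] bump_bounds[of C "k + k0" x] by (cases "x \<in> N") (auto simp: g_def)
  have glim: "(\<lambda>k. g k x) \<longlonglongrightarrow> complex_of_real (indicator C x)" for x
    unfolding g_def using C
    by (intro tendsto_of_real LIMSEQ_ignore_initial_segment bump_tendsto) (auto simp: compact_imp_closed)
  have [measurable]: "g k \<in> borel_measurable borel" for k unfolding g_def by measurable
  have eq: "(LINT x|lborel. T f x * g k x) = (LINT x|lborel. kernel_op f x * g k x)" for k
  proof -
    have sN: "supp (g k) \<subseteq> N" using gN N by (intro supp_subset_closed) (auto simp: compact_imp_closed)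
    have "(LINT x|lborel. T f x * g k x) = (LINT x|lborel. (LINT y|lborel. K x y * f y * g k x))"
    proof (rule rep)
      show "continuous_on UNIV (g k)" unfolding g_def by (intro continuous_intros)
      show "compact (supp (g k))" using N gN by (rule supp_compact)
      show "supp f \<inter> supp (g k) = {}" using sN far \<eta>(1) by force
    qed (use f in auto)
    then show ?thesis by (simp add: kernel_op_def)
  qed
  have l1: "(\<lambda>k. LINT x|lborel. T f x * g k x) \<longlonglongrightarrow> (LINT x|lborel. T f x * complex_of_real (indicator C x))"
  proof (rule integral_dominated_convergence[OF _ _ iT])
    show "AE x in lborel. norm (T f x * g k x) \<le> indicator N x * cmod (T f x)" for k
      using mult_left_mono[OF g1 norm_ge_zero[of "T f _"]] by (auto simp: norm_mult mult.commute)
  qed (auto intro!: tendsto_mult glim)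
  have l2: "(\<lambda>k. LINT x|lborel. kernel_op f x * g k x) \<longlonglongrightarrow> (LINT x|lborel. kernel_op f x * complex_of_real (indicator C x))"
  proof (rule integral_dominated_convergence[OF _ _ iK])
    have "norm (kernel_op f x * g k x) \<le> indicator N x * B" for k x
    proof (cases "x \<in> N")
      case True
      then show ?thesis using mult_mono[OF KB[OF True] g1[of k x]] B0 by (simp add: norm_mult mult.commute)
    next
      case False
      then show ?thesis using gN[of k x] by auto
    qed
    then show "AE x in lborel. norm (kernel_op f x * g k x) \<le> indicator N x * B" for k by auto
  qed (auto intro!: tendsto_mult glim)
  have e: "indicator C x *\<^sub>R (T f x - kernel_op f x) = T f x * complex_of_real (indicator C x) - kernel_op f x * complex_of_real (indicator C x)" for x
    by (auto simp: indicator_def)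
  show "integrable lborel (\<lambda>x. indicator C x *\<^sub>R (T f x - kernel_op f x))"
    unfolding e using iTC iKC by (rule Bochner_Integration.integrable_diff)
  have "(LINT x|lborel. T f x * complex_of_real (indicator C x)) = (LINT x|lborel. kernel_op f x * complex_of_real (indicator C x))"
    using l1 l2 LIMSEQ_unique unfolding eq by blast
  then show "(LINT x|lborel. indicator C x *\<^sub>R (T f x - kernel_op f x)) = 0"
    unfolding e using iTC iKC by (subst Bochner_Integration.integral_diff) auto
qed

text \<open>
  If \<open>T f\<close> and the kernel integral differed on a set of positive measure, the real part of some multiple of
  the difference by \<open>1\<close>, \<open>- 1\<close>, \<open>\<i>\<close> or \<open>- \<i>\<close> would be positive on a compact set of positive measure, and
  its integral over that set would not vanish.
\<close>

lemma rep_continuous: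
  assumes f: "continuous_on UNIV f" "compact (supp f)"
  shows "AE x in lborel. x \<notin> supp f \<longrightarrow> T f x = kernel_op f x"
proof -
  have fL: "f \<in> L2_space lborel" using f by (rule L2_compact_continuous)
  have [measurable]: "f \<in> borel_measurable borel" "T f \<in> borel_measurable borel" using fL by auto
  have [measurable]: "supp f \<in> sets borel" using f(2) by (simp add: compact_imp_closed)
  let ?h = "\<lambda>x. T f x - kernel_op f x"
  have *: "AE x in lborel. x \<notin> supp f \<longrightarrow> Re (c * ?h x) \<le> 0" for c
  proof -
    define D where "D = {x \<in> - supp f. 0 < Re (c * ?h x)}"
    have Dm [measurable]: "D \<in> sets borel" unfolding D_def by measurable
    have "emeasure lborel D = 0"
    proof (rule ccontr)
      assume "emeasure lborel D \<noteq> 0"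
      then obtain C where C: "compact C" "C \<subseteq> D" "emeasure lborel C \<noteq> 0" using compact_positive[OF Dm] by blast
      have Cs: "C \<noteq> {}" "C \<inter> supp f = {}" using C by (auto simp: D_def)
      note R = rep_on_compact[OF f C(1) Cs]
      have [measurable]: "C \<in> sets borel" using C by (simp add: compact_imp_closed)
      define v where "v x = indicator C x *\<^sub>R ?h x" for x
      note R = R[folded v_def]
      let ?u = "\<lambda>x. Re (c * v x)"
      have int: "integrable lborel ?u" using R(1) by (intro integrable_Re integrable_mult_right) auto
      have "(LINT x|lborel. ?u x) = Re (c * (LINT x|lborel. v x))"
        using R(1) by (subst integral_Re) auto
      then have "(LINT x|lborel. ?u x) = 0" using R(2) by simp
      moreover have nn: "AE x in lborel. 0 \<le> ?u x" using C(2) by (auto simp: v_def D_def indicator_def intro!: AE_I2 less_imp_le)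
      ultimately have "AE x in lborel. ?u x = 0" using integral_nonneg_eq_0_iff_AE[OF int] by auto
      then have "AE x in lborel. x \<notin> C"
      proof eventually_elim
        case (elim x)
        then show ?case using C(2) by (auto simp: v_def D_def indicator_def)
      qed
      then have "emeasure lborel C = 0" by (subst (asm) AE_iff_measurable[of C]) auto
      then show False using C(3) by simp
    qed
    then have "AE x in lborel. x \<notin> D" by (intro AE_not_in) (auto intro: null_setsI)
    then show ?thesis by eventually_elim (auto simp: D_def not_less)
  qed
  from *[of 1] *[of "-1"] *[of "\<i>"] *[of "-\<i>"] show ?thesis
    by eventually_elim (auto simp: complex_eq_iff)
qed

text \<open>
  The representation survives limits in the mean square sense as long as all supports stay in one
  bounded set \<open>W\<close> away from \<open>V\<close>: there the kernel is bounded, so the kernel integrals converge at every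
  point of \<open>V\<close>, while \<open>T\<close> converges almost everywhere along a subsequence.
\<close>

lemma rep_limit:
  assumes f: "\<And>k. f k \<in> L2_space lborel" and g: "g \<in> L2_space lborel"
    and W: "W \<in> sets borel" "bounded W" "\<And>k x. x \<notin> W \<Longrightarrow> f k x = 0" "\<And>x. x \<notin> W \<Longrightarrow> g x = 0"
    and far: "0 < \<eta>" "\<And>x y. x \<in> V \<Longrightarrow> y \<in> W \<Longrightarrow> \<eta> \<le> dist x y"
    and r: "\<And>k. AE x in lborel. x \<in> V \<longrightarrow> T (f k) x = kernel_op (f k) x"
    and lim: "(\<lambda>k. sqnorm lborel (\<lambda>x. f k x - g x)) \<longlonglongrightarrow> 0"
  shows "AE x in lborel. x \<in> V \<longrightarrow> T g x = kernel_op g x"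
proof -
  obtain s where s: "strict_mono s" "AE x in lborel. (\<lambda>k. T (f (s k)) x) \<longlonglongrightarrow> T g x"
    using T_AE_subseq[OF f g lim] by blast
  have dL: "(\<lambda>x. f k x - g x) \<in> L2_space lborel" for k using f g by auto
  have Wfin: "emeasure lborel W < \<infinity>" using emeasure_bounded_finite[OF W(2)] .
  have fi: "integrable lborel (f k)" for k using f W by (intro L2_integrable_support[of _ W]) auto
  have gi: "integrable lborel g" using g W by (intro L2_integrable_support[of _ W]) auto
  define I where "I k = (LINT y|lborel. cmod (f k y - g y))" for k
  have I0: "0 \<le> I k" for k unfolding I_def by (intro integral_nonneg_AE) auto
  have bd: "ennreal ((I k)\<^sup>2) \<le> sqnorm lborel (\<lambda>x. f k x - g x) * emeasure lborel W" for k
  proof -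
    have "ennreal (I k) = (\<integral>\<^sup>+y. ennreal (cmod (f k y - g y)) \<partial>lborel)"
      unfolding I_def using fi gi by (intro nn_integral_eq_integral[symmetric]) auto
    also have "\<dots> = (\<integral>\<^sup>+y. ennreal (cmod (f k y - g y)) * indicator W y \<partial>lborel)"
      using W by (intro nn_integral_cong) (auto simp: indicator_def)
    finally have "ennreal ((I k)\<^sup>2) = (\<integral>\<^sup>+y. ennreal (cmod (f k y - g y)) * indicator W y \<partial>lborel)\<^sup>2"
      using I0[of k] by (metis ennreal_power)
    then show ?thesis using L2_restr_L1[OF dL, of W k] W(1) by simp
  qed
  have lim0: "(\<lambda>k. sqnorm lborel (\<lambda>x. f k x - g x) * emeasure lborel W) \<longlonglongrightarrow> 0"
    using ennreal_tendsto_cmult[OF _ lim, of "emeasure lborel W"] Wfin by (simp add: mult.commute)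
  have "(\<lambda>k. ennreal ((I k)\<^sup>2)) \<longlonglongrightarrow> 0"
    by (rule tendsto_sandwich[OF _ _ tendsto_const lim0]) (use bd in auto)
  then have "(\<lambda>k. (I k)\<^sup>2) \<longlonglongrightarrow> 0" by (simp add: ennreal_tendsto_0_iff)
  then have "(\<lambda>k. sqrt ((I k)\<^sup>2)) \<longlonglongrightarrow> sqrt 0" by (intro tendsto_real_sqrt)
  then have Il: "I \<longlonglongrightarrow> 0" using I0 by simp
  have Kl: "(\<lambda>k. kernel_op (f k) x) \<longlonglongrightarrow> kernel_op g x" if x: "x \<in> V" for x
  proof -
    have 1: "integrable lborel (\<lambda>y. K x y * f k y)" for k
      using far x W by (intro kernel_op_integrable(1)[OF fi far(1)]) blast
    have 2: "integrable lborel (\<lambda>y. K x y * g y)"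
      using far x W by (intro kernel_op_integrable(1)[OF gi far(1)]) blast
    have bd: "cmod (kernel_op (f k) x - kernel_op g x) \<le> I k / \<eta> ^ CARD('d)" for k
    proof -
      have "kernel_op (f k) x - kernel_op g x = kernel_op (\<lambda>y. f k y - g y) x"
        unfolding kernel_op_def using 1 2 by (subst Bochner_Integration.integral_diff[symmetric]) (auto simp: right_diff_distrib)
      also have "cmod \<dots> \<le> I k / \<eta> ^ CARD('d)"
        unfolding I_def
      proof (rule kernel_op_integrable(2))
        show "integrable lborel (\<lambda>y. f k y - g y)" using fi gi by auto
        fix y assume "f k y - g y \<noteq> 0"
        then have "y \<in> W" using W by force
        then show "\<eta> \<le> dist x y" using far x by auto
      qed (rule far)
      finally show ?thesis .
    qed
    have lim0: "(\<lambda>k. I k / \<eta> ^ CARD('d)) \<longlonglongrightarrow> 0" using tendsto_divide[OF Il tendsto_const, of "\<eta> ^ CARD('d)"] far(1) by simp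
    have "(\<lambda>k. kernel_op (f k) x - kernel_op g x) \<longlonglongrightarrow> 0"
      by (rule Lim_null_comparison[OF always_eventually lim0]) (use bd in blast)
    then show ?thesis by (simp add: LIM_zero_iff)
  qed
  have "AE x in lborel. \<forall>k. x \<in> V \<longrightarrow> T (f k) x = kernel_op (f k) x" using r by (subst AE_all_countable) auto
  with s(2) show ?thesis
  proof eventually_elim
    case (elim x)
    show ?case
    proof
      assume x: "x \<in> V"
      have "(\<lambda>k. kernel_op (f (s k)) x) \<longlonglongrightarrow> T g x" using elim x by simp
      moreover have "(\<lambda>k. kernel_op (f (s k)) x) \<longlonglongrightarrow> kernel_op g x"
        using LIMSEQ_subseq_LIMSEQ[OF Kl[OF x] s(1)] by (simp add: o_def)
      ultimately show "T g x = kernel_op g x" by (rule LIMSEQ_unique)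
    qed
  qed
qed

lemma rep_compact:
  assumes C: "compact C" and far: "0 < \<eta>" "\<And>x y. x \<in> V \<Longrightarrow> y \<in> C \<Longrightarrow> \<eta> \<le> dist x y"
  shows "AE x in lborel. x \<in> V \<longrightarrow> T (indicator C) x = kernel_op (indicator C) x"
proof (cases "C = {}")
  case True
  have eq: "indicator C = (\<lambda>x :: real ^ 'd. 0 :: complex)" using True by auto
  have "AE x in lborel. T (\<lambda>x. 0) x = 0" by (rule T_null) auto
  then show ?thesis by eventually_elim (simp add: eq kernel_op_def)
next
  case False
  define W where "W = {x. infdist x C \<le> \<eta> / 4}"
  have W: "compact W" unfolding W_def using C False by (intro compact_infdist_le) auto
  have Wm [measurable]: "W \<in> sets borel" using W by (simp add: compact_imp_closed)
  have Cm [measurable]: "C \<in> sets borel" using C by (simp add: compact_imp_closed)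
  have CW: "C \<subseteq> W" using far(1) by (auto simp: W_def)
  have farW: "\<eta> / 4 \<le> dist x y" if x: "x \<in> V" and y: "y \<in> W" for x y
  proof -
    obtain a where a: "a \<in> C" "dist y a < \<eta> / 4 + \<eta> / 4"
      using infdist_near[OF False, of y "\<eta> / 4" "\<eta> / 4"] y far by (auto simp: W_def)
    then show ?thesis using far(1) far(2)[OF x a(1)] dist_triangle[of x a y] by simp
  qed
  obtain k0 :: nat where k0: "1 / (\<eta> / 4) < k0" using reals_Archimedean2 by blast
  define g where "g k x = complex_of_real (bump C (k + k0) x)" for k x
  have gW: "x \<in> W" if "g k x \<noteq> 0" for k x
    using bump_support[of "\<eta> / 4" "k + k0" C x] that k0 far(1) by (auto simp: g_def W_def)
  have [measurable]: "g k \<in> borel_measurable borel" for k unfolding g_def by measurable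
  have gc: "continuous_on UNIV (g k)" "compact (supp (g k))" for k
  proof -
    show "continuous_on UNIV (g k)" unfolding g_def by (intro continuous_intros)
    show "compact (supp (g k))" using W gW by (rule supp_compact)
  qed
  have gV: "x \<notin> supp (g k)" if "x \<in> V" for k x
    using supp_subset_closed[of W "g k"] gW W farW[OF that, of x] far(1) by (auto simp: compact_imp_closed)
  have d1: "(cmod (g k x - indicator C x))\<^sup>2 \<le> indicator W x" for k x
  proof (cases "x \<in> W")
    case True
    have "\<bar>bump C (k + k0) x - indicator C x\<bar> \<le> 1" using bump_bounds[of C "k + k0" x] by (auto simp: indicator_def)
    moreover have "g k x - indicator C x = complex_of_real (bump C (k + k0) x - indicator C x)"
      by (auto simp: g_def indicator_def)
    ultimately show ?thesis using True by (simp only: norm_of_real) (simp add: abs_square_le_1 power2_abs)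
  next
    case False
    then have "x \<notin> C" "g k x = 0" using gW[of k x] CW by (blast, blast)
    then show ?thesis by simp
  qed
  show ?thesis
  proof (rule rep_limit[where W = W and \<eta> = "\<eta> / 4" and f = g])
    show "g k \<in> L2_space lborel" for k using gc by (rule L2_compact_continuous)
    show "indicator C \<in> L2_space lborel" using emeasure_compact_finite[OF C]
      by (intro L2_bounded[of _ _ C 1]) (auto simp: indicator_def)
    show "W \<in> sets borel" "bounded W" using W by (auto simp: compact_imp_bounded)
    show "AE x in lborel. x \<in> V \<longrightarrow> T (g k) x = kernel_op (g k) x" for k
      using rep_continuous[OF gc] by eventually_elim (use gV in blast)
    show "(\<lambda>k. sqnorm lborel (\<lambda>x. g k x - indicator C x)) \<longlonglongrightarrow> 0"
    proof -
      have gl: "(\<lambda>k. ennreal ((cmod (g k x - indicator C x))\<^sup>2)) \<longlonglongrightarrow> 0" for x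
      proof -
        have "(\<lambda>k. bump C (k + k0) x) \<longlonglongrightarrow> indicator C x"
          using C False by (intro LIMSEQ_ignore_initial_segment bump_tendsto) (auto simp: compact_imp_closed)
        then have "(\<lambda>k. g k x) \<longlonglongrightarrow> complex_of_real (indicator C x)" unfolding g_def by (intro tendsto_of_real)
        then have "(\<lambda>k. (cmod (g k x - complex_of_real (indicator C x)))\<^sup>2) \<longlonglongrightarrow> (cmod (complex_of_real (indicator C x) - complex_of_real (indicator C x)))\<^sup>2"
          by (intro tendsto_intros)
        moreover have "complex_of_real (indicator C x) = indicator C x" by (auto simp: indicator_def)
        ultimately show ?thesis by (simp add: ennreal_tendsto_0_iff)
      qed
      have "(\<lambda>k. \<integral>\<^sup>+x. ennreal ((cmod (g k x - indicator C x))\<^sup>2) \<partial>lborel) \<longlonglongrightarrow> (\<integral>\<^sup>+(x :: real ^ 'd). 0 \<partial>lborel)"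
      proof (rule nn_integral_dominated_convergence[where w = "indicator W"])
        show "(\<integral>\<^sup>+x. indicator W x \<partial>lborel) < \<infinity>" using emeasure_compact_finite[OF W] by simp
        show "AE x in lborel. ennreal ((cmod (g k x - indicator C x))\<^sup>2) \<le> indicator W x" for k
        proof (rule AE_I2)
          fix x
          show "ennreal ((cmod (g k x - indicator C x))\<^sup>2) \<le> indicator W x"
            using ennreal_leI[OF d1[of k x]] by (simp only: ennreal_indicator)
        qed
      qed (use gl in auto)
      then show ?thesis by (simp add: sqnorm_def)
    qed
  qed (use gW CW farW far(1) in \<open>auto simp: indicator_def\<close>)
qed

lemma rep_set:
  assumes A: "A \<in> sets borel" "bounded A" and far: "0 < \<eta>" "\<And>x y. x \<in> V \<Longrightarrow> y \<in> A \<Longrightarrow> \<eta> \<le> dist x y"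
  shows "AE x in lborel. x \<in> V \<longrightarrow> T (indicator A) x = kernel_op (indicator A) x"
proof -
  have "\<exists>C. compact C \<and> C \<subseteq> A \<and> emeasure lborel (A - C) < ennreal (inverse (real (Suc k)))" for k
    by (rule compact_inner[OF A, of "inverse (real (Suc k))"]) auto
  then obtain C where C: "\<And>k. compact (C k)" "\<And>k. C k \<subseteq> A" "\<And>k. emeasure lborel (A - C k) < ennreal (inverse (real (Suc k)))"
    by metis
  have [measurable]: "A \<in> sets borel" "C k \<in> sets borel" for k using A C(1)[of k] by (auto simp: compact_imp_closed)
  show ?thesis
  proof (rule rep_limit[where W = A and \<eta> = \<eta> and f = "\<lambda>k. indicator (C k)"])
    show "indicator A \<in> L2_space lborel" using emeasure_bounded_finite[OF A(2)]
      by (intro L2_bounded[of _ _ A 1]) (auto simp: indicator_def)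
    show "indicator (C k) \<in> L2_space lborel" for k using emeasure_compact_finite[OF C(1)[of k]]
      by (intro L2_bounded[of _ _ "C k" 1]) (auto simp: indicator_def)
    show "AE x in lborel. x \<in> V \<longrightarrow> T (indicator (C k)) x = kernel_op (indicator (C k)) x" for k
      using C far by (intro rep_compact[of _ \<eta>]) blast+
    show "(\<lambda>k. sqnorm lborel (\<lambda>x. indicator (C k) x - indicator A x)) \<longlonglongrightarrow> 0"
    proof (rule tendsto_sandwich[OF _ _ tendsto_const])
      have "sqnorm lborel (\<lambda>x. indicator (C k) x - indicator A x) = (\<integral>\<^sup>+x. indicator (A - C k) x \<partial>lborel)" for k
        unfolding sqnorm_def using C(2)[of k] by (intro nn_integral_cong) (auto simp: indicator_def)
      then show "\<forall>\<^sub>F k in sequentially. sqnorm lborel (\<lambda>x. indicator (C k) x - indicator A x) \<le> ennreal (inverse (real (Suc k)))"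
        using C(3) by (auto intro!: always_eventually less_imp_le)
      show "(\<lambda>k. ennreal (inverse (real (Suc k)))) \<longlonglongrightarrow> 0"
        using LIMSEQ_inverse_real_of_nat by (simp add: ennreal_tendsto_0_iff)
    qed auto
  qed (use A far C(2) in \<open>auto simp: indicator_def\<close>)
qed

lemma rep_simple:
  assumes I: "finite I" and A: "\<And>v. v \<in> I \<Longrightarrow> A v \<in> sets borel" "\<And>v. v \<in> I \<Longrightarrow> A v \<subseteq> W" "bounded W"
    and far: "0 < \<eta>" "\<And>x y. x \<in> V \<Longrightarrow> y \<in> W \<Longrightarrow> \<eta> \<le> dist x y"
  shows "AE x in lborel. x \<in> V \<longrightarrow> T (\<lambda>y. \<Sum>v\<in>I. v * indicator (A v) y) x = kernel_op (\<lambda>y. \<Sum>v\<in>I. v * indicator (A v) y) x"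
proof -
  have bA: "bounded (A v)" if "v \<in> I" for v using bounded_subset[OF A(3) A(2)[OF that]] .
  have L: "indicator (A v) \<in> L2_space lborel" if "v \<in> I" for v
    using emeasure_bounded_finite[OF bA[OF that]] A(1)[OF that]
    by (intro L2_bounded[of _ _ "A v" 1]) (auto simp: indicator_def)
  have i: "integrable lborel (indicator (A v) :: _ \<Rightarrow> complex)" if "v \<in> I" for v
    using L[OF that] A(1)[OF that] bA[OF that] by (intro L2_integrable_support[of _ "A v"]) auto
  have "AE x in lborel. T (\<lambda>y. \<Sum>v\<in>I. v * indicator (A v) y) x = (\<Sum>v\<in>I. T (\<lambda>y. v * indicator (A v) y) x)"
    using I L by (intro T_sum) auto
  moreover have "AE x in lborel. \<forall>v\<in>I. T (\<lambda>y. v * indicator (A v) y) x = v * T (indicator (A v)) x"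
    using I L T_scale by (intro AE_finite_allI) auto
  moreover have "AE x in lborel. \<forall>v\<in>I. x \<in> V \<longrightarrow> T (indicator (A v)) x = kernel_op (indicator (A v)) x"
    using I A far bA by (intro AE_finite_allI rep_set[of _ \<eta>]) blast+
  ultimately show ?thesis
  proof eventually_elim
    case (elim x)
    show ?case
    proof
      assume x: "x \<in> V"
      have "integrable lborel (\<lambda>y. K x y * indicator (A v) y)" if "v \<in> I" for v
      proof (rule kernel_op_integrable(1)[OF i[OF that] far(1)])
        fix y assume "indicator (A v) y \<noteq> (0::complex)"
        then show "\<eta> \<le> dist x y" using far(2)[OF x] A(2)[OF that] by (auto simp: indicator_def split: if_splits)
      qed
      then have iv: "integrable lborel (\<lambda>y. v * (K x y * indicator (A v) y))" if "v \<in> I" for v using that by auto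
      have "kernel_op (\<lambda>y. \<Sum>v\<in>I. v * indicator (A v) y) x = (LINT y|lborel. (\<Sum>v\<in>I. v * (K x y * indicator (A v) y)))"
        unfolding kernel_op_def by (simp add: sum_distrib_left mult_ac)
      also have "\<dots> = (\<Sum>v\<in>I. v * kernel_op (indicator (A v)) x)"
        unfolding kernel_op_def using iv by (subst Bochner_Integration.integral_sum) auto
      finally show "T (\<lambda>y. \<Sum>v\<in>I. v * indicator (A v) y) x = kernel_op (\<lambda>y. \<Sum>v\<in>I. v * indicator (A v) y) x"
        using elim x by simp
    qed
  qed
qed

text \<open>
  Continuous functions approximate indicator functions of compact sets, these approximate indicator
  functions of bounded measurable sets, and simple functions approximate \<open>f\<close>; \<open>rep_limit\<close> applies at
  each stage.
\<close>

lemma kernel_representation: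
  assumes f: "f \<in> L2_space lborel" and W: "W \<in> sets borel" "bounded W" "\<And>x. x \<notin> W \<Longrightarrow> f x = 0"
    and far: "0 < \<eta>" "\<And>x y. x \<in> V \<Longrightarrow> y \<in> W \<Longrightarrow> \<eta> \<le> dist x y"
  shows "AE x in lborel. x \<in> V \<longrightarrow> T f x = kernel_op f x"
proof -
  have [measurable]: "f \<in> borel_measurable borel" "W \<in> sets borel" using f W by auto
  obtain s where s: "\<And>k. simple_function lborel (s k)" "\<And>x. (\<lambda>k. s k x) \<longlonglongrightarrow> f x" "\<And>k x. cmod (s k x) \<le> 2 * cmod (f x)"
    using borel_measurable_implies_sequence_metric[of f lborel 0] by (auto simp: dist_norm)
  have [measurable]: "s k \<in> borel_measurable borel" for k using borel_measurable_simple_function[OF s(1)[of k]] by simp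
  have sW: "s k x = 0" if "x \<notin> W" for k x using s(3)[of k x] W(3)[OF that] by simp
  show ?thesis
  proof (rule rep_limit[where W = W and \<eta> = \<eta> and f = s])
    show "s k \<in> L2_space lborel" for k
      using L2_scale[OF f, of 2] s(3)[of k] by (intro L2_mono[OF L2_scale[OF f, of 2]]) (auto simp: norm_mult)
    show "AE x in lborel. x \<in> V \<longrightarrow> T (s k) x = kernel_op (s k) x" for k
    proof -
      define A where "A v = {x \<in> W. s k x = v}" for v
      have fin: "finite (range (s k))" using simple_functionD(1)[OF s(1)[of k]] by simp
      have "s k x = (\<Sum>v\<in>range (s k). v * indicator (A v) x)" for x
      proof (cases "x \<in> W")
        case True
        have "(\<Sum>v\<in>range (s k). v * indicator (A v) x) = (\<Sum>v\<in>{s k x}. v * indicator (A v) x)"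
          using fin by (intro sum.mono_neutral_right) (auto simp: A_def)
        then show ?thesis using True by (simp add: A_def)
      next
        case False
        then show ?thesis using sW by (simp add: A_def)
      qed
      then have "s k = (\<lambda>x. \<Sum>v\<in>range (s k). v * indicator (A v) x)" by blast
      moreover have "A v \<in> sets borel" for v unfolding A_def by measurable
      ultimately show ?thesis
        using rep_simple[OF fin, of A W \<eta> V] W(2) far by (auto simp: A_def)
    qed
    show "(\<lambda>k. sqnorm lborel (\<lambda>x. s k x - f x)) \<longlonglongrightarrow> 0"
    proof -
      have "(\<lambda>k. \<integral>\<^sup>+x. ennreal ((cmod (s k x - f x))\<^sup>2) \<partial>lborel) \<longlonglongrightarrow> (\<integral>\<^sup>+(x :: real ^ 'd). 0 \<partial>lborel)"
      proof (rule nn_integral_dominated_convergence[where w = "\<lambda>x. ennreal (9 * (cmod (f x))\<^sup>2)"])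
        have "(\<integral>\<^sup>+x. ennreal (9 * (cmod (f x))\<^sup>2) \<partial>lborel) = 9 * sqnorm lborel f"
          unfolding sqnorm_def by (simp add: ennreal_mult nn_integral_cmult)
        also have "\<dots> < \<infinity>" using f by (simp add: L2_space_iff ennreal_mult_less_top)
        finally show "(\<integral>\<^sup>+x. ennreal (9 * (cmod (f x))\<^sup>2) \<partial>lborel) < \<infinity>" .
        have "(cmod (s k x - f x))\<^sup>2 \<le> 9 * (cmod (f x))\<^sup>2" for k x
        proof -
          have "cmod (s k x - f x) \<le> 3 * cmod (f x)" using norm_triangle_ineq4[of "s k x" "f x"] s(3)[of k x] by simp
          then have "(cmod (s k x - f x))\<^sup>2 \<le> (3 * cmod (f x))\<^sup>2" by (intro power_mono) auto
          then show ?thesis by (simp add: power_mult_distrib)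
        qed
        then show "AE x in lborel. ennreal ((cmod (s k x - f x))\<^sup>2) \<le> ennreal (9 * (cmod (f x))\<^sup>2)" for k
          by (auto intro!: AE_I2 ennreal_leI)
        have "(\<lambda>k. (cmod (s k x - f x))\<^sup>2) \<longlonglongrightarrow> (cmod (f x - f x))\<^sup>2" for x by (intro tendsto_intros s(2))
        then show "AE x in lborel. (\<lambda>k. ennreal ((cmod (s k x - f x))\<^sup>2)) \<longlonglongrightarrow> 0"
          by (auto simp: ennreal_tendsto_0_iff)
      qed auto
      then show ?thesis by (simp add: sqnorm_def)
    qed
  qed (use W sW far f in auto)
qed

end

section \<open>The local weak type estimate\<close>

locale cz_grid = cz_operator T M \<epsilon> K + grid L
  for T :: "(real ^ 'd \<Rightarrow> complex) \<Rightarrow> real ^ 'd \<Rightarrow> complex" and M \<epsilon> K and L :: real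
begin

definition triple_avg :: "(real ^ 'd \<Rightarrow> complex) \<Rightarrow> 'd cell \<Rightarrow> real" where
  "triple_avg f P = (LINT x|lborel. cmod (restr (triple P) f x)) / (3 * side (fst P)) ^ CARD('d)"

lemma tail_nonneg: "0 \<le> tail_const \<epsilon> TYPE('d)" by (rule tail_const_nonneg[OF eps])

lemma emeasure_triple_finite: "emeasure lborel (triple (P :: 'd cell)) < \<infinity>"
  by (simp add: emeasure_triple)

lemma emeasure_cell_finite: "emeasure lborel (cell (P :: 'd cell)) < \<infinity>"
  by (simp add: emeasure_cell)

lemma restr_triple_integrable: "f \<in> L2_space lborel \<Longrightarrow> integrable lborel (restr (triple (P :: 'd cell)) f)"
  using emeasure_triple_finite by (intro L2_integrable_on_finite) auto

lemma restr_cell_integrable: "f \<in> L2_space lborel \<Longrightarrow> integrable lborel (restr (cell (P :: 'd cell)) f)"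
  using emeasure_cell_finite by (intro L2_integrable_on_finite) auto

lemma nn_integral_restr:
  assumes "integrable lborel (restr S f)"
  shows "(\<integral>\<^sup>+x. ennreal (cmod (f x)) * indicator S x \<partial>lborel) = ennreal (LINT x|lborel. cmod (restr S f x))"
proof -
  have "(\<integral>\<^sup>+x. ennreal (cmod (f x)) * indicator S x \<partial>lborel) = (\<integral>\<^sup>+x. ennreal (cmod (restr S f x)) \<partial>lborel)"
    by (intro nn_integral_cong) (auto simp: restr_apply)
  also have "\<dots> = ennreal (LINT x|lborel. cmod (restr S f x))"
    using assms by (intro nn_integral_eq_integral) auto
  finally show ?thesis .
qed

lemma triple_avg_nonneg: "0 \<le> triple_avg f P"
  unfolding triple_avg_def using less_imp_le[OF side_pos[of "fst P"]]
  by (intro divide_nonneg_nonneg integral_nonneg_AE) auto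

lemma triple_avg_times: "triple_avg f P * (3 * side (fst P)) ^ CARD('d) = (LINT x|lborel. cmod (restr (triple P) f x))"
  unfolding triple_avg_def using side_pos[of "fst P"] by simp

lemma triple_avg_nn:
  assumes f: "f \<in> L2_space lborel"
  shows "(\<integral>\<^sup>+x. ennreal (cmod (f x)) * indicator (triple P) x \<partial>lborel) = ennreal (triple_avg f P) * emeasure lborel (triple P)"
  unfolding nn_integral_restr[OF restr_triple_integrable[OF f]] triple_avg_times[symmetric] emeasure_triple
  using triple_avg_nonneg side_pos[of "fst P"] by (simp add: ennreal_mult)

lemma cell_nonempty: "cell (P :: 'd cell) \<noteq> {}"
proof
  assume "cell P = {}"
  then have "emeasure lborel (cell P) = 0" by simp
  then show False using side_pos[of "fst P"] by (simp add: emeasure_cell)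
qed

text \<open>
  Since \<open>b\<close> has integral zero, \<open>K x c\<close> may be subtracted from the kernel for a fixed point \<open>c\<close> of the cell, and
  the oscillation of the kernel in its second variable takes over.
\<close>

lemma atom_tail:
  fixes P :: "'d cell"
  assumes b: "b \<in> L2_space lborel" "\<And>x. x \<notin> cell P \<Longrightarrow> b x = 0" and mean: "(LINT x|lborel. b x) = 0"
    and n0: "n0 \<le> fst P"
  shows "(\<integral>\<^sup>+x. ennreal (cmod (T b x)) * indicator (triple (anc n0 P) - triple P) x \<partial>lborel)
    \<le> ennreal (tail_const \<epsilon> TYPE('d) * (LINT x|lborel. cmod (b x)))"
proof -
  obtain c where c: "c \<in> cell P" using cell_nonempty by blast
  have bc: "bounded (cell P)" using bounded_subset[OF bounded_triple cell_subset_triple] .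
  have bi: "integrable lborel b" using b bc by (intro L2_integrable_support[of b "cell P"]) auto
  let ?b = "LINT x|lborel. cmod (b x)"
  have b0: "0 \<le> ?b" by (intro integral_nonneg_AE) auto
  have far: "side (fst P) \<le> dist x y" if "x \<in> - triple P" "y \<in> cell P" for x y
    using triple_far[OF that(2), of x] that(1) by (simp add: dist_norm norm_minus_commute)
  have "AE x in lborel. x \<in> - triple P \<longrightarrow> T b x = kernel_op b x"
    using b bc far side_pos by (intro kernel_representation[of b "cell P" "side (fst P)"]) auto
  then have "AE x in lborel. ennreal (cmod (T b x)) * indicator (triple (anc n0 P) - triple P) x
      \<le> ennreal (kernel_majorant \<epsilon> n0 P x) * ennreal ?b"
  proof eventually_elim
    case (elim x)
    show ?case
    proof (cases "x \<in> triple (anc n0 P) - triple P")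
      case True
      have 1: "integrable lborel (\<lambda>y. K x y * b y)"
        using far[of x] True b side_pos by (intro kernel_op_integrable(1)[OF bi, of "side (fst P)"]) auto
      have 2: "integrable lborel (\<lambda>y. K x c * b y)" using bi by auto
      have "T b x = kernel_op b x" using elim True by auto
      also have "\<dots> = (LINT y|lborel. K x y * b y - K x c * b y)"
        unfolding kernel_op_def using 1 2 mean by (subst Bochner_Integration.integral_diff) auto
      finally have "cmod (T b x) \<le> (LINT y|lborel. cmod (K x y * b y - K x c * b y))"
        using integral_norm_bound[of lborel "\<lambda>y. K x y * b y - K x c * b y"] by metis
      also have "\<dots> \<le> (LINT y|lborel. kernel_majorant \<epsilon> n0 P x * cmod (b y))"
      proof (rule integral_mono)
        show "integrable lborel (\<lambda>y. cmod (K x y * b y - K x c * b y))" using 1 2 by auto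
        show "integrable lborel (\<lambda>y. kernel_majorant \<epsilon> n0 P x * cmod (b y))" using bi by auto
        fix y
        show "cmod (K x y * b y - K x c * b y) \<le> kernel_majorant \<epsilon> n0 P x * cmod (b y)"
        proof (cases "y \<in> cell P")
          case y: True
          have "cmod (K x y - K x c) \<le> kernel_majorant \<epsilon> n0 P x"
            using kernel_osc[OF cz_kernel_transpose[OF kernel] eps y c, of x n0] True n0 by auto
          then show ?thesis by (simp add: left_diff_distrib[symmetric] norm_mult mult_right_mono)
        next
          case False
          then show ?thesis using b(2) by simp
        qed
      qed
      finally have "cmod (T b x) \<le> kernel_majorant \<epsilon> n0 P x * ?b" by simp
      then show ?thesis using True kernel_majorant_nonneg[of \<epsilon> n0 P x] b0 by (simp add: ennreal_mult'[symmetric] ennreal_leI)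
    qed simp
  qed
  then have "(\<integral>\<^sup>+x. ennreal (cmod (T b x)) * indicator (triple (anc n0 P) - triple P) x \<partial>lborel)
      \<le> (\<integral>\<^sup>+x. ennreal (kernel_majorant \<epsilon> n0 P x) * ennreal ?b \<partial>lborel)"
    by (rule nn_integral_mono_AE)
  also have "\<dots> = (\<integral>\<^sup>+x. ennreal (kernel_majorant \<epsilon> n0 P x) * 1 \<partial>lborel) * ennreal ?b"
    by (subst nn_integral_multc) auto
  also have "\<dots> \<le> ennreal (tail_const \<epsilon> TYPE('d) * 1) * ennreal ?b"
    by (intro mult_right_mono kernel_majorant_integral eps) auto
  also have "\<dots> = ennreal (tail_const \<epsilon> TYPE('d) * ?b)" using tail_nonneg b0 by (simp add: ennreal_mult)
  finally show ?thesis .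
qed

text \<open>
  The three terms come from the good part, the bad part off the triples of the stopping cells, and
  those triples.
\<close>

definition weak_base :: real where
  "weak_base = 12 * 2 ^ CARD('d) * M + 4 * tail_const \<epsilon> TYPE('d) + 3 ^ CARD('d)"

definition weak_const :: "real \<Rightarrow> real" where
  "weak_const \<delta> = 3 ^ CARD('d) * (1 + weak_base / \<delta>)"

lemma weak_base_nonneg: "0 \<le> weak_base"
  unfolding weak_base_def using M_nonneg tail_nonneg by (intro add_nonneg_nonneg mult_nonneg_nonneg) auto

lemma weak_const_pos: "0 < \<delta> \<Longrightarrow> 0 < weak_const \<delta>"
  unfolding weak_const_def using weak_base_nonneg by (intro mult_pos_pos add_pos_nonneg) auto

text \<open>
  The Calderon-Zygmund decomposition of \<open>f 1\<^bsub>3Q\<^esub>\<close> at a height \<open>l\<close> proportional to its average. The height is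
  so large that no cell of the generation of \<open>Q\<close> is selected. Only finitely many stopping cells
  contribute to the bad part, so that \<open>T\<close> is applied to finite sums; the other stopping cells are left in
  the good part, where their contribution to the square integral is negligible.
\<close>

lemma local_weak_type:
  assumes f: "f \<in> L2_space lborel" and \<delta>: "0 < \<delta>"
  shows "emeasure lborel {x \<in> cell Q. weak_const \<delta> * triple_avg f Q < cmod (T (restr (triple Q) f) x)} \<le> ennreal \<delta> * emeasure lborel (cell Q)"
proof (cases "triple_avg f Q = 0")
  case True
  have FL: "restr (triple Q) f \<in> L2_space lborel" using f by auto
  have [measurable]: "f \<in> borel_measurable borel" "T (restr (triple Q) f) \<in> borel_measurable borel" using f FL by auto
  have "(\<integral>\<^sup>+x. ennreal (cmod (f x)) * indicator (triple Q) x \<partial>lborel) = 0" using triple_avg_nn[OF f, of Q] True by simp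
  then have "AE x in lborel. ennreal (cmod (f x)) * indicator (triple Q) x = 0" by (subst (asm) nn_integral_0_iff_AE) auto
  then have "AE x in lborel. restr (triple Q) f x = 0" by eventually_elim (auto simp: restr_apply)
  then have "AE x in lborel. T (restr (triple Q) f) x = 0" by (rule T_null[OF FL])
  then have "AE x in lborel. x \<notin> {x \<in> cell Q. weak_const \<delta> * triple_avg f Q < cmod (T (restr (triple Q) f) x)}"
    by eventually_elim (auto simp: True)
  then have "emeasure lborel {x \<in> cell Q. weak_const \<delta> * triple_avg f Q < cmod (T (restr (triple Q) f) x)} = 0"
    by (subst (asm) AE_iff_measurable[OF _ refl]) auto
  then show ?thesis by simp
next
  case False
  define n0 where "n0 = fst Q"
  define A where "A = triple_avg f Q"
  have A: "0 < A" using triple_avg_nonneg[of f Q] False by (simp add: A_def)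
  define F where "F = restr (triple Q) f"
  have FL: "F \<in> L2_space lborel" unfolding F_def using f by auto
  have [measurable]: "F \<in> borel_measurable borel" "T F \<in> borel_measurable borel" using FL by auto
  define v where "v P = side (fst P) ^ CARD('d)" for P :: "'d cell"
  have v: "0 < v P" "emeasure lborel (cell P) = ennreal (v P)" for P :: "'d cell" using side_pos by (auto simp: v_def emeasure_cell)
  have v3: "(3 * side (fst P)) ^ CARD('d) = 3 ^ CARD('d) * v P" for P :: "'d cell" by (simp add: v_def power_mult_distrib)
  define I where "I = (LINT x|lborel. cmod (F x))"
  have I: "I = 3 ^ CARD('d) * (A * v Q)" unfolding I_def F_def triple_avg_times[symmetric] v3 A_def by simp
  have I0: "0 < I" unfolding I using A v by simp
  have Fi: "integrable lborel F" unfolding F_def using f by (rule restr_triple_integrable)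
  have Inn: "(\<integral>\<^sup>+x. ennreal (cmod (F x)) \<partial>lborel) = ennreal I" unfolding I_def using Fi by (intro nn_integral_eq_integral) auto
  define p where "p P = (LINT x|lborel. cmod (restr (cell P) F x))" for P :: "'d cell"
  have pnn: "(\<integral>\<^sup>+x. ennreal (cmod (F x)) * indicator (cell P) x \<partial>lborel) = ennreal (p P)" for P
    unfolding p_def using FL by (intro nn_integral_restr restr_cell_integrable)
  have p0: "0 \<le> p P" for P unfolding p_def by (intro integral_nonneg_AE) auto
  have pmono: "p P \<le> p R" if "cell P \<subseteq> cell R" for P R
  proof -
    have "ennreal (p P) \<le> ennreal (p R)"
      unfolding pnn[symmetric] using that by (intro nn_integral_mono mult_left_mono) (auto simp: indicator_def)
    then show ?thesis using p0 by simp
  qed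
  have pI: "p P \<le> I" for P
  proof -
    have "ennreal (p P) \<le> ennreal I"
      unfolding pnn[symmetric] Inn[symmetric] by (intro nn_integral_mono) (auto simp: indicator_def)
    then show ?thesis using I0 by simp
  qed
  define \<kappa> where "\<kappa> = weak_const \<delta>"
  define l where "l = \<kappa> * A"
  have k3: "3 ^ CARD('d) \<le> \<kappa>" unfolding \<kappa>_def weak_const_def using weak_base_nonneg \<delta> by simp
  have l: "0 < l" unfolding l_def \<kappa>_def using weak_const_pos[OF \<delta>] A by simp
  define Sel where "Sel P \<longleftrightarrow> l * v P < p P" for P
  define S where "S = stopping n0 Sel"
  define \<Omega> where "\<Omega> = (\<Union>P\<in>S. cell P)"
  (* The initial cells are not selected: the integral over one of them is at most the whole
     integral, which is 3^d times the average times the measure of the cell. *)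
  have top: "\<not> Sel R" if "fst R = n0" for R
  proof -
    have "v R = v Q" using that by (simp add: v_def n0_def)
    have "p R \<le> 3 ^ CARD('d) * (A * v R)" using pI[of R] \<open>v R = v Q\<close> by (simp add: I)
    also have "\<dots> \<le> \<kappa> * (A * v R)" using k3 A v(1)[of R] by (intro mult_right_mono) auto
    finally have "p R \<le> l * v R" by (simp add: l_def mult.assoc)
    then show ?thesis by (simp add: Sel_def)
  qed
  have SP: "n0 \<le> fst P" "l * v P \<le> p P" "p P \<le> 2 ^ CARD('d) * l * v P" if P: "P \<in> S" for P
  proof -
    show "n0 \<le> fst P" "l * v P \<le> p P" using P by (auto simp: S_def stopping_def Sel_def)
    obtain n where n: "n0 \<le> n" "fst P = Suc n" "\<not> Sel (anc n P)"
      using stopping_parent[of P n0 Sel] P top unfolding S_def by blast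
    have "p P \<le> p (anc n P)" using cell_anc[of n P] n by (intro pmono) auto
    also have "\<dots> \<le> l * v (anc n P)" using n by (simp add: Sel_def)
    also have "v (anc n P) = 2 ^ CARD('d) * v P" using n by (simp add: v_def side_Suc[of n] power_mult_distrib)
    finally show "p P \<le> 2 ^ CARD('d) * l * v P" by (simp add: mult_ac)
  qed
  have dS: "disjoint_family_on cell S" unfolding S_def by (rule stopping_disjoint_family)
  have [measurable]: "\<Omega> \<in> sets borel" unfolding \<Omega>_def by simp
  have good: "AE x in lborel. x \<notin> \<Omega> \<longrightarrow> cmod (F x) \<le> l"
  proof -
    have "AE x in lborel. x \<in> - \<Omega> \<longrightarrow> ennreal (cmod (F x)) \<le> ennreal l"
    proof (rule dyadic_average_AE[where ?n0.0 = n0])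
      fix x n assume x: "x \<in> - \<Omega>" and n: "n0 \<le> n"
      have "\<not> Sel (n, coord n x)" using stopping_covers[of n0 n Sel x] n x unfolding \<Omega>_def S_def by blast
      then show "(\<integral>\<^sup>+y. ennreal (cmod (F y)) * indicator (cell (n, coord n x)) y \<partial>lborel) \<le> ennreal l * emeasure lborel (cell (n, coord n x))"
        unfolding pnn v using l by (simp add: Sel_def ennreal_mult'[symmetric] ennreal_leI)
    qed (use l in auto)
    then show ?thesis by eventually_elim (use l in auto)
  qed
  (* Finitely many stopping cells carry all of the square integral over the stopping cells except
     for an amount that the good part can absorb. *)
  obtain J where J: "finite J" "J \<subseteq> S" "(\<integral>\<^sup>+x. ennreal ((cmod (F x))\<^sup>2) * indicator (\<Omega> - (\<Union>P\<in>J. cell P)) x \<partial>lborel) \<le> ennreal (l * I)"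
  proof -
    let ?\<nu> = "density lborel (\<lambda>x. ennreal ((cmod (F x))\<^sup>2))"
    define Jk where "Jk k = S \<inter> from_nat ` {..<k}" for k :: nat
    define D where "D k = \<Omega> - (\<Union>P\<in>Jk k. cell P)" for k
    have Dm [measurable]: "D k \<in> sets borel" for k unfolding D_def by simp
    have em: "emeasure ?\<nu> B = (\<integral>\<^sup>+x. ennreal ((cmod (F x))\<^sup>2) * indicator B x \<partial>lborel)" if "B \<in> sets borel" for B
      using that by (simp add: emeasure_density)
    have "emeasure ?\<nu> (D k) \<le> sqnorm lborel F" for k
      unfolding em[OF Dm] sqnorm_def by (intro nn_integral_mono) (auto simp: indicator_def)
    then have fin: "emeasure ?\<nu> (D k) \<noteq> \<infinity>" for k using FL by (metis L2_space_iff infinity_ennreal_def leD)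
    have "(\<lambda>k. emeasure ?\<nu> (D k)) \<longlonglongrightarrow> emeasure ?\<nu> (\<Inter>k. D k)"
      using fin by (intro Lim_emeasure_decseq) (auto simp: decseq_def D_def Jk_def)
    moreover have "(\<Inter>k. D k) = {}"
    proof -
      have "x \<notin> (\<Inter>k. D k)" for x
      proof
        assume x: "x \<in> (\<Inter>k. D k)"
        then obtain P where P: "P \<in> S" "x \<in> cell P" by (auto simp: D_def \<Omega>_def)
        have "P \<in> Jk (Suc (to_nat P))" using P by (auto simp: Jk_def intro!: image_eqI[of _ _ "to_nat P"])
        then have "x \<notin> D (Suc (to_nat P))" using P by (auto simp: D_def)
        then show False using x by auto
      qed
      then show ?thesis by blast
    qed
    ultimately have "(\<lambda>k. emeasure ?\<nu> (D k)) \<longlonglongrightarrow> 0" by simp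
    moreover have "(0::ennreal) < ennreal (l * I)" using l I0 by simp
    ultimately have "eventually (\<lambda>k. emeasure ?\<nu> (D k) < ennreal (l * I)) sequentially" by (rule order_tendstoD)
    then obtain k where "emeasure ?\<nu> (D k) < ennreal (l * I)" using eventually_happens' sequentially_bot by blast
    then show thesis using that[of "Jk k"] unfolding em[OF Dm] by (auto simp: Jk_def D_def less_imp_le)
  qed
  define m where "m P = (LINT x|lborel. restr (cell P) F x) / v P" for P
  define b where "b P = restr (cell P) (\<lambda>x. F x - m P)" for P
  define g where "g x = F x - (\<Sum>P\<in>J. b P x)" for x
  have mb: "cmod (m P) * v P \<le> p P" for P
    unfolding m_def p_def using v(1)[of P] integral_norm_bound[of lborel "restr (cell P) F"] by (simp add: norm_divide)
  have constL: "restr (cell P) (\<lambda>x. c) \<in> L2_space lborel" for P :: "'d cell" and c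
    using emeasure_cell_finite by (intro L2_bounded[of _ _ "cell P" "cmod c"]) (auto simp: restr_apply)
  have b_eq: "b P = (\<lambda>x. restr (cell P) F x - restr (cell P) (\<lambda>x. m P) x)" for P
    by (auto simp: b_def restr_apply fun_eq_iff)
  have bL: "b P \<in> L2_space lborel" for P unfolding b_eq using FL constL by (intro L2_diff) auto
  have [measurable]: "b P \<in> borel_measurable borel" for P using L2_spaceD[OF bL[of P]] by simp
  have gL: "g \<in> L2_space lborel" unfolding g_def[abs_def] using FL bL by (intro L2_diff L2_sum)
  have [measurable]: "g \<in> borel_measurable borel" using gL by auto
  have ci: "integrable lborel (restr (cell P) (\<lambda>x. c))" "(LINT x|lborel. restr (cell P) (\<lambda>x. c) x) = c * v P"
    "(LINT x|lborel. cmod (restr (cell P) (\<lambda>x. c) x)) = cmod c * v P" for P c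
  proof -
    have cc: "integrable lborel (restr (cell P) (\<lambda>x. c))" for c
    proof (rule L2_integrable_support[OF constL])
      show "bounded (cell P)" by (rule bounded_subset[OF bounded_triple cell_subset_triple])
    qed (auto simp: restr_apply)
    then show "integrable lborel (restr (cell P) (\<lambda>x. c))" .
    have meas: "measure lborel (cell P) = v P" using v[of P] by (simp add: measure_def)
    have "(LINT x|lborel. indicator (cell P) x *\<^sub>R c) = measure lborel (cell P) *\<^sub>R c"
      using emeasure_cell_finite[of P] by simp
    moreover have "restr (cell P) (\<lambda>x. c) = (\<lambda>x. indicator (cell P) x *\<^sub>R c)" by (auto simp: restr_def indicator_def)
    ultimately show "(LINT x|lborel. restr (cell P) (\<lambda>x. c) x) = c * v P" using meas by (simp add: scaleR_conv_of_real mult.commute)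
    have "(\<lambda>x. cmod (restr (cell P) (\<lambda>x. c) x)) = (\<lambda>x. cmod c * indicator (cell P) x)" by (auto simp: restr_apply)
    then show "(LINT x|lborel. cmod (restr (cell P) (\<lambda>x. c) x)) = cmod c * v P" using emeasure_cell_finite[of P] meas by simp
  qed
  have bmean: "(LINT x|lborel. b P x) = 0" for P
    unfolding b_eq using ci[of P "m P"] restr_cell_integrable[OF FL, of P] v(1)[of P]
    by (subst Bochner_Integration.integral_diff) (auto simp: m_def)
  have bnorm: "(LINT x|lborel. cmod (b P x)) \<le> 2 * p P" for P
  proof -
    have "(LINT x|lborel. cmod (b P x)) \<le> (LINT x|lborel. cmod (restr (cell P) F x) + cmod (restr (cell P) (\<lambda>x. m P) x))"
      unfolding b_eq using ci[of P "m P"] restr_cell_integrable[OF FL, of P]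
      by (intro integral_mono) (auto intro: norm_triangle_ineq4)
    also have "\<dots> = p P + cmod (m P) * v P"
      using ci[of P "m P"] restr_cell_integrable[OF FL, of P] unfolding p_def by (subst Bochner_Integration.integral_add) auto
    finally show ?thesis using mb[of P] by simp
  qed
  have JS: "P \<in> S" if "P \<in> J" for P using J that by auto
  have dJ: "disjoint_family_on cell J" using disjoint_family_on_mono[OF J(2) dS] .
  have sump: "(\<Sum>P\<in>J. p P) \<le> I"
  proof -
    have "ennreal (\<Sum>P\<in>J. p P) = (\<Sum>P\<in>J. (\<integral>\<^sup>+x. ennreal (cmod (F x)) * indicator (cell P) x \<partial>lborel))"
      using p0 by (simp add: pnn sum_ennreal)
    also have "\<dots> = (\<integral>\<^sup>+x. ennreal (cmod (F x)) * (\<Sum>P\<in>J. indicator (cell P) x) \<partial>lborel)"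
      by (subst nn_integral_sum[symmetric]) (auto simp: sum_distrib_left)
    also have "\<dots> \<le> (\<integral>\<^sup>+x. ennreal (cmod (F x)) * 1 \<partial>lborel)"
    proof (intro nn_integral_mono mult_left_mono)
      fix x
      have "(\<Sum>P\<in>J. indicator (cell P) x :: ennreal) = indicator (\<Union>P\<in>J. cell P) x"
        by (intro indicator_UN_disjoint[symmetric] J(1) dJ)
      then show "(\<Sum>P\<in>J. indicator (cell P) x :: ennreal) \<le> 1" by (simp add: indicator_def)
    qed auto
    also have "\<dots> = ennreal I" using Inn by simp
    finally show ?thesis using I0 by simp
  qed
  have gx: "g x = (if x \<in> cell P then m P else g x)" if P: "P \<in> J" for P x
  proof (cases "x \<in> cell P")
    case True
    have "(\<Sum>R\<in>J. b R x) = (\<Sum>R\<in>{P}. b R x)"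
    proof (rule sum.mono_neutral_right)
      show "\<forall>R\<in>J - {P}. b R x = 0"
      proof
        fix R assume R: "R \<in> J - {P}"
        then have "cell R \<inter> cell P = {}" using dJ P unfolding disjoint_family_on_def by blast
        then show "b R x = 0" using True by (auto simp: b_def restr_apply)
      qed
    qed (use J P in auto)
    then show ?thesis using True by (simp add: g_def b_def restr_apply)
  qed simp
  have gx0: "g x = F x" if "x \<notin> (\<Union>P\<in>J. cell P)" for x
    using that by (auto simp: g_def b_def restr_apply intro!: sum.neutral)
  have sqg: "sqnorm lborel g \<le> ennreal (3 * 2 ^ CARD('d) * l * I)"
  proof -
    have "AE x in lborel. ennreal ((cmod (g x))\<^sup>2) \<le> ennreal l * ennreal (cmod (F x))
        + ennreal ((cmod (F x))\<^sup>2) * indicator (\<Omega> - (\<Union>P\<in>J. cell P)) x + (\<Sum>P\<in>J. ennreal ((cmod (m P))\<^sup>2) * indicator (cell P) x)"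
      using good
    proof eventually_elim
      case (elim x)
      show ?case
      proof (cases "x \<in> (\<Union>P\<in>J. cell P)")
        case True
        then obtain P where P: "P \<in> J" "x \<in> cell P" by auto
        have "ennreal ((cmod (g x))\<^sup>2) = ennreal ((cmod (m P))\<^sup>2) * indicator (cell P) x" using gx[OF P(1), of x] P by simp
        also have "\<dots> \<le> (\<Sum>P\<in>J. ennreal ((cmod (m P))\<^sup>2) * indicator (cell P) x)" using P J by (intro member_le_sum) auto
        finally show ?thesis by (simp add: add_increasing)
      next
        case False
        show ?thesis
        proof (cases "x \<in> \<Omega>")
          case True
          then show ?thesis using False gx0[OF False] by (simp add: add_increasing add_increasing2)
        next
          case nO: False
          then have "(cmod (F x))\<^sup>2 \<le> l * cmod (F x)" using elim by (simp add: power2_eq_square mult_right_mono)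
          then have "ennreal ((cmod (g x))\<^sup>2) \<le> ennreal l * ennreal (cmod (F x))"
            using gx0[OF False] l by (simp add: ennreal_mult'[symmetric] ennreal_leI)
          then show ?thesis by (simp add: add_increasing2)
        qed
      qed
    qed
    then have "sqnorm lborel g \<le> (\<integral>\<^sup>+x. ennreal l * ennreal (cmod (F x))
        + ennreal ((cmod (F x))\<^sup>2) * indicator (\<Omega> - (\<Union>P\<in>J. cell P)) x + (\<Sum>P\<in>J. ennreal ((cmod (m P))\<^sup>2) * indicator (cell P) x) \<partial>lborel)"
      unfolding sqnorm_def by (rule nn_integral_mono_AE)
    also have "\<dots> = ennreal l * ennreal I + (\<integral>\<^sup>+x. ennreal ((cmod (F x))\<^sup>2) * indicator (\<Omega> - (\<Union>P\<in>J. cell P)) x \<partial>lborel)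
        + (\<Sum>P\<in>J. ennreal ((cmod (m P))\<^sup>2) * ennreal (v P))"
      by (simp add: nn_integral_add nn_integral_sum nn_integral_cmult Inn v)
    also have "\<dots> \<le> ennreal (l * I) + ennreal (l * I) + ennreal (2 ^ CARD('d) * l * I)"
    proof (intro add_mono J(3))
      show "ennreal l * ennreal I \<le> ennreal (l * I)" using l I0 by (simp add: ennreal_mult)
      have "(\<Sum>P\<in>J. ennreal ((cmod (m P))\<^sup>2) * ennreal (v P)) = ennreal (\<Sum>P\<in>J. (cmod (m P))\<^sup>2 * v P)"
        using v(1) by (subst sum_ennreal[symmetric]) (auto simp: ennreal_mult less_imp_le)
      also have "\<dots> \<le> ennreal (2 ^ CARD('d) * l * I)"
      proof (intro ennreal_leI)
        have "(\<Sum>P\<in>J. (cmod (m P))\<^sup>2 * v P) \<le> (\<Sum>P\<in>J. 2 ^ CARD('d) * l * p P)"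
        proof (intro sum_mono)
          fix P assume P: "P \<in> J"
          have "cmod (m P) * v P \<le> 2 ^ CARD('d) * l * v P" using mb[of P] SP(3)[OF JS[OF P]] by linarith
          then have "cmod (m P) \<le> 2 ^ CARD('d) * l" using v(1)[of P] by simp
          then have "cmod (m P) * (cmod (m P) * v P) \<le> 2 ^ CARD('d) * l * p P"
            using mb[of P] v(1)[of P] l by (intro mult_mono) auto
          then show "(cmod (m P))\<^sup>2 * v P \<le> 2 ^ CARD('d) * l * p P" by (simp add: power2_eq_square mult_ac)
        qed
        also have "\<dots> \<le> 2 ^ CARD('d) * l * I" using sump l by (simp add: sum_distrib_left[symmetric])
        finally show "(\<Sum>P\<in>J. (cmod (m P))\<^sup>2 * v P) \<le> 2 ^ CARD('d) * l * I" .
      qed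
      finally show "(\<Sum>P\<in>J. ennreal ((cmod (m P))\<^sup>2) * ennreal (v P)) \<le> ennreal (2 ^ CARD('d) * l * I)" .
    qed
    also have "\<dots> = ennreal (l * I + l * I + 2 ^ CARD('d) * l * I)" using l I0 by (simp flip: ennreal_plus)
    also have "\<dots> \<le> ennreal (3 * 2 ^ CARD('d) * l * I)"
    proof (intro ennreal_leI)
      have "1 * (l * I) \<le> 2 ^ CARD('d) * (l * I)" using l I0 by (intro mult_right_mono) auto
      then show "l * I + l * I + 2 ^ CARD('d) * l * I \<le> 3 * 2 ^ CARD('d) * l * I" by (simp add: mult_ac)
    qed
    finally show ?thesis .
  qed
  define E where "E = {x \<in> cell Q. l < cmod (T F x)}"
  have [measurable]: "E \<in> sets borel" unfolding E_def by measurable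
  (* Every point of Q lies in the triple of the initial ancestor of a stopping cell, because that
     cell meets the triple of Q. Off the triple of the stopping cell it is in the range of atom_tail. *)
  have near: "cell Q \<subseteq> triple (anc n0 P)" if P: "P \<in> J" for P
  proof -
    have "0 < p P" using SP(2)[OF JS[OF P]] l v(1)[of P] by (meson less_le_trans mult_pos_pos)
    then have "restr (cell P) F \<noteq> (\<lambda>x. 0)" unfolding p_def by auto
    then obtain z where z: "z \<in> cell P" "F z \<noteq> 0" by (auto simp: restr_apply fun_eq_iff split: if_splits)
    then have z3: "z \<in> triple Q" by (auto simp: F_def restr_apply split: if_splits)
    have "anc n0 P = (n0, coord n0 z)" using cell_coordD[OF z(1)] anc_coord[OF SP(1)[OF JS[OF P]], of z] by metis
    then show ?thesis using z3 by (auto simp: triple_def cell_def n0_def abs_minus_commute)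
  qed
  have "AE x in lborel. T F x = T g x + (\<Sum>P\<in>J. T (b P) x)"
  proof -
    have "F = (\<lambda>x. g x + (\<Sum>P\<in>J. b P x))" by (simp add: g_def fun_eq_iff)
    then have "AE x in lborel. T F x = T g x + T (\<lambda>x. \<Sum>P\<in>J. b P x) x"
      using T_add[OF gL L2_sum[OF bL, where I = J]] by simp
    moreover have "AE x in lborel. T (\<lambda>x. \<Sum>P\<in>J. b P x) x = (\<Sum>P\<in>J. T (b P) x)"
      by (intro T_sum J(1) bL)
    ultimately show ?thesis by eventually_elim simp
  qed
  then have "AE x in lborel. indicator E x \<le> ennreal (4 / l\<^sup>2) * ennreal ((cmod (T g x))\<^sup>2) + (\<Sum>P\<in>J. indicator (triple P) x)
      + ennreal (2 / l) * (\<Sum>P\<in>J. ennreal (cmod (T (b P) x)) * indicator (triple (anc n0 P) - triple P) x)"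
  proof eventually_elim
    case (elim x)
    show ?case
    proof (cases "x \<in> E")
      case True
      then have xQ: "x \<in> cell Q" and big: "l < cmod (T F x)" by (auto simp: E_def)
      consider "\<exists>P\<in>J. x \<in> triple P" | "l / 2 \<le> cmod (T g x)" | "\<forall>P\<in>J. x \<notin> triple P" "cmod (T g x) < l / 2" by force
      then show ?thesis
      proof cases
        case 1
        then obtain P where P: "P \<in> J" "x \<in> triple P" by auto
        have "(1::ennreal) = indicator (triple P) x" using P by simp
        also have "\<dots> \<le> (\<Sum>P\<in>J. indicator (triple P) x)" using P J by (intro member_le_sum) auto
        finally show ?thesis using True by (simp add: add_increasing add_increasing2)
      next
        case 2
        then have "(l / 2)\<^sup>2 \<le> (cmod (T g x))\<^sup>2" using l by (intro power_mono) auto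
        then have "1 \<le> 4 / l\<^sup>2 * (cmod (T g x))\<^sup>2" using l by (simp add: field_simps power_divide)
        then have "(1::ennreal) \<le> ennreal (4 / l\<^sup>2) * ennreal ((cmod (T g x))\<^sup>2)"
          by (simp add: ennreal_mult'[symmetric] flip: ennreal_1)
        then show ?thesis using True by (simp add: add_increasing2)
      next
        case 3
        have "cmod (T F x) \<le> cmod (T g x) + (\<Sum>P\<in>J. cmod (T (b P) x))"
          unfolding elim by (intro order.trans[OF norm_triangle_ineq] add_left_mono norm_sum)
        then have "1 \<le> 2 / l * (\<Sum>P\<in>J. cmod (T (b P) x))" using 3 big l by (simp add: field_simps)
        then have "(1::ennreal) \<le> ennreal (2 / l) * ennreal (\<Sum>P\<in>J. cmod (T (b P) x))"
          using l by (simp add: ennreal_mult'[symmetric] flip: ennreal_1)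
        also have "ennreal (\<Sum>P\<in>J. cmod (T (b P) x)) = (\<Sum>P\<in>J. ennreal (cmod (T (b P) x)) * indicator (triple (anc n0 P) - triple P) x)"
        proof -
          have "indicator (triple (anc n0 P) - triple P) x = (1::ennreal)" if "P \<in> J" for P
            using 3(1) near[OF that] xQ that by auto
          then have "(\<Sum>P\<in>J. ennreal (cmod (T (b P) x)) * indicator (triple (anc n0 P) - triple P) x) = (\<Sum>P\<in>J. ennreal (cmod (T (b P) x)))"
            by (intro sum.cong refl) (simp only: mult_1_right)
          also have "\<dots> = ennreal (\<Sum>P\<in>J. cmod (T (b P) x))" by (intro sum_ennreal) auto
          finally show ?thesis by simp
        qed
        finally show ?thesis using True by (simp add: add_increasing)
      qed
    qed simp
  qed
  then have "(\<integral>\<^sup>+x. indicator E x \<partial>lborel) \<le> (\<integral>\<^sup>+x. ennreal (4 / l\<^sup>2) * ennreal ((cmod (T g x))\<^sup>2) + (\<Sum>P\<in>J. indicator (triple P) x)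
      + ennreal (2 / l) * (\<Sum>P\<in>J. ennreal (cmod (T (b P) x)) * indicator (triple (anc n0 P) - triple P) x) \<partial>lborel)"
    by (rule nn_integral_mono_AE)
  also have "\<dots> = ennreal (4 / l\<^sup>2) * sqnorm lborel (T g) + (\<Sum>P\<in>J. emeasure lborel (triple P))
      + ennreal (2 / l) * (\<Sum>P\<in>J. \<integral>\<^sup>+x. ennreal (cmod (T (b P) x)) * indicator (triple (anc n0 P) - triple P) x \<partial>lborel)"
  proof -
    have [measurable]: "T g \<in> borel_measurable borel" "T (b P) \<in> borel_measurable borel" for P
      by (rule T_measurable[OF gL], rule T_measurable[OF bL])
    show ?thesis by (simp add: nn_integral_add nn_integral_cmult nn_integral_sum sqnorm_def)
  qed
  also have "\<dots> \<le> ennreal (12 * 2 ^ CARD('d) * M * I / l) + ennreal (3 ^ CARD('d) * I / l) + ennreal (4 * tail_const \<epsilon> TYPE('d) * I / l)"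
  proof (intro add_mono)
    have "ennreal (4 / l\<^sup>2) * sqnorm lborel (T g) \<le> ennreal (4 / l\<^sup>2) * (ennreal M * ennreal (3 * 2 ^ CARD('d) * l * I))"
      by (intro mult_left_mono order.trans[OF T_bound[OF gL]] sqg) auto
    also have "\<dots> = ennreal (4 / l\<^sup>2 * (M * (3 * 2 ^ CARD('d) * l * I)))"
      using M_nonneg l I0 by (simp flip: ennreal_mult')
    also have "4 / l\<^sup>2 * (M * (3 * 2 ^ CARD('d) * l * I)) = 12 * 2 ^ CARD('d) * M * I / l"
      using l by (simp add: power2_eq_square)
    finally show "ennreal (4 / l\<^sup>2) * sqnorm lborel (T g) \<le> ennreal (12 * 2 ^ CARD('d) * M * I / l)" .
    have "(\<Sum>P\<in>J. emeasure lborel (triple P)) = ennreal (\<Sum>P\<in>J. 3 ^ CARD('d) * v P)"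
      unfolding emeasure_triple v3 by (intro sum_ennreal mult_nonneg_nonneg less_imp_le[OF v(1)]) auto
    also have "\<dots> \<le> ennreal (3 ^ CARD('d) * I / l)"
    proof (intro ennreal_leI)
      have "(\<Sum>P\<in>J. l * v P) \<le> (\<Sum>P\<in>J. p P)" using SP(2) JS by (intro sum_mono) auto
      then have "l * (\<Sum>P\<in>J. v P) \<le> I" using sump by (simp add: sum_distrib_left)
      then have "(\<Sum>P\<in>J. v P) \<le> I / l" using l by (simp add: field_simps)
      then have "3 ^ CARD('d) * (\<Sum>P\<in>J. v P) \<le> 3 ^ CARD('d) * (I / l)" by (intro mult_left_mono) auto
      then show "(\<Sum>P\<in>J. 3 ^ CARD('d) * v P) \<le> 3 ^ CARD('d) * I / l" by (simp add: sum_distrib_left)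
    qed
    finally show "(\<Sum>P\<in>J. emeasure lborel (triple P)) \<le> ennreal (3 ^ CARD('d) * I / l)" .
    let ?t = "tail_const \<epsilon> TYPE('d)"
    have t: "0 \<le> ?t" by (rule tail_nonneg)
    have "ennreal (2 / l) * (\<Sum>P\<in>J. \<integral>\<^sup>+x. ennreal (cmod (T (b P) x)) * indicator (triple (anc n0 P) - triple P) x \<partial>lborel)
        \<le> ennreal (2 / l) * (\<Sum>P\<in>J. ennreal (?t * (2 * p P)))"
    proof (intro mult_left_mono sum_mono)
      fix P assume P: "P \<in> J"
      have "(\<integral>\<^sup>+x. ennreal (cmod (T (b P) x)) * indicator (triple (anc n0 P) - triple P) x \<partial>lborel)
          \<le> ennreal (?t * (LINT x|lborel. cmod (b P x)))"
        using SP(1)[OF JS[OF P]] by (intro atom_tail bL bmean) (auto simp: b_def restr_apply)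
      also have "\<dots> \<le> ennreal (?t * (2 * p P))" using bnorm t by (intro ennreal_leI mult_left_mono) auto
      finally show "(\<integral>\<^sup>+x. ennreal (cmod (T (b P) x)) * indicator (triple (anc n0 P) - triple P) x \<partial>lborel) \<le> ennreal (?t * (2 * p P))" .
    qed auto
    also have "\<dots> = ennreal (2 / l * (\<Sum>P\<in>J. ?t * (2 * p P)))"
    proof -
      have "(\<Sum>P\<in>J. ennreal (?t * (2 * p P))) = ennreal (\<Sum>P\<in>J. ?t * (2 * p P))"
        using t p0 by (intro sum_ennreal mult_nonneg_nonneg) auto
      then show ?thesis using l by (simp flip: ennreal_mult')
    qed
    also have "\<dots> \<le> ennreal (4 * ?t * I / l)"
    proof (intro ennreal_leI)
      have "(\<Sum>P\<in>J. ?t * (2 * p P)) = 2 * ?t * (\<Sum>P\<in>J. p P)"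
        unfolding sum_distrib_left by (intro sum.cong refl) simp
      then have "2 / l * (\<Sum>P\<in>J. ?t * (2 * p P)) = 4 * ?t / l * (\<Sum>P\<in>J. p P)" by simp
      also have "\<dots> \<le> 4 * ?t / l * I" using sump t l by (intro mult_left_mono) auto
      finally show "2 / l * (\<Sum>P\<in>J. ?t * (2 * p P)) \<le> 4 * ?t * I / l" by simp
    qed
    finally show "ennreal (2 / l) * (\<Sum>P\<in>J. \<integral>\<^sup>+x. ennreal (cmod (T (b P) x)) * indicator (triple (anc n0 P) - triple P) x \<partial>lborel) \<le> ennreal (4 * ?t * I / l)" .
  qed
  also have "\<dots> = ennreal (12 * 2 ^ CARD('d) * M * I / l + 3 ^ CARD('d) * I / l + 4 * tail_const \<epsilon> TYPE('d) * I / l)"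
    using M_nonneg l I0 tail_nonneg by (simp flip: ennreal_plus)
  also have "\<dots> = ennreal (weak_base * I / l)"
    by (intro arg_cong[where f = ennreal]) (simp add: weak_base_def add_divide_distrib distrib_right)
  also have "\<dots> \<le> ennreal (\<delta> * v Q)"
  proof (intro ennreal_leI)
    have "weak_base * 3 ^ CARD('d) \<le> \<delta> * \<kappa>" unfolding \<kappa>_def weak_const_def using \<delta> weak_base_nonneg by (simp add: field_simps)
    then have "weak_base * 3 ^ CARD('d) * (A * v Q) \<le> \<delta> * \<kappa> * (A * v Q)" using A v(1)[of Q] by (intro mult_right_mono) auto
    then have "weak_base * I \<le> \<delta> * v Q * l" by (simp add: I l_def mult_ac)
    then show "weak_base * I / l \<le> \<delta> * v Q" using l by (simp add: pos_divide_le_eq)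
  qed
  also have "\<dots> = ennreal \<delta> * emeasure lborel (cell Q)" using \<delta> v[of Q] by (simp add: ennreal_mult)
  finally have "emeasure lborel E \<le> ennreal \<delta> * emeasure lborel (cell Q)" by simp
  then show ?thesis by (simp add: E_def F_def l_def A_def \<kappa>_def)
qed

end

section \<open>One step of the sparse decomposition\<close>

lemma ennreal_numeral_power: "(numeral k :: ennreal) ^ n = ennreal (numeral k ^ n)"
  by (metis ennreal_numeral ennreal_power zero_le_numeral)

context cz_grid
begin

lemma cell_triple_subset:
  assumes "cell P \<subseteq> cell (Q :: 'd cell)" "fst Q \<le> fst P"
  shows "triple P \<subseteq> triple Q"
  using triple_subset_ancestor[OF assms cell_nonempty] .

text \<open>
  Within one lattice class the triples are laminar, and there are \<open>3\<^sup>d\<close> classes. A further factor \<open>3\<^sup>d\<close> is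
  the measure of the triple of \<open>Q\<close> compared with that of \<open>Q\<close>.
\<close>

lemma maximal_weak_type:
  assumes f: "f \<in> L2_space lborel" and \<kappa>: "0 < \<kappa>"
  shows "emeasure lborel (\<Union>P\<in>{P. fst Q \<le> fst P \<and> cell P \<subseteq> cell Q \<and> \<kappa> * triple_avg f Q < triple_avg f P}. cell P)
    \<le> ennreal (9 ^ CARD('d) / \<kappa>) * emeasure lborel (cell Q)"
proof -
  define Bd where "Bd = {P. fst Q \<le> fst P \<and> cell P \<subseteq> cell Q \<and> \<kappa> * triple_avg f Q < triple_avg f P}"
  define A where "A = triple_avg f Q"
  have [measurable]: "f \<in> borel_measurable borel" using f by auto
  let ?I = "\<integral>\<^sup>+x. ennreal (cmod (f x)) * indicator (triple Q) x \<partial>lborel"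
  have I: "?I = ennreal A * emeasure lborel (triple Q)" unfolding A_def by (rule triple_avg_nn[OF f])
  have sub: "triple P \<subseteq> triple Q" if "P \<in> Bd" for P using that by (intro cell_triple_subset) (auto simp: Bd_def)
  show ?thesis
  proof (cases "A = 0")
    case True
    have "triple_avg f P = 0" if "P \<in> Bd" for P
    proof -
      have "ennreal (triple_avg f P) * emeasure lborel (triple P) \<le> ?I"
        unfolding triple_avg_nn[OF f, symmetric] using sub[OF that] by (intro nn_integral_mono mult_left_mono) (auto simp: indicator_def)
      then have "ennreal (triple_avg f P) * emeasure lborel (triple P) = 0" using I True by simp
      moreover have "emeasure lborel (triple P) \<noteq> 0" using side_pos[of "fst P"] by (simp add: emeasure_triple)
      ultimately show ?thesis using triple_avg_nonneg[of f P] by simp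
    qed
    moreover have "0 < triple_avg f P" if "P \<in> Bd" for P using that True by (simp add: Bd_def A_def)
    ultimately have "Bd = {}" by force
    then show ?thesis unfolding Bd_def[symmetric] by simp
  next
    case False
    then have A: "0 < A" using triple_avg_nonneg[of f Q] by (simp add: A_def)
    define Bt where "Bt t = {P \<in> Bd. lattice_class P = t}" for t
    define v where "v = side (fst Q) ^ CARD('d)"
    have v: "0 < v" "emeasure lborel (cell Q) = ennreal v" "emeasure lborel (triple Q) = ennreal (3 ^ CARD('d) * v)"
      using side_pos by (auto simp: v_def emeasure_cell emeasure_triple power_mult_distrib)
    have fin: "emeasure lborel (\<Union>P\<in>S. triple P) \<le> ennreal (3 ^ CARD('d) * v / \<kappa>)" if S: "finite S" "S \<subseteq> Bt t" for S t
    proof -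
      have "ennreal (\<kappa> * A) * emeasure lborel (\<Union>P\<in>S. triple P)
          \<le> (\<integral>\<^sup>+x. ennreal (cmod (f x)) * indicator (\<Union>P\<in>S. triple P) x \<partial>lborel)"
      proof (rule laminar_weak_type[where r = fst])
        fix P R assume "P \<in> S" "R \<in> S" "fst P \<le> fst R"
        then show "triple P \<inter> triple R = {} \<or> triple R \<subseteq> triple P"
          using triple_laminar[of P R] S by (auto simp: Bt_def)
      next
        fix P assume "P \<in> S"
        then have "\<kappa> * A < triple_avg f P" using S by (auto simp: Bt_def Bd_def A_def)
        then show "ennreal (\<kappa> * A) * emeasure lborel (triple P) \<le> (\<integral>\<^sup>+x. ennreal (cmod (f x)) * indicator (triple P) x \<partial>lborel)"
          unfolding triple_avg_nn[OF f] by (intro mult_right_mono ennreal_leI) auto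
      qed (use S in auto)
      also have "\<dots> \<le> ?I" using sub S by (intro nn_integral_mono mult_left_mono) (fastforce simp: indicator_def Bt_def)+
      also have "\<dots> = ennreal (\<kappa> * A) * ennreal (3 ^ CARD('d) * v / \<kappa>)"
        unfolding I v(3) using \<kappa> A v(1) by (simp flip: ennreal_mult')
      finally show ?thesis using \<kappa> A by (subst (asm) ennreal_mult_le_mult_iff) auto
    qed
    have cls: "emeasure lborel (\<Union>P\<in>Bt t. triple P) \<le> ennreal (3 ^ CARD('d) * v / \<kappa>)" for t
    proof -
      define Jk where "Jk k = Bt t \<inter> from_nat ` {..<k}" for k :: nat
      have "(\<lambda>k. emeasure lborel (\<Union>P\<in>Jk k. triple P)) \<longlonglongrightarrow> emeasure lborel (\<Union>k. (\<Union>P\<in>Jk k. triple P))"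
      proof (rule Lim_emeasure_incseq)
        show "range (\<lambda>k. \<Union>P\<in>Jk k. triple P) \<subseteq> sets lborel" by (auto intro!: sets.countable_UN')
        show "incseq (\<lambda>k. \<Union>P\<in>Jk k. triple P)" unfolding incseq_def Jk_def by fastforce
      qed
      moreover have "(\<Union>k. (\<Union>P\<in>Jk k. triple P)) = (\<Union>P\<in>Bt t. triple P)"
      proof -
        have "P \<in> Jk (Suc (to_nat P))" if "P \<in> Bt t" for P using that by (auto simp: Jk_def intro!: image_eqI[of _ _ "to_nat P"])
        then show ?thesis by (fastforce simp: Jk_def)
      qed
      ultimately have "(\<lambda>k. emeasure lborel (\<Union>P\<in>Jk k. triple P)) \<longlonglongrightarrow> emeasure lborel (\<Union>P\<in>Bt t. triple P)" by simp
      then show ?thesis by (rule LIMSEQ_le_const2) (auto intro!: exI[of _ 0] fin simp: Jk_def)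
    qed
    have "(\<Union>P\<in>Bd. cell P) \<subseteq> (\<Union>t\<in>lattice_classes. \<Union>P\<in>Bt t. triple P)"
      using cell_subset_triple lattice_class_in by (fastforce simp: Bt_def)
    then have "emeasure lborel (\<Union>P\<in>Bd. cell P) \<le> emeasure lborel (\<Union>t\<in>(lattice_classes :: ('d \<Rightarrow> int) set). \<Union>P\<in>Bt t. triple P)"
      by (intro emeasure_mono) (auto intro!: sets.finite_UN sets.countable_UN' finite_lattice_classes)
    also have "\<dots> \<le> (\<Sum>t\<in>(lattice_classes :: ('d \<Rightarrow> int) set). emeasure lborel (\<Union>P\<in>Bt t. triple P))"
      by (intro emeasure_subadditive_finite finite_lattice_classes) (auto intro!: sets.countable_UN')
    also have "\<dots> \<le> (\<Sum>t\<in>(lattice_classes :: ('d \<Rightarrow> int) set). ennreal (3 ^ CARD('d) * v / \<kappa>))"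
      by (intro sum_mono cls)
    also have "\<dots> = ennreal (3 ^ CARD('d) * (3 ^ CARD('d) * v / \<kappa>))"
    proof -
      have "(of_nat (3 ^ CARD('d)) :: ennreal) = ennreal (3 ^ CARD('d))" by (simp flip: ennreal_power ennreal_numeral)
      then have "(\<Sum>t\<in>(lattice_classes :: ('d \<Rightarrow> int) set). ennreal (3 ^ CARD('d) * v / \<kappa>)) = ennreal (3 ^ CARD('d)) * ennreal (3 ^ CARD('d) * v / \<kappa>)"
        by (simp only: sum_constant card_lattice_classes)
      also have "\<dots> = ennreal (3 ^ CARD('d) * (3 ^ CARD('d) * v / \<kappa>))" by (rule ennreal_mult'[symmetric]) simp
      finally show ?thesis .
    qed
    also have "3 ^ CARD('d) * (3 ^ CARD('d) * v / \<kappa>) = 9 ^ CARD('d) / \<kappa> * v"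
      by (simp flip: power_mult_distrib)
    also have "ennreal \<dots> = ennreal (9 ^ CARD('d) / \<kappa>) * emeasure lborel (cell Q)"
      unfolding v(2) using \<kappa> by (intro ennreal_mult') auto
    finally show ?thesis unfolding Bd_def .
  qed
qed

text \<open>
  With these thresholds each of the two exceptional sets in \<open>sparse_step\<close> has at most \<open>2\<^sup>-\<^sup>(\<^sup>d\<^sup>+\<^sup>3\<^sup>)\<close> times
  the measure of \<open>Q\<close>.
\<close>

definition split_const :: real where "split_const = weak_const (1 / 2 ^ (CARD('d) + 3))"
definition max_const :: real where "max_const = 9 ^ CARD('d) * 2 ^ (CARD('d) + 3)"
text \<open>
  On a selected cell \<open>P\<close> the first two terms bound \<open>T(f 1\<^bsub>3Q - 3P\<^esub>)\<close> at one point and the third one its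
  oscillation over \<open>P\<close>.
\<close>

definition step_const :: real where
  "step_const = split_const + split_const * max_const + tail_const \<epsilon> TYPE('d) * max_const"

lemma split_const_pos: "0 < split_const" unfolding split_const_def by (intro weak_const_pos) auto
lemma max_const_pos: "0 < max_const" unfolding max_const_def by auto

lemma step_const_pos: "0 < step_const"
  unfolding step_const_def using split_const_pos max_const_pos tail_nonneg
  by (intro add_pos_nonneg mult_nonneg_nonneg) auto

text \<open>
  The averages over the triples of the proper ancestors of \<open>P\<close>, up to generation \<open>n0\<close>, control the
  oscillation, since the majorant of the kernel is a combination of their indicator functions.
\<close>

lemma kernel_op_oscillation:
  fixes P :: "'d cell"
  assumes f: "f \<in> L2_space lborel" and n0: "n0 \<le> fst P" and B: "0 \<le> B"
    and av: "\<And>j. n0 \<le> j \<Longrightarrow> j < fst P \<Longrightarrow> triple_avg f (anc j P) \<le> B"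
    and x: "x \<in> cell P" "x' \<in> cell P"
  defines "h \<equiv> restr (triple (anc n0 P) - triple P) f"
  shows "cmod (kernel_op h x - kernel_op h x') \<le> tail_const \<epsilon> TYPE('d) * B"
proof -
  have [measurable]: "f \<in> borel_measurable borel" using f by auto
  have hL: "h \<in> L2_space lborel" unfolding h_def using f by auto
  have hi: "integrable lborel h"
  proof (rule L2_integrable_support[OF hL])
    show "bounded (triple (anc n0 P))" by (rule bounded_triple)
  qed (auto simp: h_def restr_apply)
  have K: "integrable lborel (\<lambda>y. K z y * h y)" if "z \<in> cell P" for z
  proof (rule kernel_op_integrable(1)[OF hi side_pos[of "fst P"]])
    fix y assume "h y \<noteq> 0"
    then have "y \<notin> triple P" by (auto simp: h_def restr_apply split: if_splits)
    then show "side (fst P) \<le> dist z y" using triple_far[OF that] by (simp add: dist_norm)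
  qed
  have bd: "cmod (K x y * h y - K x' y * h y) \<le> kernel_majorant \<epsilon> n0 P y * cmod (f y)" for y
  proof (cases "h y = 0")
    case True
    then show ?thesis using kernel_majorant_nonneg[of \<epsilon> n0 P y] by simp
  next
    case False
    then have y: "y \<in> triple (anc n0 P)" "y \<notin> triple P" "h y = f y" by (auto simp: h_def restr_apply split: if_splits)
    have "cmod (K x y * h y - K x' y * h y) = cmod (K x y - K x' y) * cmod (f y)"
      using y(3) by (simp add: norm_mult flip: left_diff_distrib)
    also have "\<dots> \<le> kernel_majorant \<epsilon> n0 P y * cmod (f y)"
      using kernel_osc[OF kernel eps x y(1,2) n0] by (intro mult_right_mono) auto
    finally show ?thesis .
  qed
  have "kernel_op h x - kernel_op h x' = (LINT y|lborel. K x y * h y - K x' y * h y)"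
    unfolding kernel_op_def using K x by (subst Bochner_Integration.integral_diff) auto
  then have "ennreal (cmod (kernel_op h x - kernel_op h x')) \<le> ennreal (LINT y|lborel. cmod (K x y * h y - K x' y * h y))"
    by (simp only:) (intro ennreal_leI integral_norm_bound)
  also have "\<dots> = (\<integral>\<^sup>+y. ennreal (cmod (K x y * h y - K x' y * h y)) \<partial>lborel)"
    using K x by (intro nn_integral_eq_integral[symmetric]) auto
  also have "\<dots> \<le> (\<integral>\<^sup>+y. ennreal (kernel_majorant \<epsilon> n0 P y) * ennreal (cmod (f y)) \<partial>lborel)"
    using bd by (intro nn_integral_mono) (simp add: ennreal_leI kernel_majorant_nonneg flip: ennreal_mult')
  also have "\<dots> \<le> ennreal (tail_const \<epsilon> TYPE('d) * B)"
  proof (rule kernel_majorant_integral[OF eps _ B])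
    fix j assume "n0 \<le> j" "j < fst P"
    then show "(\<integral>\<^sup>+y. ennreal (cmod (f y)) * indicator (triple (anc j P)) y \<partial>lborel) \<le> ennreal B * emeasure lborel (triple (anc j P))"
      unfolding triple_avg_nn[OF f] using av by (intro mult_right_mono ennreal_leI) auto
  qed auto
  finally show ?thesis using tail_nonneg B by simp
qed

text \<open>
  The cells of \<open>S\<close> are the maximal ones in which the exceptional set \<open>E\<close> has density above \<open>2\<^sup>-\<^sup>(\<^sup>d\<^sup>+\<^sup>1\<^sup>)\<close>. The
  lower bound on the density bounds their total measure. The parents fail it, so the density in a
  selected cell is at most \<open>1 / 2\<close>; hence each selected cell contains points outside \<open>E\<close>, where the averages
  over the triples of all ancestors and \<open>T(f 1\<^bsub>3Q\<^esub>)\<close> are controlled.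
\<close>

lemma sparse_step:
  assumes f: "f \<in> L2_space lborel"
  obtains S where "\<And>P. P \<in> S \<Longrightarrow> fst Q < fst P \<and> cell P \<subseteq> cell Q" "disjoint_family_on cell S"
    "2 * emeasure lborel (\<Union>P\<in>S. cell P) \<le> emeasure lborel (cell Q)"
    "AE x in lborel. x \<in> cell Q \<longrightarrow>
       (x \<notin> (\<Union>P\<in>S. cell P) \<longrightarrow> cmod (T (restr (triple Q) f) x) \<le> step_const * triple_avg f Q) \<and>
       (\<forall>P\<in>S. x \<in> cell P \<longrightarrow> cmod (T (restr (triple Q) f) x) \<le> step_const * triple_avg f Q + cmod (T (restr (triple P) f) x))"
proof -
  define n0 where "n0 = fst Q"
  define D where "D = CARD('d)"
  define A where "A = triple_avg f Q"
  have A: "0 \<le> A" unfolding A_def by (rule triple_avg_nonneg)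
  define \<delta> :: real where "\<delta> = 1 / 2 ^ (D + 3)"
  have \<delta>: "0 < \<delta>" by (simp add: \<delta>_def)
  have cL: "restr (triple P) f \<in> L2_space lborel" for P :: "'d cell" using f by auto
  have Tm [measurable]: "T (restr (triple P) f) \<in> borel_measurable borel" for P :: "'d cell" using T_measurable[OF cL[of P]] .
  define E1 where "E1 P = {x \<in> cell P. split_const * triple_avg f P < cmod (T (restr (triple P) f) x)}" for P
  have E1m [measurable]: "E1 P \<in> sets borel" for P unfolding E1_def by measurable
  define v where "v P = side (fst P) ^ CARD('d)" for P :: "'d cell"
  have v: "0 < v P" "emeasure lborel (cell P) = ennreal (v P)" for P :: "'d cell" using side_pos by (auto simp: v_def emeasure_cell)
  have E1: "emeasure lborel (E1 P) \<le> ennreal (\<delta> * v P)" for P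
  proof -
    have "emeasure lborel (E1 P) \<le> ennreal \<delta> * ennreal (v P)"
      using local_weak_type[OF f \<delta>, of P] unfolding E1_def split_const_def \<delta>_def D_def v(2) .
    then show ?thesis using \<delta> by (simp add: ennreal_mult')
  qed
  define Bd where "Bd = {P. fst Q \<le> fst P \<and> cell P \<subseteq> cell Q \<and> max_const * triple_avg f Q < triple_avg f P}"
  define E2 where "E2 = (\<Union>P\<in>Bd. cell P)"
  have E2m [measurable]: "E2 \<in> sets borel" unfolding E2_def by simp
  have E2: "emeasure lborel E2 \<le> ennreal (\<delta> * v Q)"
  proof -
    have "9 ^ CARD('d) / max_const = \<delta>" by (simp add: max_const_def \<delta>_def D_def)
    then have "emeasure lborel E2 \<le> ennreal \<delta> * ennreal (v Q)"
      using maximal_weak_type[OF f max_const_pos, of Q] unfolding E2_def Bd_def v(2) by simp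
    then show ?thesis using \<delta> by (simp add: ennreal_mult')
  qed
  define E where "E = E1 Q \<union> E2"
  have Em [measurable]: "E \<in> sets borel" unfolding E_def by simp
  have EQ: "E \<subseteq> cell Q" by (auto simp: E_def E1_def E2_def Bd_def)
  have Esz: "emeasure lborel E \<le> ennreal (2 * \<delta> * v Q)"
  proof -
    have "emeasure lborel E \<le> emeasure lborel (E1 Q) + emeasure lborel E2" unfolding E_def by (intro emeasure_subadditive) auto
    also have "\<dots> \<le> ennreal (\<delta> * v Q) + ennreal (\<delta> * v Q)" by (intro add_mono E1 E2)
    also have "\<dots> = ennreal (2 * \<delta> * v Q)" using \<delta> v(1)[of Q] by (simp flip: ennreal_plus)
    finally show ?thesis .
  qed
  define e where "e P = measure lborel (cell P \<inter> E)" for P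
  have ee: "emeasure lborel (cell P \<inter> E) = ennreal (e P)" for P
  proof -
    have "emeasure lborel (cell P \<inter> E) \<le> emeasure lborel (cell P)" by (intro emeasure_mono) auto
    then show ?thesis unfolding e_def using v[of P] by (intro emeasure_eq_ennreal_measure) (auto simp: top_unique)
  qed
  have e0: "0 \<le> e P" for P by (simp add: e_def)
  have emono: "e P \<le> e R" if "cell P \<subseteq> cell R" for P R
  proof -
    have "ennreal (e P) \<le> ennreal (e R)" unfolding ee[symmetric] using that by (intro emeasure_mono) auto
    then show ?thesis using e0 by simp
  qed
  have eQ: "e P \<le> 2 * \<delta> * v Q" for P
  proof -
    have "ennreal (e P) \<le> emeasure lborel E" unfolding ee[symmetric] by (intro emeasure_mono) auto
    then have "ennreal (e P) \<le> ennreal (2 * \<delta> * v Q)" using Esz by simp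
    then show ?thesis using \<delta> v(1)[of Q] by simp
  qed
  define Sel where "Sel P \<longleftrightarrow> v P < 2 ^ (D + 1) * e P" for P
  define S where "S = stopping n0 Sel"
  have top: "\<not> Sel R" if "fst R = n0" for R
  proof -
    have "v R = v Q" using that by (simp add: v_def n0_def)
    have "2 ^ (D + 1) * e R \<le> 2 ^ (D + 1) * (2 * \<delta> * v Q)" using eQ by (intro mult_left_mono) auto
    also have "\<dots> = v Q / 2" by (simp add: \<delta>_def power_add)
    also have "\<dots> \<le> v R" using v(1)[of Q] \<open>v R = v Q\<close> by simp
    finally show ?thesis by (simp add: Sel_def)
  qed
  have dS: "disjoint_family_on cell S" unfolding S_def by (rule stopping_disjoint_family)
  have SP: "n0 < fst P" "anc n0 P = Q" "cell P \<subseteq> cell Q" "v P < 2 ^ (D + 1) * e P" "2 * e P \<le> v P" if P: "P \<in> S" for P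
  proof -
    obtain n where n: "n0 \<le> n" "fst P = Suc n" "\<not> Sel (anc n P)"
      using stopping_parent[of P n0 Sel] P top unfolding S_def by blast
    show lt: "n0 < fst P" using n by simp
    show s: "v P < 2 ^ (D + 1) * e P" using P by (auto simp: S_def stopping_def Sel_def)
    then have "e P \<noteq> 0" using v(1)[of P] by auto
    then have "cell P \<inter> E \<noteq> {}" unfolding e_def by auto
    then obtain z where z: "z \<in> cell P" "z \<in> cell Q" using EQ by auto
    show a: "anc n0 P = Q" using cell_nested[OF z(2,1)] lt by (simp add: n0_def)
    show "cell P \<subseteq> cell Q" using cell_anc[of n0 P] lt a by simp
    have "2 ^ (D + 1) * e P \<le> 2 ^ (D + 1) * e (anc n P)" using cell_anc[of n P] n by (intro mult_left_mono emono) auto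
    also have "\<dots> \<le> v (anc n P)" using n by (simp add: Sel_def)
    also have "\<dots> = 2 ^ D * v P" using n by (simp add: v_def D_def side_Suc[of n] power_mult_distrib)
    finally show "2 * e P \<le> v P" by simp
  qed
  define \<Omega> where "\<Omega> = (\<Union>P\<in>S. cell P)"
  have \<Omega>m [measurable]: "\<Omega> \<in> sets borel" unfolding \<Omega>_def by simp
  have size: "2 * emeasure lborel \<Omega> \<le> emeasure lborel (cell Q)"
  proof -
    have "emeasure lborel \<Omega> = (\<integral>\<^sup>+P. emeasure lborel (cell P) \<partial>count_space S)"
      unfolding \<Omega>_def using dS by (rule emeasure_cells)
    also have "\<dots> \<le> (\<integral>\<^sup>+P. 2 ^ (D + 1) * emeasure lborel (cell P \<inter> E) \<partial>count_space S)"
    proof (intro nn_integral_mono)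
      fix P assume "P \<in> space (count_space S)"
      then have "v P \<le> 2 ^ (D + 1) * e P" using SP(4)[of P] by auto
      then have "ennreal (v P) \<le> ennreal (2 ^ (D + 1)) * ennreal (e P)" by (simp add: ennreal_leI flip: ennreal_mult')
      moreover have "(2::ennreal) ^ (D + 1) = ennreal (2 ^ (D + 1))" by (rule ennreal_numeral_power)
      ultimately show "emeasure lborel (cell P) \<le> 2 ^ (D + 1) * emeasure lborel (cell P \<inter> E)"
        unfolding ee v by (simp only:)
    qed
    also have "\<dots> = 2 ^ (D + 1) * (\<integral>\<^sup>+P. emeasure lborel (cell P \<inter> E) \<partial>count_space S)"
      by (simp add: nn_integral_cmult)
    also have "(\<integral>\<^sup>+P. emeasure lborel (cell P \<inter> E) \<partial>count_space S) = emeasure lborel (\<Union>P\<in>S. cell P \<inter> E)"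
    proof (rule emeasure_UN_countable[symmetric])
      show "disjoint_family_on (\<lambda>P. cell P \<inter> E) S" using dS unfolding disjoint_family_on_def by blast
    qed auto
    also have "\<dots> \<le> emeasure lborel E" by (intro emeasure_mono) auto
    finally have "emeasure lborel \<Omega> \<le> 2 ^ (D + 1) * ennreal (2 * \<delta> * v Q)" using Esz by (meson mult_left_mono order.trans zero_le)
    also have "\<dots> = ennreal (v Q / 2)"
    proof -
      have "(2::ennreal) ^ (D + 1) = ennreal (2 ^ (D + 1))" by (rule ennreal_numeral_power)
      then have "2 ^ (D + 1) * ennreal (2 * \<delta> * v Q) = ennreal (2 ^ (D + 1)) * ennreal (2 * \<delta> * v Q)" by (simp only:)
      also have "\<dots> = ennreal (2 ^ (D + 1) * (2 * \<delta> * v Q))" by (rule ennreal_mult'[symmetric]) simp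
      finally have "2 ^ (D + 1) * ennreal (2 * \<delta> * v Q) = \<dots>" .
      then show ?thesis by (simp add: \<delta>_def power_add)
    qed
    finally have "2 * emeasure lborel \<Omega> \<le> 2 * ennreal (v Q / 2)" by (intro mult_left_mono) auto
    also have "\<dots> = ennreal (2 * (v Q / 2))" by (subst ennreal_mult') auto
    finally show ?thesis by (simp add: v)
  qed
  have dens: "AE x in lborel. x \<in> E - \<Omega> \<longrightarrow> indicator E x \<le> ennreal (1 / 2 ^ (D + 1))"
  proof (rule dyadic_average_AE[where ?n0.0 = n0])
    fix x n assume x: "x \<in> E - \<Omega>" and n: "n0 \<le> n"
    have "\<not> Sel (n, coord n x)" using stopping_covers[of n0 n Sel x] n x unfolding \<Omega>_def S_def by blast
    then have "e (n, coord n x) \<le> 1 / 2 ^ (D + 1) * v (n, coord n x)" by (simp add: Sel_def field_simps)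
    moreover have "(\<integral>\<^sup>+y. indicator E y * indicator (cell (n, coord n x)) y \<partial>lborel) = ennreal (e (n, coord n x))"
    proof -
      have "(\<lambda>y. indicator E y * indicator (cell (n, coord n x)) y :: ennreal) = indicator (cell (n, coord n x) \<inter> E)" by (auto simp: indicator_def)
      then show ?thesis by (simp add: ee)
    qed
    ultimately show "(\<integral>\<^sup>+y. indicator E y * indicator (cell (n, coord n x)) y \<partial>lborel) \<le> ennreal (1 / 2 ^ (D + 1)) * emeasure lborel (cell (n, coord n x))"
      unfolding v by (simp add: ennreal_leI flip: ennreal_mult')
  qed auto
  have outside: "AE x in lborel. x \<in> cell Q \<longrightarrow> x \<notin> \<Omega> \<longrightarrow> cmod (T (restr (triple Q) f) x) \<le> step_const * A"
    using dens
  proof eventually_elim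
    case (elim x)
    show ?case
    proof (intro impI)
      assume x: "x \<in> cell Q" "x \<notin> \<Omega>"
      have "x \<notin> E"
      proof
        assume "x \<in> E"
        then have "(1::ennreal) \<le> ennreal (1 / 2 ^ (D + 1))" using elim x by simp
        then have "1 \<le> (1::real) / 2 ^ (D + 1)" by (simp flip: ennreal_1)
        moreover have "(1::real) < 2 ^ (D + 1)" by (rule one_less_power) auto
        ultimately show False by (simp add: field_simps)
      qed
      then have "cmod (T (restr (triple Q) f) x) \<le> split_const * A" using x by (auto simp: E_def E1_def A_def)
      also have "\<dots> \<le> step_const * A" unfolding step_const_def
        using A split_const_pos max_const_pos tail_nonneg by (intro mult_right_mono) auto
      finally show "cmod (T (restr (triple Q) f) x) \<le> step_const * A" .
    qed
  qed
  have inside: "AE x in lborel. x \<in> cell P \<longrightarrow> cmod (T (restr (triple Q) f) x) \<le> step_const * A + cmod (T (restr (triple P) f) x)" if P: "P \<in> S" for P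
  proof -
    define h where "h = restr (triple (anc n0 P) - triple P) f"
    have hL: "h \<in> L2_space lborel" unfolding h_def using f by auto
    have PQ: "triple P \<subseteq> triple Q" using SP[OF P] by (intro cell_triple_subset) (auto simp: n0_def)
    have "h = (\<lambda>x. restr (triple Q) f x - restr (triple P) f x)"
      unfolding h_def SP(2)[OF P] using PQ by (auto simp: restr_apply fun_eq_iff)
    then have Th: "AE x in lborel. T h x = T (restr (triple Q) f) x - T (restr (triple P) f) x"
      using T_diff[OF cL cL, of Q P] by simp
    have rep: "AE x in lborel. x \<in> cell P \<longrightarrow> T h x = kernel_op h x"
    proof (rule kernel_representation[OF hL _ _ _ side_pos[of "fst P"]])
      show "bounded (triple (anc n0 P) - triple P)" using bounded_subset[OF bounded_triple[of "anc n0 P"]] by blast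
      fix x y assume "x \<in> cell P" "y \<in> triple (anc n0 P) - triple P"
      then show "side (fst P) \<le> dist x y" using triple_far[of x P y] by (simp add: dist_norm)
    qed (auto simp: h_def restr_apply)
    have notB: "triple_avg f R \<le> max_const * A" if "z \<in> cell R" "cell R \<subseteq> cell Q" "n0 \<le> fst R" "z \<notin> E" for z R
    proof (rule ccontr)
      assume "\<not> ?thesis"
      then have "R \<in> Bd" using that by (simp add: Bd_def A_def n0_def)
      then show False using that by (auto simp: E_def E2_def)
    qed
    (* Half of P lies outside E, and T(f 1_{3P}) is large on less than half of P only. *)
    have good: "\<exists>x'\<in>cell P. x' \<notin> E \<and> x' \<notin> E1 P \<and> T h x' = T (restr (triple Q) f) x' - T (restr (triple P) f) x' \<and> T h x' = kernel_op h x'"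
    proof (rule ccontr)
      assume neg: "\<not> ?thesis"
      from Th rep have "AE x in lborel. x \<in> cell P \<longrightarrow> x \<in> (cell P \<inter> E) \<union> E1 P"
        by eventually_elim (use neg in blast)
      then have "emeasure lborel (cell P) \<le> emeasure lborel ((cell P \<inter> E) \<union> E1 P)"
        by (intro emeasure_mono_AE) auto
      also have "\<dots> \<le> emeasure lborel (cell P \<inter> E) + emeasure lborel (E1 P)" by (intro emeasure_subadditive) auto
      also have "\<dots> \<le> ennreal (v P / 2) + ennreal (\<delta> * v P)"
        using SP(5)[OF P] E1 by (intro add_mono) (auto simp: ee intro!: ennreal_leI)
      also have "\<dots> = ennreal (v P / 2 + \<delta> * v P)" using \<delta> v(1)[of P] by (simp flip: ennreal_plus)
      finally have "v P \<le> v P / 2 + \<delta> * v P" using \<delta> v(1)[of P] unfolding v(2) by (subst (asm) ennreal_le_iff) auto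
      moreover have "\<delta> * v P < 1 / 2 * v P"
      proof (intro mult_strict_right_mono v)
        have "(2::real) ^ 1 < 2 ^ (D + 3)" by (intro power_strict_increasing) auto
        then show "\<delta> < 1 / 2" by (simp add: \<delta>_def field_simps)
      qed
      ultimately show False by simp
    qed
    then obtain x' where x': "x' \<in> cell P" "x' \<notin> E" "x' \<notin> E1 P"
      "T h x' = T (restr (triple Q) f) x' - T (restr (triple P) f) x'" "T h x' = kernel_op h x'" by blast
    have Qx: "x' \<in> cell Q" using x'(1) SP(3)[OF P] by auto
    have B0: "0 \<le> max_const * A" using A max_const_pos by simp
    have avP: "triple_avg f P \<le> max_const * A" using x' SP[OF P] by (intro notB[of x' P]) auto
    have "cmod (kernel_op h x') \<le> split_const * A + split_const * (max_const * A)"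
    proof -
      have "cmod (kernel_op h x') \<le> cmod (T (restr (triple Q) f) x') + cmod (T (restr (triple P) f) x')"
        unfolding x'(5)[symmetric] x'(4) by (rule norm_triangle_ineq4)
      also have "cmod (T (restr (triple Q) f) x') \<le> split_const * A" using x'(2) Qx by (auto simp: E_def E1_def A_def)
      also have "cmod (T (restr (triple P) f) x') \<le> split_const * triple_avg f P" using x'(1,3) by (auto simp: E1_def)
      also have "split_const * triple_avg f P \<le> split_const * (max_const * A)" using avP split_const_pos by (intro mult_left_mono) auto
      finally show ?thesis by simp
    qed
    then have K: "cmod (kernel_op h x) \<le> step_const * A" if x: "x \<in> cell P" for x
    proof -
      have "cmod (kernel_op h x - kernel_op h x') \<le> tail_const \<epsilon> TYPE('d) * (max_const * A)"
        unfolding h_def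
      proof (rule kernel_op_oscillation[OF f _ B0 _ x x'(1)])
        fix j assume j: "n0 \<le> j" "j < fst P"
        have "cell (anc j P) \<subseteq> cell (anc n0 (anc j P))" using cell_anc[of n0 "anc j P"] j by simp
        moreover have "anc n0 (anc j P) = Q"
        proof -
          have "x' \<in> cell (anc j P)" using cell_anc[of j P] j x'(1) by auto
          then show ?thesis using cell_nested[OF Qx, of "anc j P"] j by (simp add: n0_def)
        qed
        ultimately show "triple_avg f (anc j P) \<le> max_const * A"
          using j x' cell_anc[of j P] by (intro notB[of x']) auto
      qed (use SP[OF P] in auto)
      moreover have "cmod (kernel_op h x) \<le> cmod (kernel_op h x') + cmod (kernel_op h x - kernel_op h x')"
        using norm_triangle_ineq[of "kernel_op h x'" "kernel_op h x - kernel_op h x'"] by simp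
      ultimately show ?thesis using \<open>cmod (kernel_op h x') \<le> _\<close> by (simp add: step_const_def algebra_simps)
    qed
    from Th rep show ?thesis
    proof eventually_elim
      case (elim x)
      show ?case
      proof
        assume x: "x \<in> cell P"
        have "T (restr (triple Q) f) x = kernel_op h x + T (restr (triple P) f) x" using elim x by simp
        then have "cmod (T (restr (triple Q) f) x) \<le> cmod (kernel_op h x) + cmod (T (restr (triple P) f) x)" by (simp add: norm_triangle_ineq)
        then show "cmod (T (restr (triple Q) f) x) \<le> step_const * A + cmod (T (restr (triple P) f) x)" using K[OF x] by simp
      qed
    qed
  qed
  have "AE x in lborel. \<forall>P\<in>S. x \<in> cell P \<longrightarrow> cmod (T (restr (triple Q) f) x) \<le> step_const * A + cmod (T (restr (triple P) f) x)"
    using inside by (subst AE_ball_countable) auto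
  with outside have "AE x in lborel. x \<in> cell Q \<longrightarrow>
       (x \<notin> (\<Union>P\<in>S. cell P) \<longrightarrow> cmod (T (restr (triple Q) f) x) \<le> step_const * triple_avg f Q) \<and>
       (\<forall>P\<in>S. x \<in> cell P \<longrightarrow> cmod (T (restr (triple Q) f) x) \<le> step_const * triple_avg f Q + cmod (T (restr (triple P) f) x))"
    unfolding A_def \<Omega>_def by eventually_elim blast
  then show thesis using that[of S] SP dS size unfolding \<Omega>_def n0_def by blast
qed

end

section \<open>Sparse domination\<close>

context cz_grid
begin

text \<open>
  Each generation of cells occupies at most half of the previous one, so almost every point lies in cells of
  finitely many generations only; there the steps add up to a finite sum \<open>J\<close>. Removing from each cell the
  cells of its own next generation leaves the disjoint sets \<open>E P\<close>.
\<close>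

lemma sparse_domination:
  assumes f: "f \<in> L2_space lborel"
  obtains S E where "\<And>P. E P \<in> sets borel" "\<And>P. E P \<subseteq> cell P" "\<And>P. emeasure lborel (cell P) \<le> 2 * emeasure lborel (E P)"
    "disjoint_family_on E S"
    "AE x in lborel. x \<in> cell Q0 \<longrightarrow> (\<exists>J. finite J \<and> J \<subseteq> S \<and> (\<forall>P\<in>J. x \<in> cell P) \<and>
        cmod (T (restr (triple Q0) f) x) \<le> step_const * (\<Sum>P\<in>J. triple_avg f P))"
proof -
  define good where "good Q S \<longleftrightarrow> (\<forall>P\<in>S. fst Q < fst P \<and> cell P \<subseteq> cell Q) \<and> disjoint_family_on cell S \<and>
    2 * emeasure lborel (\<Union>P\<in>S. cell P) \<le> emeasure lborel (cell Q) \<and>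
    (AE x in lborel. x \<in> cell Q \<longrightarrow>
       (x \<notin> (\<Union>P\<in>S. cell P) \<longrightarrow> cmod (T (restr (triple Q) f) x) \<le> step_const * triple_avg f Q) \<and>
       (\<forall>P\<in>S. x \<in> cell P \<longrightarrow> cmod (T (restr (triple Q) f) x) \<le> step_const * triple_avg f Q + cmod (T (restr (triple P) f) x)))" for Q S
  have "\<exists>S. good Q S" for Q
    unfolding good_def by (rule sparse_step[OF f, of Q]) blast
  then obtain Fam where Fam: "\<And>Q. good Q (Fam Q)" by metis
  note F1 = Fam[unfolded good_def, THEN conjunct1, rule_format]
  note F2 = Fam[unfolded good_def, THEN conjunct2, THEN conjunct1]
  note F3 = Fam[unfolded good_def, THEN conjunct2, THEN conjunct2, THEN conjunct1]
  note F4 = Fam[unfolded good_def, THEN conjunct2, THEN conjunct2, THEN conjunct2]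
  define U where "U P = (\<Union>R\<in>Fam P. cell R)" for P
  have UP: "U P \<subseteq> cell P" for P unfolding U_def using F1[of _ P] by blast
  have Um [measurable]: "U P \<in> sets borel" for P by (simp add: U_def)
  define gen where "gen n = ((\<lambda>S. \<Union>P\<in>S. Fam P) ^^ n) {Q0}" for n
  have gen0: "gen 0 = {Q0}" and genS: "gen (Suc n) = (\<Union>P\<in>gen n. Fam P)" for n by (simp_all add: gen_def)
  have gd: "P = R" if "P \<in> gen n" "R \<in> gen n" "x \<in> cell P" "x \<in> cell R" for n P R x
    using that
  proof (induction n arbitrary: P R)
    case 0
    then show ?case by (simp add: gen0)
  next
    case (Suc n)
    obtain P' R' where PR: "P' \<in> gen n" "P \<in> Fam P'" "R' \<in> gen n" "R \<in> Fam R'" using Suc.prems by (auto simp: genS)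
    have "x \<in> cell P'" "x \<in> cell R'" using F1[OF PR(2)] F1[OF PR(4)] Suc.prems by auto
    then have "P' = R'" using Suc.IH PR by blast
    then show ?case using F2[of P'] PR Suc.prems unfolding disjoint_family_on_def by blast
  qed
  have dgen: "disjoint_family_on cell (gen n)" for n unfolding disjoint_family_on_def using gd by blast
  define \<Omega> where "\<Omega> n = (\<Union>P\<in>gen n. cell P)" for n
  have Om [measurable]: "\<Omega> n \<in> sets borel" for n by (simp add: \<Omega>_def)
  have OS: "\<Omega> (Suc n) = (\<Union>P\<in>gen n. U P)" for n by (auto simp: \<Omega>_def genS U_def)
  have half: "2 * emeasure lborel (\<Omega> (Suc n)) \<le> emeasure lborel (\<Omega> n)" for n
  proof -
    have "emeasure lborel (\<Omega> (Suc n)) = (\<integral>\<^sup>+P. emeasure lborel (U P) \<partial>count_space (gen n))"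
      unfolding OS
    proof (rule emeasure_UN_countable)
      show "disjoint_family_on U (gen n)" using dgen[of n] UP unfolding disjoint_family_on_def by blast
    qed auto
    then have "2 * emeasure lborel (\<Omega> (Suc n)) = (\<integral>\<^sup>+P. 2 * emeasure lborel (U P) \<partial>count_space (gen n))"
      by (simp add: nn_integral_cmult)
    also have "\<dots> \<le> (\<integral>\<^sup>+P. emeasure lborel (cell P) \<partial>count_space (gen n))"
      using F3 by (intro nn_integral_mono) (simp add: U_def)
    also have "\<dots> = emeasure lborel (\<Omega> n)" unfolding \<Omega>_def by (rule emeasure_cells[OF dgen, symmetric])
    finally show ?thesis .
  qed
  have anti: "\<Omega> m \<subseteq> \<Omega> n" if "n \<le> m" for m n
  proof (rule lift_Suc_antimono_le[OF _ that])
    show "\<Omega> (Suc k) \<subseteq> \<Omega> k" for k unfolding OS[of k] unfolding \<Omega>_def by (rule UN_mono[OF subset_refl UP])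
  qed
  have null: "emeasure lborel (\<Inter>n. \<Omega> n) = 0"
  proof -
    have dec: "2 ^ n * emeasure lborel (\<Omega> n) \<le> emeasure lborel (cell Q0)" for n
    proof (induction n)
      case 0
      then show ?case by (simp add: \<Omega>_def gen0)
    next
      case (Suc n)
      have "2 ^ Suc n * emeasure lborel (\<Omega> (Suc n)) = 2 ^ n * (2 * emeasure lborel (\<Omega> (Suc n)))" by (simp add: mult_ac)
      also have "\<dots> \<le> 2 ^ n * emeasure lborel (\<Omega> n)" using half by (intro mult_left_mono) auto
      finally show ?case using Suc.IH by (rule order.trans)
    qed
    have le: "emeasure lborel (\<Inter>n. \<Omega> n) \<le> emeasure lborel (\<Omega> n)" for n by (intro emeasure_mono) auto
    obtain s where s: "emeasure lborel (cell Q0) = ennreal s" "0 \<le> s" using emeasure_cell_finite[of Q0] by (cases "emeasure lborel (cell Q0)") auto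
    have "emeasure lborel (\<Inter>n. \<Omega> n) \<le> ennreal s" using le[of 0] s by (simp add: \<Omega>_def gen0)
    then obtain r where r: "emeasure lborel (\<Inter>n. \<Omega> n) = ennreal r" "0 \<le> r"
      by (metis enn2real_nonneg ennreal_enn2real ennreal_less_top order.strict_trans1)
    have *: "2 ^ n * r \<le> s" for n
    proof -
      have "ennreal (2 ^ n * r) = 2 ^ n * emeasure lborel (\<Inter>n. \<Omega> n)" using r by (simp add: ennreal_mult' ennreal_numeral_power)
      also have "\<dots> \<le> 2 ^ n * emeasure lborel (\<Omega> n)" by (intro mult_left_mono le) auto
      also have "\<dots> \<le> ennreal s" using dec s by simp
      finally show ?thesis using s by simp
    qed
    have "r = 0"
    proof (rule ccontr)
      assume "r \<noteq> 0"
      then have "0 < r" using r by simp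
      obtain n where "s / r < 2 ^ n" using real_arch_pow[of 2] by auto
      then show False using *[of n] \<open>0 < r\<close> by (simp add: field_simps)
    qed
    then show ?thesis using r by simp
  qed
  define S where "S = (\<Union>n. gen n)"
  define E where "E P = cell P - U P" for P
  have Em: "E P \<in> sets borel" for P by (simp add: E_def)
  have Esz: "emeasure lborel (cell P) \<le> 2 * emeasure lborel (E P)" for P
  proof -
    obtain s where s: "emeasure lborel (cell P) = ennreal s" "0 \<le> s" using emeasure_cell_finite[of P] by (cases "emeasure lborel (cell P)") auto
    have "emeasure lborel (U P) \<le> emeasure lborel (cell P)" using UP by (intro emeasure_mono) auto
    then obtain r where r: "emeasure lborel (U P) = ennreal r" "0 \<le> r" using s
      by (metis enn2real_nonneg ennreal_enn2real ennreal_less_top order.strict_trans1)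
    have "ennreal (2 * r) \<le> ennreal s" using F3[of P] r s by (simp add: U_def ennreal_mult')
    then have "2 * r \<le> s" using s by simp
    have "emeasure lborel (E P) = emeasure lborel (cell P) - emeasure lborel (U P)"
      unfolding E_def using UP r by (intro emeasure_Diff) auto
    also have "\<dots> = ennreal (s - r)" using r s by (simp add: ennreal_minus)
    finally have "2 * emeasure lborel (E P) = ennreal 2 * ennreal (s - r)" by simp
    also have "\<dots> = ennreal (2 * (s - r))" by (rule ennreal_mult'[symmetric]) simp
    finally have "2 * emeasure lborel (E P) = ennreal (2 * (s - r))" .
    then show ?thesis using s \<open>2 * r \<le> s\<close> by (simp add: ennreal_leI)
  qed
  have Edis: "disjoint_family_on E S"
  proof -
    have *: "E P \<inter> E R = {}" if P: "P \<in> gen n" and R: "R \<in> gen m" and "P \<noteq> R" "n \<le> m" for P R n m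
    proof (cases "n = m")
      case True
      then show ?thesis using gd[of P n R] that by (auto simp: E_def)
    next
      case False
      have "x \<notin> E P" if x: "x \<in> E R" for x
      proof
        assume xP: "x \<in> E P"
        have "x \<in> \<Omega> m" using x R by (auto simp: \<Omega>_def E_def)
        then have "x \<in> \<Omega> (Suc n)" using anti[of "Suc n" m] False \<open>n \<le> m\<close> by auto
        then obtain P' where P': "P' \<in> gen n" "x \<in> U P'" by (auto simp: OS)
        then have "x \<in> cell P'" using UP[of P'] by blast
        then have "P' = P" using gd[of P' n P x] P P' xP by (auto simp: E_def)
        then show False using P' xP by (simp add: E_def)
      qed
      then show ?thesis by blast
    qed
    show ?thesis unfolding disjoint_family_on_def
    proof (intro ballI impI)
      fix P R assume "P \<in> S" "R \<in> S" "P \<noteq> R"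
      then obtain n m where nm: "P \<in> gen n" "R \<in> gen m" by (auto simp: S_def)
      show "E P \<inter> E R = {}"
      proof (cases "n \<le> m")
        case True
        then show ?thesis using *[OF nm] \<open>P \<noteq> R\<close> by simp
      next
        case False
        then show ?thesis using *[OF nm(2,1)] \<open>P \<noteq> R\<close> by auto
      qed
    qed
  qed
  have "AE x in lborel. \<forall>Q. x \<in> cell Q \<longrightarrow>
       (x \<notin> U Q \<longrightarrow> cmod (T (restr (triple Q) f) x) \<le> step_const * triple_avg f Q) \<and>
       (\<forall>P\<in>Fam Q. x \<in> cell P \<longrightarrow> cmod (T (restr (triple Q) f) x) \<le> step_const * triple_avg f Q + cmod (T (restr (triple P) f) x))"
    unfolding U_def using F4 by (subst AE_all_countable) auto
  moreover have "AE x in lborel. x \<notin> (\<Inter>n. \<Omega> n)" using null by (intro AE_not_in) (auto intro!: null_setsI)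
  ultimately have dom: "AE x in lborel. x \<in> cell Q0 \<longrightarrow> (\<exists>J. finite J \<and> J \<subseteq> S \<and> (\<forall>P\<in>J. x \<in> cell P) \<and>
        cmod (T (restr (triple Q0) f) x) \<le> step_const * (\<Sum>P\<in>J. triple_avg f P))"
  proof eventually_elim
    case (elim x)
    obtain N where N: "x \<notin> \<Omega> N" using elim by auto
    have "\<exists>J. finite J \<and> J \<subseteq> S \<and> (\<forall>R\<in>J. x \<in> cell R \<and> fst P \<le> fst R) \<and>
        cmod (T (restr (triple P) f) x) \<le> step_const * (\<Sum>R\<in>J. triple_avg f R)"
      if "P \<in> gen n" "x \<in> cell P" "N = n + k" for k n P
      using that
    proof (induction k arbitrary: n P)
      case 0
      then show ?case using N by (auto simp: \<Omega>_def)
    next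
      case (Suc k)
      have PS: "P \<in> S" using Suc.prems by (auto simp: S_def)
      show ?case
      proof (cases "x \<in> U P")
        case False
        then have "cmod (T (restr (triple P) f) x) \<le> step_const * triple_avg f P" using elim(1) Suc.prems by blast
        then show ?thesis using PS Suc.prems by (intro exI[of _ "{P}"]) auto
      next
        case True
        then obtain R where R: "R \<in> Fam P" "x \<in> cell R" by (auto simp: U_def)
        have "R \<in> gen (Suc n)" using R Suc.prems by (auto simp: genS)
        then obtain J where J: "finite J" "J \<subseteq> S" "\<And>R'. R' \<in> J \<Longrightarrow> x \<in> cell R' \<and> fst R \<le> fst R'"
          "cmod (T (restr (triple R) f) x) \<le> step_const * (\<Sum>R\<in>J. triple_avg f R)"
          using Suc.IH[of R "Suc n"] R Suc.prems by auto
        have lt: "fst P < fst R" using F1[OF R(1)] by simp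
        then have nin: "P \<notin> J" using J(3)[of P] by auto
        have "cmod (T (restr (triple P) f) x) \<le> step_const * triple_avg f P + cmod (T (restr (triple R) f) x)"
          using elim(1) Suc.prems R by blast
        also have "\<dots> \<le> step_const * triple_avg f P + step_const * (\<Sum>R\<in>J. triple_avg f R)" using J(4) by simp
        also have "\<dots> = step_const * (\<Sum>R\<in>insert P J. triple_avg f R)" using nin J(1) by (simp add: distrib_left)
        finally show ?thesis using J PS Suc.prems lt by (intro exI[of _ "insert P J"]) force
      qed
    qed
    from this[of Q0 0 N] show ?case by (auto simp: gen0)
  qed
  show thesis by (rule that[OF Em _ Esz Edis dom]) (auto simp: E_def)
qed

end

section \<open>Sparse sums in weighted spaces\<close>

lemma A2_cube_bound:
  fixes w :: "real ^ 'd \<Rightarrow> real"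
  assumes I: "I \<in> cubes" "emeasure lborel I = ennreal v" "0 < v"
  shows "(\<integral>\<^sup>+x. ennreal (w x) * indicator I x \<partial>lborel) * (\<integral>\<^sup>+x. ennreal (inverse (w x)) * indicator I x \<partial>lborel)
    \<le> A2_char w * ennreal (v\<^sup>2)"
proof -
  let ?W = "\<integral>\<^sup>+x. ennreal (w x) * indicator I x \<partial>lborel" and ?S = "\<integral>\<^sup>+x. ennreal (inverse (w x)) * indicator I x \<partial>lborel"
  have le: "?W / ennreal v * (?S / ennreal v) \<le> A2_char w"
    unfolding A2_char_def using SUP_upper[OF I(1), of "\<lambda>I. average w I * average (\<lambda>x. inverse (w x)) I"]
    by (simp add: average_def I(2))
  have c: "a / ennreal v * ennreal v = a" for a :: ennreal
    using I(3) by (simp add: divide_ennreal_def mult.assoc inverse_ennreal flip: ennreal_mult)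
  have "?W * ?S = (?W / ennreal v * ennreal v) * (?S / ennreal v * ennreal v)" by (simp only: c)
  also have "\<dots> = ?W / ennreal v * (?S / ennreal v) * (ennreal v * ennreal v)" by (simp only: mult_ac)
  also have "\<dots> \<le> A2_char w * (ennreal v * ennreal v)" using le by (intro mult_right_mono) auto
  also have "ennreal v * ennreal v = ennreal (v\<^sup>2)" using I(3) by (simp add: power2_eq_square ennreal_mult')
  finally show ?thesis .
qed

locale A2_grid = grid L for L :: real +
  fixes w :: "real ^ 'd \<Rightarrow> real"
  assumes A2: "A2_weight w"
begin

definition A2c :: real where "A2c = enn2real (A2_char w)"

lemma A2_char_eq: "A2_char w = ennreal A2c" "0 \<le> A2c"
  using A2 unfolding A2c_def A2_weight_def by (auto simp: less_top[symmetric])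

lemma w_measurable [measurable]: "w \<in> borel_measurable borel"
  using A2 by (simp add: A2_weight_def is_weight_def)

lemma w_pos: "AE x in lborel. 0 < w x"
  using A2 by (simp add: A2_weight_def is_weight_def)

text \<open>
  The lower bound is the Cauchy-Schwarz inequality for \<open>sqrt w\<close> and \<open>sqrt (inverse w)\<close>. It makes both masses
  positive, so the upper bound forces the mass of \<open>inverse w\<close> to be finite as well.
\<close>

lemma triple_weight_mass:
  fixes P :: "'d cell"
  obtains W V where "0 < W" "0 < V" "(\<integral>\<^sup>+x. ennreal (w x) * indicator (triple P) x \<partial>lborel) = ennreal W"
    "(\<integral>\<^sup>+x. ennreal (inverse (w x)) * indicator (triple P) x \<partial>lborel) = ennreal V"
    "W * V \<le> A2c * ((3 * side (fst P)) ^ CARD('d))\<^sup>2" "((3 * side (fst P)) ^ CARD('d))\<^sup>2 \<le> W * V"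
proof -
  let ?v = "(3 * side (fst P)) ^ CARD('d)"
  have v: "0 < ?v" using side_pos[of "fst P"] by simp
  let ?W = "\<integral>\<^sup>+x. ennreal (w x) * indicator (triple P) x \<partial>lborel"
  let ?V = "\<integral>\<^sup>+x. ennreal (inverse (w x)) * indicator (triple P) x \<partial>lborel"
  have "?W * ?V \<le> (\<integral>\<^sup>+x. ennreal (w x) * indicator (triple_cube P) x \<partial>lborel) * (\<integral>\<^sup>+x. ennreal (inverse (w x)) * indicator (triple_cube P) x \<partial>lborel)"
    using triple_subset_cube[of P] by (intro mult_mono nn_integral_mono mult_left_mono) (auto simp: indicator_def)
  also have "\<dots> \<le> A2_char w * ennreal (?v\<^sup>2)" by (intro A2_cube_bound triple_cube_cubes emeasure_triple_cube v)
  finally have up: "?W * ?V \<le> ennreal (A2c * ?v\<^sup>2)" using A2_char_eq v by (simp add: ennreal_mult')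
  have Wfin: "?W < \<infinity>"
  proof -
    have "compact (triple_cube P)" by (simp add: triple_cube_def)
    then have "set_integrable lborel (triple_cube P) w" using A2 by (simp add: A2_weight_def is_weight_def)
    then have fin: "(\<integral>\<^sup>+x. norm (indicator (triple_cube P) x *\<^sub>R w x) \<partial>lborel) < \<infinity>"
      unfolding set_integrable_def integrable_iff_bounded by auto
    have "?W \<le> (\<integral>\<^sup>+x. norm (indicator (triple_cube P) x *\<^sub>R w x) \<partial>lborel)"
      using triple_subset_cube[of P] by (intro nn_integral_mono) (auto simp: indicator_def intro: ennreal_leI)
    from order.strict_trans1[OF this fin] show ?thesis .
  qed
  have low: "ennreal (?v\<^sup>2) \<le> ?W * ?V"
  proof -
    have "ennreal ?v = (\<integral>\<^sup>+x. indicator (triple P) x \<partial>lborel)" by (simp add: emeasure_triple)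
    also have "\<dots> = (\<integral>\<^sup>+x. (ennreal (sqrt (w x)) * indicator (triple P) x) * (ennreal (sqrt (inverse (w x))) * indicator (triple P) x) \<partial>lborel)"
    proof (intro nn_integral_cong_AE eventually_mono[OF w_pos])
      fix x assume x: "0 < w x"
      have "ennreal (sqrt (w x)) * ennreal (sqrt (inverse (w x))) = 1"
        using x by (simp add: real_sqrt_mult[symmetric] flip: ennreal_mult')
      then show "indicator (triple P) x = (ennreal (sqrt (w x)) * indicator (triple P) x) * (ennreal (sqrt (inverse (w x))) * indicator (triple P) x)"
        by (simp add: indicator_def)
    qed
    finally have "ennreal (?v\<^sup>2) = \<dots>\<^sup>2" using v by (metis ennreal_power less_imp_le)
    also have "\<dots> \<le> (\<integral>\<^sup>+x. (ennreal (sqrt (w x)) * indicator (triple P) x)\<^sup>2 \<partial>lborel) * (\<integral>\<^sup>+x. (ennreal (sqrt (inverse (w x))) * indicator (triple P) x)\<^sup>2 \<partial>lborel)"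
      by (rule Cauchy_Schwarz_nn_integral) auto
    also have "\<dots> = ?W * ?V"
    proof (intro arg_cong2[where f = "(*)"] nn_integral_cong_AE eventually_mono[OF w_pos])
      fix x assume x: "0 < w x"
      have "(ennreal (sqrt a))\<^sup>2 = ennreal a" if "0 < a" for a using that by (subst ennreal_power) auto
      then show "(ennreal (sqrt (w x)) * indicator (triple P) x)\<^sup>2 = ennreal (w x) * indicator (triple P) x"
        "(ennreal (sqrt (inverse (w x))) * indicator (triple P) x)\<^sup>2 = ennreal (inverse (w x)) * indicator (triple P) x"
        using x by (auto simp: indicator_def)
    qed
    finally show ?thesis .
  qed
  have "0 < ennreal (?v\<^sup>2)" using v by (simp only: ennreal_less_zero_iff zero_less_power)
  then have ne: "?W \<noteq> 0" "?V \<noteq> 0" using low by auto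
  obtain W where W: "?W = ennreal W" "0 \<le> W" using Wfin by (cases ?W) auto
  have "0 < W" using W ne by (cases "W = 0") auto
  have "?V < \<infinity>"
  proof (rule ccontr)
    assume "\<not> ?V < \<infinity>"
    then have "?V = top" by (metis infinity_ennreal_def top.not_eq_extremum)
    then have "?W * ?V = top" using ne(1) by (simp add: ennreal_mult_eq_top_iff)
    then show False using up by (simp add: top_unique)
  qed
  then obtain V where V: "?V = ennreal V" "0 \<le> V" by (cases ?V) auto
  have "0 < V" using V ne by (cases "V = 0") auto
  have WV: "?W * ?V = ennreal (W * V)" using W V by (simp add: ennreal_mult)
  have "W * V \<le> A2c * ?v\<^sup>2" using up A2_char_eq(2) unfolding WV by (subst (asm) ennreal_le_iff) auto
  moreover have "?v\<^sup>2 \<le> W * V" using low W V unfolding WV by (subst (asm) ennreal_le_iff) auto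
  ultimately show thesis using that[OF \<open>0 < W\<close> \<open>0 < V\<close> W(1) V(1)] by blast
qed

lemma A2c_ge_1: "1 \<le> A2c"
proof -
  let ?P = "(0, \<lambda>_. 0) :: 'd cell"
  let ?v = "(3 * side (fst ?P)) ^ CARD('d)"
  obtain W V where "W * V \<le> A2c * ?v\<^sup>2" "?v\<^sup>2 \<le> W * V" by (rule triple_weight_mass[of ?P])
  then have "1 * ?v\<^sup>2 \<le> A2c * ?v\<^sup>2" by linarith
  moreover have "0 < ?v\<^sup>2" using side_pos[of 0] by simp
  ultimately show ?thesis by (simp only: mult_le_cancel_right_pos)
qed

definition sparse_sum :: "('d cell \<Rightarrow> real) \<Rightarrow> 'd cell set \<Rightarrow> real ^ 'd \<Rightarrow> real" where
  "sparse_sum A S x = (\<Sum>P\<in>S. A P * indicator (cell P) x)"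

lemma sparse_sum_measurable [measurable]: "sparse_sum A S \<in> borel_measurable borel"
  unfolding sparse_sum_def[abs_def] by measurable

text \<open>
  Let \<open>u\<close> be the sparse sum, \<open>X\<close> the square of its norm in \<open>L\<^sup>2(w)\<close>, and \<open>Y\<close> that of \<open>f\<close>. Expanding one
  factor of \<open>u\<^sup>2\<close> bounds \<open>X\<close> by the sum of \<open>A P * G P\<close>, where \<open>G P\<close> is the integral of \<open>u w\<close> over the triple.
  With \<open>a P\<close>, \<open>b P\<close> the averages of \<open>f w\<close> and \<open>u\<close> over the triple with respect to \<open>w\<^sup>-\<^sup>1 dx\<close> and \<open>w dx\<close>, each
  term is at most a multiple of \<open>[w]\<close> times \<open>a P * b P\<close> times the measure of \<open>E P\<close>. In each lattice class
  the sum of these is at most the integral of the product of the two maximal functions, and the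
  square of this integral is at most \<open>16 X Y\<close>. So \<open>X\<^sup>2\<close> is at most a multiple of \<open>X Y\<close>, and \<open>X\<close> is finite because
  the sum is finite and the weight is locally integrable.
\<close>

lemma sparse_bound:
  assumes S: "finite S" and f [measurable]: "f \<in> borel_measurable borel"
    and A: "\<And>P. P \<in> S \<Longrightarrow> 0 \<le> A P"
      "\<And>P. P \<in> S \<Longrightarrow> ennreal (A P) * emeasure lborel (triple P) \<le> (\<integral>\<^sup>+x. ennreal (f x) * indicator (triple P) x \<partial>lborel)"
    and f0: "\<And>x. 0 \<le> f x"
    and E: "\<And>P. E P \<in> sets borel" "\<And>P. E P \<subseteq> cell P" "\<And>P. emeasure lborel (cell P) \<le> 2 * emeasure lborel (E P)"
      "disjoint_family_on E S"
  shows "(\<integral>\<^sup>+x. ennreal ((sparse_sum A S x)\<^sup>2) * ennreal (w x) \<partial>lborel)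
    \<le> ennreal ((8 * 9 ^ CARD('d) * A2c)\<^sup>2) * (\<integral>\<^sup>+x. ennreal ((f x)\<^sup>2) * ennreal (w x) \<partial>lborel)"
proof -
  define u where "u = sparse_sum A S"
  have um [measurable]: "u \<in> borel_measurable borel" unfolding u_def by measurable
  have u0: "0 \<le> u x" for x unfolding u_def sparse_sum_def using A by (intro sum_nonneg) auto
  define X where "X = (\<integral>\<^sup>+x. ennreal ((u x)\<^sup>2) * ennreal (w x) \<partial>lborel)"
  define Y where "Y = (\<integral>\<^sup>+x. ennreal ((f x)\<^sup>2) * ennreal (w x) \<partial>lborel)"
  define v where "v P = (3 * side (fst P)) ^ CARD('d)" for P :: "'d cell"
  have v: "0 < v P" for P using side_pos[of "fst P"] by (simp add: v_def)
  have "\<exists>W V. 0 < W \<and> 0 < V \<and> (\<integral>\<^sup>+x. ennreal (w x) * indicator (triple P) x \<partial>lborel) = ennreal W \<and>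
    (\<integral>\<^sup>+x. ennreal (inverse (w x)) * indicator (triple P) x \<partial>lborel) = ennreal V \<and> W * V \<le> A2c * (v P)\<^sup>2" for P
    unfolding v_def by (rule triple_weight_mass[of P]) blast
  then obtain W V where WV: "\<And>P. 0 < W P" "\<And>P. 0 < V P"
    "\<And>P. (\<integral>\<^sup>+x. ennreal (w x) * indicator (triple P) x \<partial>lborel) = ennreal (W P)"
    "\<And>P. (\<integral>\<^sup>+x. ennreal (inverse (w x)) * indicator (triple P) x \<partial>lborel) = ennreal (V P)"
    "\<And>P. W P * V P \<le> A2c * (v P)\<^sup>2" by metis
  define B where "B = (\<Sum>P\<in>S. A P)"
  have B0: "0 \<le> B" unfolding B_def using A by (intro sum_nonneg) auto
  have uB: "u x \<le> B" for x unfolding u_def sparse_sum_def B_def using A by (intro sum_mono) (auto simp: indicator_def)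
  have Xfin: "X < \<infinity>"
  proof -
    have "X \<le> (\<integral>\<^sup>+x. ennreal (B\<^sup>2) * (\<Sum>P\<in>S. ennreal (w x) * indicator (triple P) x) \<partial>lborel)"
      unfolding X_def
    proof (intro nn_integral_mono)
      fix x
      show "ennreal ((u x)\<^sup>2) * ennreal (w x) \<le> ennreal (B\<^sup>2) * (\<Sum>P\<in>S. ennreal (w x) * indicator (triple P) x)"
      proof (cases "u x = 0")
        case False
        then obtain P where P: "P \<in> S" "x \<in> cell P" unfolding u_def sparse_sum_def
          by (metis (no_types, lifting) indicator_simps(2) mult_zero_right sum.neutral)
        then have "x \<in> triple P" using cell_subset_triple[of P] by auto
        then have "ennreal (w x) = ennreal (w x) * indicator (triple P) x" by simp
        also have "\<dots> \<le> (\<Sum>P\<in>S. ennreal (w x) * indicator (triple P) x)" using P S by (intro member_le_sum) auto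
        finally show ?thesis using uB[of x] u0[of x] by (intro mult_mono ennreal_leI power_mono) auto
      qed simp
    qed
    also have "\<dots> = ennreal (B\<^sup>2) * (\<Sum>P\<in>S. ennreal (W P))"
      by (simp add: nn_integral_cmult nn_integral_sum WV)
    also have "(\<Sum>P\<in>S. ennreal (W P)) = ennreal (\<Sum>P\<in>S. W P)" by (intro sum_ennreal less_imp_le[OF WV(1)])
    also have "ennreal (B\<^sup>2) * \<dots> < \<infinity>" by (simp add: ennreal_mult_less_top)
    finally show ?thesis .
  qed
  define G where "G P = enn2real (\<integral>\<^sup>+x. ennreal (u x) * ennreal (w x) * indicator (triple P) x \<partial>lborel)" for P
  have G: "(\<integral>\<^sup>+x. ennreal (u x) * ennreal (w x) * indicator (triple P) x \<partial>lborel) = ennreal (G P)" for P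
  proof -
    have "(\<integral>\<^sup>+x. ennreal (u x) * ennreal (w x) * indicator (triple P) x \<partial>lborel) \<le> (\<integral>\<^sup>+x. ennreal B * (ennreal (w x) * indicator (triple P) x) \<partial>lborel)"
      using uB by (intro nn_integral_mono) (auto simp: mult.assoc intro!: mult_right_mono ennreal_leI)
    also have "\<dots> < \<infinity>" by (simp add: nn_integral_cmult WV ennreal_mult_less_top)
    finally show ?thesis unfolding G_def by simp
  qed
  have G0: "0 \<le> G P" for P by (simp add: G_def)
  define a where "a P = A P * v P / V P" for P
  define b where "b P = G P / W P" for P
  have a0: "0 \<le> a P" if "P \<in> S" for P unfolding a_def using A(1)[OF that] v[of P] WV(2)[of P] by simp
  have b0: "0 \<le> b P" for P unfolding b_def using G0[of P] WV(1)[of P] by simp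
  define e where "e P = enn2real (emeasure lborel (E P))" for P
  have e: "emeasure lborel (E P) = ennreal (e P)" "0 \<le> e P" for P
  proof -
    have "emeasure lborel (E P) \<le> emeasure lborel (cell P)" using E by (intro emeasure_mono) auto
    also have "\<dots> < \<infinity>" by (simp add: emeasure_cell)
    finally show "emeasure lborel (E P) = ennreal (e P)" unfolding e_def by simp
  qed (simp add: e_def)
  have ve: "v P \<le> 2 * 3 ^ CARD('d) * e P" for P
  proof -
    have "ennreal (side (fst P) ^ CARD('d)) \<le> ennreal (2 * e P)" using E(3)[of P] e[of P] by (simp add: emeasure_cell ennreal_mult')
    then have "side (fst P) ^ CARD('d) \<le> 2 * e P" using e[of P] by (subst (asm) ennreal_le_iff) auto
    then have "3 ^ CARD('d) * side (fst P) ^ CARD('d) \<le> 3 ^ CARD('d) * (2 * e P)" by (intro mult_left_mono) auto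
    then show ?thesis by (simp add: v_def power_mult_distrib mult_ac)
  qed
  define k where "k = 2 * 3 ^ CARD('d) * A2c"
  have k0: "0 \<le> k" unfolding k_def using A2_char_eq(2) by simp
  have termwise: "A P * G P \<le> k * (e P * (a P * b P))" if P: "P \<in> S" for P
  proof -
    have "A P * G P = a P * b P * (W P * V P) / v P"
      unfolding a_def b_def using WV(1,2)[of P] v[of P] by simp
    also have "\<dots> \<le> a P * b P * (A2c * (v P)\<^sup>2) / v P"
      using WV(5)[of P] a0[OF P] b0[of P] v[of P] by (intro divide_right_mono mult_left_mono) auto
    also have "\<dots> = a P * b P * A2c * v P" using v[of P] by (simp add: power2_eq_square)
    also have "\<dots> \<le> a P * b P * A2c * (2 * 3 ^ CARD('d) * e P)"
      using ve[of P] a0[OF P] b0[of P] A2_char_eq(2) by (intro mult_left_mono) auto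
    finally show ?thesis by (simp add: k_def mult_ac)
  qed
  define St where "St t = {P \<in> S. lattice_class P = t}" for t
  have St: "finite (St t)" "St t \<subseteq> S" for t using S by (auto simp: St_def)
  define Ma Mb where "Ma t = laminar_max triple a (St t)" and "Mb t = laminar_max triple b (St t)" for t
  have Mm [measurable]: "Ma t \<in> borel_measurable borel" "Mb t \<in> borel_measurable borel" for t
    unfolding Ma_def Mb_def using St by (auto intro!: laminar_max_measurable)
  have M0: "0 \<le> Ma t x" "0 \<le> Mb t x" for t x unfolding Ma_def Mb_def using St by (auto intro!: laminar_max_nonneg)
  define Z where "Z t = (\<integral>\<^sup>+x. ennreal (Ma t x) * ennreal (Mb t x) \<partial>lborel)" for t
  have lam: "triple P \<inter> triple R = {} \<or> triple R \<subseteq> triple P" if "P \<in> St t" "R \<in> St t" "fst P \<le> fst R" for P R t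
    using triple_laminar[of P R] that by (auto simp: St_def)
  (* Doob for the measure w^-1 dx, applied to f w, whose square integral is Y. *)
  have Za: "(\<integral>\<^sup>+x. ennreal ((Ma t x)\<^sup>2) * ennreal (inverse (w x)) \<partial>lborel) \<le> 4 * Y" for t
  proof -
    let ?N = "density lborel (\<lambda>x. ennreal (inverse (w x)))"
    let ?h = "\<lambda>x. ennreal (f x) * ennreal (w x)"
    have "(\<integral>\<^sup>+x. ennreal ((laminar_max triple a (St t) x)\<^sup>2) \<partial>?N) \<le> 4 * (\<integral>\<^sup>+x. (?h x)\<^sup>2 \<partial>?N)"
    proof (rule laminar_maximal[where r = fst])
      show "finite (St t)" by (rule St)
      fix P assume P: "P \<in> St t"
      show "triple P \<in> sets ?N" by simp
      have em: "emeasure ?N (triple P) = ennreal (V P)" using WV(4)[of P] by (simp add: emeasure_density)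
      show "emeasure ?N (triple P) < \<infinity>" unfolding em by simp
      show "0 \<le> a P" using a0 P St by blast
      have "ennreal (a P) * emeasure ?N (triple P) = ennreal (A P) * emeasure lborel (triple P)"
        unfolding em emeasure_triple v_def[symmetric] a_def using WV(2)[of P] A(1)[of P] P St(2)[of t] v[of P]
        by (auto simp flip: ennreal_mult')
      also have "\<dots> \<le> (\<integral>\<^sup>+x. ennreal (f x) * indicator (triple P) x \<partial>lborel)" using A(2) P St by blast
      also have "\<dots> = (\<integral>\<^sup>+x. ennreal (inverse (w x)) * (?h x * indicator (triple P) x) \<partial>lborel)"
      proof (intro nn_integral_cong_AE eventually_mono[OF w_pos])
        fix x assume x: "0 < w x"
        then have "ennreal (inverse (w x)) * ennreal (w x) = 1" by (simp flip: ennreal_mult')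
        then show "ennreal (f x) * indicator (triple P) x = ennreal (inverse (w x)) * (?h x * indicator (triple P) x)"
          by (metis mult.assoc mult.commute mult_1)
      qed
      also have "\<dots> = (\<integral>\<^sup>+x. ?h x * indicator (triple P) x \<partial>?N)" by (subst nn_integral_density) auto
      finally show "ennreal (a P) * emeasure ?N (triple P) \<le> (\<integral>\<^sup>+x. ?h x * indicator (triple P) x \<partial>?N)" .
    qed (use lam in auto)
    also have "(\<integral>\<^sup>+x. (?h x)\<^sup>2 \<partial>?N) = (\<integral>\<^sup>+x. ennreal (inverse (w x)) * (?h x)\<^sup>2 \<partial>lborel)" by (subst nn_integral_density) auto
    also have "\<dots> = Y"
      unfolding Y_def
    proof (intro nn_integral_cong_AE eventually_mono[OF w_pos])
      fix x assume x: "0 < w x"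
      have "inverse (w x) * (f x * w x)\<^sup>2 = (f x)\<^sup>2 * w x" using x by (simp add: power2_eq_square field_simps)
      then have "ennreal (inverse (w x) * (f x * w x)\<^sup>2) = ennreal ((f x)\<^sup>2 * w x)" by simp
      then show "ennreal (inverse (w x)) * (?h x)\<^sup>2 = ennreal ((f x)\<^sup>2) * ennreal (w x)"
        using x f0[of x] by (simp add: ennreal_mult ennreal_power[symmetric])
    qed
    finally show ?thesis by (subst (asm) nn_integral_density) (auto simp: Ma_def[symmetric] mult.commute)
  qed
  (* Doob for the measure w dx, applied to u, whose square integral is X. *)
  have Zb: "(\<integral>\<^sup>+x. ennreal ((Mb t x)\<^sup>2) * ennreal (w x) \<partial>lborel) \<le> 4 * X" for t
  proof -
    let ?N = "density lborel (\<lambda>x. ennreal (w x))"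
    have "(\<integral>\<^sup>+x. ennreal ((laminar_max triple b (St t) x)\<^sup>2) \<partial>?N) \<le> 4 * (\<integral>\<^sup>+x. (ennreal (u x))\<^sup>2 \<partial>?N)"
    proof (rule laminar_maximal[where r = fst])
      show "finite (St t)" by (rule St)
      fix P assume P: "P \<in> St t"
      show "triple P \<in> sets ?N" by simp
      have em: "emeasure ?N (triple P) = ennreal (W P)" using WV(3)[of P] by (simp add: emeasure_density)
      show "emeasure ?N (triple P) < \<infinity>" unfolding em by simp
      show "0 \<le> b P" by (rule b0)
      have "ennreal (b P) * emeasure ?N (triple P) = ennreal (G P)"
        unfolding em b_def using WV(1)[of P] G0[of P] by (simp flip: ennreal_mult')
      also have "\<dots> = (\<integral>\<^sup>+x. ennreal (u x) * indicator (triple P) x \<partial>?N)"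
        unfolding G[symmetric] by (subst nn_integral_density) (auto simp: mult_ac)
      finally show "ennreal (b P) * emeasure ?N (triple P) \<le> (\<integral>\<^sup>+x. ennreal (u x) * indicator (triple P) x \<partial>?N)" by simp
    qed (use lam in auto)
    also have "(\<integral>\<^sup>+x. (ennreal (u x))\<^sup>2 \<partial>?N) = X"
      unfolding X_def using u0 by (subst nn_integral_density) (auto simp: ennreal_power mult.commute)
    finally show ?thesis by (subst (asm) nn_integral_density) (auto simp: Mb_def[symmetric] mult.commute)
  qed
  have Zsq: "(Z t)\<^sup>2 \<le> 16 * (X * Y)" for t
  proof -
    have "Z t = (\<integral>\<^sup>+x. (ennreal (Ma t x) * ennreal (sqrt (inverse (w x)))) * (ennreal (Mb t x) * ennreal (sqrt (w x))) \<partial>lborel)"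
      unfolding Z_def
    proof (intro nn_integral_cong_AE eventually_mono[OF w_pos])
      fix x assume x: "0 < w x"
      have 1: "ennreal (sqrt (inverse (w x))) * ennreal (sqrt (w x)) = 1"
        using x by (simp add: real_sqrt_mult[symmetric] flip: ennreal_mult')
      have "(ennreal (Ma t x) * ennreal (sqrt (inverse (w x)))) * (ennreal (Mb t x) * ennreal (sqrt (w x)))
        = ennreal (Ma t x) * ennreal (Mb t x) * (ennreal (sqrt (inverse (w x))) * ennreal (sqrt (w x)))" by (simp only: mult_ac)
      then show "ennreal (Ma t x) * ennreal (Mb t x) = (ennreal (Ma t x) * ennreal (sqrt (inverse (w x)))) * (ennreal (Mb t x) * ennreal (sqrt (w x)))"
        by (simp only: 1 mult_1_right)
    qed
    then have "(Z t)\<^sup>2 \<le> (\<integral>\<^sup>+x. (ennreal (Ma t x) * ennreal (sqrt (inverse (w x))))\<^sup>2 \<partial>lborel) * (\<integral>\<^sup>+x. (ennreal (Mb t x) * ennreal (sqrt (w x)))\<^sup>2 \<partial>lborel)"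
      by (simp only:) (rule Cauchy_Schwarz_nn_integral; measurable)
    also have "(\<integral>\<^sup>+x. (ennreal (Ma t x) * ennreal (sqrt (inverse (w x))))\<^sup>2 \<partial>lborel) = (\<integral>\<^sup>+x. ennreal ((Ma t x)\<^sup>2) * ennreal (inverse (w x)) \<partial>lborel)"
      by (intro nn_integral_cong_AE eventually_mono[OF w_pos]) (auto simp: power_mult_distrib ennreal_power M0)
    also have "(\<integral>\<^sup>+x. (ennreal (Mb t x) * ennreal (sqrt (w x)))\<^sup>2 \<partial>lborel) = (\<integral>\<^sup>+x. ennreal ((Mb t x)\<^sup>2) * ennreal (w x) \<partial>lborel)"
      by (intro nn_integral_cong_AE eventually_mono[OF w_pos]) (auto simp: power_mult_distrib ennreal_power M0)
    also have "(\<integral>\<^sup>+x. ennreal ((Ma t x)\<^sup>2) * ennreal (inverse (w x)) \<partial>lborel) * (\<integral>\<^sup>+x. ennreal ((Mb t x)\<^sup>2) * ennreal (w x) \<partial>lborel)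
        \<le> (4 * Y) * (4 * X)" by (intro mult_mono Za Zb) auto
    also have "\<dots> = 16 * (X * Y)" by (simp add: mult_ac)
    finally show ?thesis .
  qed
  have ZE: "ennreal (\<Sum>P\<in>St t. e P * (a P * b P)) \<le> Z t" for t
  proof -
    have "ennreal (\<Sum>P\<in>St t. e P * (a P * b P)) = (\<Sum>P\<in>St t. ennreal (a P * b P) * emeasure lborel (E P))"
      using e a0 b0 St(2)[of t] by (subst sum_ennreal[symmetric]) (auto simp: ennreal_mult' mult.commute intro!: sum.cong mult_nonneg_nonneg)
    also have "\<dots> = (\<integral>\<^sup>+x. (\<Sum>P\<in>St t. ennreal (a P * b P) * indicator (E P) x) \<partial>lborel)"
      using E(1) by (subst nn_integral_sum) (auto simp: nn_integral_cmult_indicator)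
    also have "\<dots> \<le> Z t"
      unfolding Z_def
    proof (intro nn_integral_mono)
      fix x
      show "(\<Sum>P\<in>St t. ennreal (a P * b P) * indicator (E P) x) \<le> ennreal (Ma t x) * ennreal (Mb t x)"
      proof (cases "\<exists>P\<in>St t. x \<in> E P")
        case True
        then obtain P where P: "P \<in> St t" "x \<in> E P" by auto
        have "(\<Sum>P\<in>St t. ennreal (a P * b P) * indicator (E P) x) = (\<Sum>R\<in>{P}. ennreal (a R * b R) * indicator (E R) x)"
        proof (rule sum.mono_neutral_right)
          show "\<forall>R\<in>St t - {P}. ennreal (a R * b R) * indicator (E R) x = 0"
          proof
            fix R assume R: "R \<in> St t - {P}"
            then have "E R \<inter> E P = {}" using E(4) P St(2)[of t] unfolding disjoint_family_on_def by blast
            then show "ennreal (a R * b R) * indicator (E R) x = 0" using P by (auto simp: indicator_def)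
          qed
        qed (use P St in auto)
        also have "\<dots> = ennreal (a P * b P)" using P by simp
        also have "\<dots> \<le> ennreal (Ma t x * Mb t x)"
        proof (intro ennreal_leI mult_mono M0 b0)
          have x3: "x \<in> triple P" using P E(2)[of P] cell_subset_triple[of P] by auto
          show "a P \<le> Ma t x" "b P \<le> Mb t x" unfolding Ma_def Mb_def using St P x3 by (auto intro!: laminar_max_ge)
        qed
        also have "\<dots> = ennreal (Ma t x) * ennreal (Mb t x)" using M0 by (simp add: ennreal_mult)
        finally show ?thesis .
      next
        case False
        then have "(\<Sum>P\<in>St t. ennreal (a P * b P) * indicator (E P) x) = 0" by (intro sum.neutral) auto
        then show ?thesis by simp
      qed
    qed
    finally show ?thesis .
  qed
  let ?LC = "lattice_classes :: ('d \<Rightarrow> int) set"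
  have ne: "?LC \<noteq> {}" using lattice_class_in by blast
  define Zm where "Zm = Max (Z ` ?LC)"
  have Zm: "Z t \<le> Zm" if "t \<in> ?LC" for t unfolding Zm_def using that finite_lattice_classes by (intro Max_ge) auto
  have "Zm \<in> Z ` ?LC" unfolding Zm_def using ne finite_lattice_classes by (intro Max_in) auto
  then have Zmsq: "Zm\<^sup>2 \<le> 16 * (X * Y)" using Zsq by auto
  have XG: "X \<le> ennreal (\<Sum>P\<in>S. A P * G P)"
  proof -
    have "X = (\<integral>\<^sup>+x. (\<Sum>P\<in>S. ennreal (A P) * (ennreal (u x) * ennreal (w x) * indicator (cell P) x)) \<partial>lborel)"
      unfolding X_def
    proof (intro nn_integral_cong)
      fix x
      have "ennreal (u x) = (\<Sum>P\<in>S. ennreal (A P * indicator (cell P) x))"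
        unfolding u_def sparse_sum_def using A by (intro sum_ennreal[symmetric]) auto
      also have "\<dots> = (\<Sum>P\<in>S. ennreal (A P) * indicator (cell P) x)" by (intro sum.cong) (auto simp: indicator_def)
      finally have ue: "ennreal (u x) = \<dots>" .
      have "ennreal ((u x)\<^sup>2) * ennreal (w x) = ennreal (u x) * (ennreal (u x) * ennreal (w x))"
        using u0[of x] by (simp add: power2_eq_square ennreal_mult mult.assoc)
      also have "\<dots> = (\<Sum>P\<in>S. ennreal (A P) * indicator (cell P) x * (ennreal (u x) * ennreal (w x)))"
        by (subst (1) ue) (rule sum_distrib_right)
      also have "\<dots> = (\<Sum>P\<in>S. ennreal (A P) * (ennreal (u x) * ennreal (w x) * indicator (cell P) x))"
        by (intro sum.cong refl) (simp only: mult_ac)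
      finally show "ennreal ((u x)\<^sup>2) * ennreal (w x) = \<dots>" .
    qed
    also have "\<dots> \<le> (\<integral>\<^sup>+x. (\<Sum>P\<in>S. ennreal (A P) * (ennreal (u x) * ennreal (w x) * indicator (triple P) x)) \<partial>lborel)"
    proof (intro nn_integral_mono sum_mono mult_left_mono)
      show "indicator (cell P) x \<le> (indicator (triple P) x :: ennreal)" for P x using cell_subset_triple[of P] by (auto simp: indicator_def)
    qed auto
    also have "\<dots> = (\<Sum>P\<in>S. ennreal (A P) * ennreal (G P))"
      by (subst nn_integral_sum) (auto simp: nn_integral_cmult G)
    also have "\<dots> = ennreal (\<Sum>P\<in>S. A P * G P)"
      using A G0 by (subst sum_ennreal[symmetric]) (auto simp: ennreal_mult')
    finally show ?thesis .
  qed
  have sp: "0 \<le> (\<Sum>P\<in>St t. e P * (a P * b P))" for t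
    using e a0 b0 St(2)[of t] by (intro sum_nonneg mult_nonneg_nonneg) auto
  have "(\<Sum>P\<in>S. A P * G P) \<le> (\<Sum>P\<in>S. k * (e P * (a P * b P)))" by (intro sum_mono termwise)
  also have "\<dots> = k * (\<Sum>t\<in>?LC. (\<Sum>P\<in>St t. e P * (a P * b P)))"
    unfolding St_def sum_distrib_left[symmetric]
    using sum.group[OF S finite_lattice_classes, of lattice_class "\<lambda>P. e P * (a P * b P)", OF image_subsetI[OF lattice_class_in]] by simp
  finally have "X \<le> ennreal (k * (\<Sum>t\<in>?LC. (\<Sum>P\<in>St t. e P * (a P * b P))))" using XG ennreal_leI order.trans by blast
  also have "\<dots> = ennreal k * (\<Sum>t\<in>?LC. ennreal (\<Sum>P\<in>St t. e P * (a P * b P)))"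
    using k0 sp by (simp add: ennreal_mult' sum_ennreal)
  also have "\<dots> \<le> ennreal k * (\<Sum>t\<in>?LC. Zm)"
    using ZE Zm by (intro mult_left_mono sum_mono) (auto intro: order.trans)
  also have "\<dots> = ennreal (k * 3 ^ CARD('d)) * Zm"
    using k0 by (simp add: card_lattice_classes ennreal_mult' mult.assoc ennreal_numeral_power)
  finally have "X\<^sup>2 \<le> (ennreal (k * 3 ^ CARD('d)) * Zm)\<^sup>2" by (intro power_mono) auto
  also have "\<dots> = ennreal ((k * 3 ^ CARD('d))\<^sup>2) * Zm\<^sup>2" using k0 by (simp add: power_mult_distrib ennreal_power)
  also have "\<dots> \<le> ennreal ((k * 3 ^ CARD('d))\<^sup>2) * (16 * (X * Y))" by (intro mult_left_mono Zmsq) auto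
  also have "\<dots> = ennreal ((8 * 9 ^ CARD('d) * A2c)\<^sup>2) * Y * X"
  proof -
    have "(3::real) ^ CARD('d) * 3 ^ CARD('d) = 9 ^ CARD('d)" by (simp flip: power_mult_distrib)
    then have "k * 3 ^ CARD('d) * 4 = 8 * 9 ^ CARD('d) * A2c" by (simp add: k_def)
    moreover have "(k * 3 ^ CARD('d))\<^sup>2 * 16 = (k * 3 ^ CARD('d) * 4)\<^sup>2" unfolding power_mult_distrib[of _ 4] by simp
    ultimately have "(k * 3 ^ CARD('d))\<^sup>2 * 16 = (8 * 9 ^ CARD('d) * A2c)\<^sup>2" by (simp only:)
    then have "ennreal ((k * 3 ^ CARD('d))\<^sup>2) * 16 = ennreal ((8 * 9 ^ CARD('d) * A2c)\<^sup>2)"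
      by (metis ennreal_mult' ennreal_numeral zero_le_power2)
    then show ?thesis by (simp only: mult_ac)
  qed
  finally have "X \<le> ennreal ((8 * 9 ^ CARD('d) * A2c)\<^sup>2) * Y" by (rule ennreal_self_bound[OF Xfin])
  then show ?thesis by (simp add: X_def Y_def u_def)
qed

end

section \<open>The weighted estimate\<close>

abbreviation weighted_sq :: "(real ^ 'd \<Rightarrow> real) \<Rightarrow> (real ^ 'd \<Rightarrow> complex) \<Rightarrow> ennreal" where
  "weighted_sq w f \<equiv> (\<integral>\<^sup>+x. ennreal ((cmod (f x))\<^sup>2) * ennreal (w x) \<partial>lborel)"

lemma nn_integral_Fatou_bound:
  fixes F :: "nat \<Rightarrow> 'a \<Rightarrow> ennreal"
  assumes [measurable]: "\<And>k. F k \<in> borel_measurable M" "G \<in> borel_measurable M"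
    and le: "\<And>k. (\<integral>\<^sup>+x. F k x \<partial>M) \<le> B" and lim: "AE x in M. (\<lambda>k. F k x) \<longlonglongrightarrow> G x"
  shows "(\<integral>\<^sup>+x. G x \<partial>M) \<le> B"
proof -
  have "(\<integral>\<^sup>+x. G x \<partial>M) = (\<integral>\<^sup>+x. liminf (\<lambda>k. F k x) \<partial>M)"
    by (intro nn_integral_cong_AE eventually_mono[OF lim]) (simp add: lim_imp_Liminf)
  also have "\<dots> \<le> liminf (\<lambda>k. \<integral>\<^sup>+x. F k x \<partial>M)" by (rule nn_integral_liminf) auto
  also have "\<dots> \<le> liminf (\<lambda>k::nat. B)" by (intro Liminf_mono always_eventually allI le)
  also have "\<dots> = B" by (rule Liminf_const) simp
  finally show ?thesis .
qed

text \<open>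
  The sparse family may be infinite. Its finite sections \<open>Sk k\<close> increase to it and satisfy the bound
  uniformly, so monotone convergence applies.
\<close>

lemma (in cz_grid) weighted_local:
  assumes w: "A2_weight w" and f: "f \<in> L2_space lborel"
  shows "(\<integral>\<^sup>+x. ennreal ((cmod (T (restr (triple Q0) f) x))\<^sup>2) * ennreal (w x) * indicator (cell Q0) x \<partial>lborel)
    \<le> ennreal ((step_const * 8 * 9 ^ CARD('d) * enn2real (A2_char w))\<^sup>2) * weighted_sq w f"
proof -
  interpret A: A2_grid L w by unfold_locales (rule w)
  have [measurable]: "f \<in> borel_measurable borel" using f by auto
  define Y where "Y = weighted_sq w f"
  let ?c = "8 * 9 ^ CARD('d) * A.A2c"
  obtain S E where E: "\<And>P. E P \<in> sets borel" "\<And>P. E P \<subseteq> cell P" "\<And>P. emeasure lborel (cell P) \<le> 2 * emeasure lborel (E P)"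
    "disjoint_family_on E S"
    and dom: "AE x in lborel. x \<in> cell Q0 \<longrightarrow> (\<exists>J. finite J \<and> J \<subseteq> S \<and> (\<forall>P\<in>J. x \<in> cell P) \<and>
        cmod (T (restr (triple Q0) f) x) \<le> step_const * (\<Sum>P\<in>J. triple_avg f P))"
    by (rule sparse_domination[OF f, of Q0]) (rule that; assumption)
  define Sk where "Sk k = S \<inter> from_nat ` {..<k}" for k :: nat
  have Sk: "finite (Sk k)" "Sk k \<subseteq> S" for k by (auto simp: Sk_def)
  define u where "u k = A.sparse_sum (triple_avg f) (Sk k)" for k
  have u0: "0 \<le> u k x" for k x unfolding u_def A.sparse_sum_def by (intro sum_nonneg mult_nonneg_nonneg triple_avg_nonneg) auto
  have umono: "u k x \<le> u l x" if "k \<le> l" for k l x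
    unfolding u_def A.sparse_sum_def
    using that Sk by (intro sum_mono2 mult_nonneg_nonneg triple_avg_nonneg) (auto simp: Sk_def)
  have um [measurable]: "u k \<in> borel_measurable borel" for k unfolding u_def by measurable
  have bound: "(\<integral>\<^sup>+x. ennreal ((u k x)\<^sup>2) * ennreal (w x) \<partial>lborel) \<le> ennreal (?c\<^sup>2) * Y" for k
    unfolding u_def Y_def
  proof (rule A.sparse_bound[OF Sk(1), where E = E])
    show "disjoint_family_on E (Sk k)" using disjoint_family_on_mono[OF Sk(2) E(4)] .
  qed (use E in \<open>auto simp: triple_avg_nn[OF f] triple_avg_nonneg\<close>)
  have "AE x in lborel. ennreal ((cmod (T (restr (triple Q0) f) x))\<^sup>2) * ennreal (w x) * indicator (cell Q0) x
      \<le> ennreal (step_const\<^sup>2) * (SUP k. ennreal ((u k x)\<^sup>2) * ennreal (w x))"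
    using dom
  proof eventually_elim
    case (elim x)
    show ?case
    proof (cases "x \<in> cell Q0")
      case True
      then obtain J where J: "finite J" "J \<subseteq> S" "\<forall>P\<in>J. x \<in> cell P"
        "cmod (T (restr (triple Q0) f) x) \<le> step_const * (\<Sum>P\<in>J. triple_avg f P)" using elim by auto
      obtain k where k: "\<forall>n\<in>to_nat ` J. n < k" using J(1) finite_nat_set_iff_bounded[of "to_nat ` J"] by auto
      have Jk: "J \<subseteq> Sk k"
      proof
        fix P assume P: "P \<in> J"
        then have "to_nat P < k" using k by blast
        then have "P \<in> from_nat ` {..<k}" by (intro image_eqI[of _ _ "to_nat P"]) auto
        then show "P \<in> Sk k" using P J by (auto simp: Sk_def)
      qed
      have "(\<Sum>P\<in>J. triple_avg f P) = (\<Sum>P\<in>J. triple_avg f P * indicator (cell P) x)" using J(3) by (intro sum.cong) auto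
      also have "\<dots> \<le> u k x" unfolding u_def A.sparse_sum_def using Jk Sk(1)
        by (intro sum_mono2 mult_nonneg_nonneg triple_avg_nonneg) auto
      finally have "step_const * (\<Sum>P\<in>J. triple_avg f P) \<le> step_const * u k x" using step_const_pos by (intro mult_left_mono) auto
      with J(4) have "cmod (T (restr (triple Q0) f) x) \<le> step_const * u k x" by simp
      then have "(cmod (T (restr (triple Q0) f) x))\<^sup>2 \<le> (step_const * u k x)\<^sup>2" by (intro power_mono) auto
      then have "ennreal ((cmod (T (restr (triple Q0) f) x))\<^sup>2) \<le> ennreal (step_const\<^sup>2) * ennreal ((u k x)\<^sup>2)"
        by (simp add: power_mult_distrib ennreal_leI flip: ennreal_mult')
      then have "ennreal ((cmod (T (restr (triple Q0) f) x))\<^sup>2) * ennreal (w x) \<le> ennreal (step_const\<^sup>2) * (ennreal ((u k x)\<^sup>2) * ennreal (w x))"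
        unfolding mult.assoc[symmetric] by (rule mult_right_mono) simp
      also have "\<dots> \<le> ennreal (step_const\<^sup>2) * (SUP k. ennreal ((u k x)\<^sup>2) * ennreal (w x))"
        by (intro mult_left_mono SUP_upper) auto
      finally show ?thesis using True by simp
    qed simp
  qed
  then have "(\<integral>\<^sup>+x. ennreal ((cmod (T (restr (triple Q0) f) x))\<^sup>2) * ennreal (w x) * indicator (cell Q0) x \<partial>lborel)
      \<le> (\<integral>\<^sup>+x. ennreal (step_const\<^sup>2) * (SUP k. ennreal ((u k x)\<^sup>2) * ennreal (w x)) \<partial>lborel)"
    by (rule nn_integral_mono_AE)
  also have "\<dots> = ennreal (step_const\<^sup>2) * (\<integral>\<^sup>+x. (SUP k. ennreal ((u k x)\<^sup>2) * ennreal (w x)) \<partial>lborel)"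
    by (rule nn_integral_cmult) measurable
  also have "(\<integral>\<^sup>+x. (SUP k. ennreal ((u k x)\<^sup>2) * ennreal (w x)) \<partial>lborel) = (SUP k. \<integral>\<^sup>+x. ennreal ((u k x)\<^sup>2) * ennreal (w x) \<partial>lborel)"
  proof (rule nn_integral_monotone_convergence_SUP)
    show "incseq (\<lambda>k x. ennreal ((u k x)\<^sup>2) * ennreal (w x))"
      unfolding incseq_def le_fun_def by (intro allI impI mult_right_mono ennreal_leI power_mono umono u0) auto
  qed measurable
  also have "ennreal (step_const\<^sup>2) * \<dots> \<le> ennreal (step_const\<^sup>2) * (ennreal (?c\<^sup>2) * Y)"
    by (intro mult_left_mono SUP_least bound) auto
  also have "\<dots> = ennreal ((step_const * 8 * 9 ^ CARD('d) * enn2real (A2_char w))\<^sup>2) * Y"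
  proof -
    have "ennreal (step_const\<^sup>2) * ennreal (?c\<^sup>2) = ennreal ((step_const * 8 * 9 ^ CARD('d) * enn2real (A2_char w))\<^sup>2)"
      unfolding A.A2c_def by (simp add: power_mult_distrib mult.assoc flip: ennreal_mult')
    then show ?thesis by (simp only: mult.assoc[symmetric])
  qed
  finally show ?thesis by (simp add: Y_def)
qed

context cz_operator
begin

definition cz_const :: real where
  "cz_const = cz_grid.step_const TYPE('d) M \<epsilon> * 8 * 9 ^ CARD('d)"

text \<open>
  The central cell of a grid with large \<open>L\<close> contains the support of \<open>f\<close> and any given ball, and the constant
  does not depend on \<open>L\<close>.
\<close>

lemma weighted_bounded_support:
  assumes w: "A2_weight w" and f: "f \<in> L2_space lborel" and r: "\<And>x. f x \<noteq> 0 \<Longrightarrow> norm x \<le> r"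
  shows "weighted_sq w (T f)
    \<le> ennreal ((cz_const * enn2real (A2_char w))\<^sup>2) * weighted_sq w f"
proof (rule nn_integral_Fatou_bound[where F = "\<lambda>k x. ennreal ((cmod (T f x))\<^sup>2) * ennreal (w x) * indicator (cball 0 (real k)) x"])
  have [measurable]: "cball (0 :: real ^ 'd) s \<in> sets borel" for s by simp
  have [measurable]: "T f \<in> borel_measurable borel" using f by (rule T_measurable)
  have [measurable]: "w \<in> borel_measurable borel" using w by (simp add: A2_weight_def is_weight_def)
  show "(\<lambda>x. ennreal ((cmod (T f x))\<^sup>2) * ennreal (w x) * indicator (cball 0 (real k)) x) \<in> borel_measurable lborel" for k by measurable
  show "(\<lambda>x. ennreal ((cmod (T f x))\<^sup>2) * ennreal (w x)) \<in> borel_measurable lborel" by measurable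
  show "AE x in lborel. (\<lambda>k. ennreal ((cmod (T f x))\<^sup>2) * ennreal (w x) * indicator (cball 0 (real k)) x) \<longlonglongrightarrow> ennreal ((cmod (T f x))\<^sup>2) * ennreal (w x)"
  proof (rule AE_I2)
    fix x :: "real ^ 'd"
    obtain N :: nat where "norm x \<le> N" using real_arch_simple by blast
    then have "eventually (\<lambda>k. indicator (cball 0 (real k)) x = (1 :: ennreal)) sequentially"
      unfolding eventually_sequentially by (intro exI[of _ N]) auto
    then have "eventually (\<lambda>k. ennreal ((cmod (T f x))\<^sup>2) * ennreal (w x) * indicator (cball 0 (real k)) x = ennreal ((cmod (T f x))\<^sup>2) * ennreal (w x)) sequentially"
      by eventually_elim simp
    then show "(\<lambda>k. ennreal ((cmod (T f x))\<^sup>2) * ennreal (w x) * indicator (cball 0 (real k)) x) \<longlonglongrightarrow> ennreal ((cmod (T f x))\<^sup>2) * ennreal (w x)"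
      by (rule tendsto_eventually)
  qed
  fix k :: nat
  define L where "L = 2 * (\<bar>r\<bar> + real k + 1)"
  interpret G: cz_grid T M \<epsilon> K L by unfold_locales (simp add: L_def)
  define Q where "Q = ((0, \<lambda>_. 0) :: 'd cell)"
  have inQ: "x \<in> G.cell Q" if "norm x \<le> \<bar>r\<bar> + real k" for x
  proof -
    have "- (L / 2) \<le> x $ i \<and> x $ i < L / 2" for i
    proof -
      have "L / 2 = \<bar>r\<bar> + real k + 1" by (simp add: L_def)
      then show ?thesis using component_le_norm_cart[of x i] that by linarith
    qed
    then show ?thesis unfolding G.cell_eq Q_def G.side_def by simp
  qed
  have "restr (G.triple Q) f = f"
  proof
    fix x
    show "restr (G.triple Q) f x = f x"
    proof (cases "f x = 0")
      case False
      then have "x \<in> G.cell Q" using r[of x] by (intro inQ) auto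
      then show ?thesis using G.cell_subset_triple[of Q] by (auto simp: restr_apply)
    qed (simp add: restr_apply)
  qed
  then have "(\<integral>\<^sup>+x. ennreal ((cmod (T f x))\<^sup>2) * ennreal (w x) * indicator (G.cell Q) x \<partial>lborel)
     \<le> ennreal ((cz_const * enn2real (A2_char w))\<^sup>2) * weighted_sq w f"
    using G.weighted_local[OF w f, of Q] by (simp add: cz_const_def)
  moreover have "cball 0 (real k) \<subseteq> G.cell Q" using inQ by auto
  then have "(\<integral>\<^sup>+x. ennreal ((cmod (T f x))\<^sup>2) * ennreal (w x) * indicator (cball 0 (real k)) x \<partial>lborel)
    \<le> (\<integral>\<^sup>+x. ennreal ((cmod (T f x))\<^sup>2) * ennreal (w x) * indicator (G.cell Q) x \<partial>lborel)"
    by (intro nn_integral_mono mult_left_mono) (auto simp: indicator_def)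
  ultimately show "(\<integral>\<^sup>+x. ennreal ((cmod (T f x))\<^sup>2) * ennreal (w x) * indicator (cball 0 (real k)) x \<partial>lborel)
     \<le> ennreal ((cz_const * enn2real (A2_char w))\<^sup>2) * weighted_sq w f" by simp
qed

text \<open>
  Truncation to balls, in the mean square sense for \<open>dx\<close>; Fatou's lemma carries the bound over to the
  limit.
\<close>

lemma weighted_estimate:
  assumes w: "A2_weight w" and f: "f \<in> L2_space lborel"
  shows "weighted_sq w (T f)
    \<le> ennreal ((cz_const * enn2real (A2_char w))\<^sup>2) * weighted_sq w f"
proof -
  have [measurable]: "f \<in> borel_measurable borel" using f by auto
  have [measurable]: "w \<in> borel_measurable borel" using w by (simp add: A2_weight_def is_weight_def)
  define g where "g k = restr (cball 0 (real k)) f" for k :: nat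
  have gL: "g k \<in> L2_space lborel" for k unfolding g_def using f by auto
  have [measurable]: "g k \<in> borel_measurable borel" for k using gL[of k] by auto
  have "(\<lambda>k. sqnorm lborel (\<lambda>x. g k x - f x)) \<longlonglongrightarrow> 0"
  proof -
    have "(\<lambda>k. \<integral>\<^sup>+x. ennreal ((cmod (g k x - f x))\<^sup>2) \<partial>lborel) \<longlonglongrightarrow> (\<integral>\<^sup>+(x :: real ^ 'd). 0 \<partial>lborel)"
    proof (rule nn_integral_dominated_convergence[where w = "\<lambda>x. ennreal ((cmod (f x))\<^sup>2)"])
      show "(\<integral>\<^sup>+x. ennreal ((cmod (f x))\<^sup>2) \<partial>lborel) < \<infinity>" using f by (simp add: L2_space_iff sqnorm_def)
      show "AE x in lborel. ennreal ((cmod (g k x - f x))\<^sup>2) \<le> ennreal ((cmod (f x))\<^sup>2)" for k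
        by (auto simp: g_def restr_apply)
      show "AE x in lborel. (\<lambda>k. ennreal ((cmod (g k x - f x))\<^sup>2)) \<longlonglongrightarrow> 0"
      proof (rule AE_I2)
        fix x :: "real ^ 'd"
        obtain N :: nat where "norm x \<le> N" using real_arch_simple by blast
        then have "eventually (\<lambda>k. ennreal ((cmod (g k x - f x))\<^sup>2) = 0) sequentially"
          unfolding eventually_sequentially by (intro exI[of _ N]) (auto simp: g_def restr_apply)
        then show "(\<lambda>k. ennreal ((cmod (g k x - f x))\<^sup>2)) \<longlonglongrightarrow> 0" by (rule tendsto_eventually)
      qed
    qed auto
    then show ?thesis by (simp add: sqnorm_def)
  qed
  from T_AE_subseq[OF gL f this] obtain r where r: "strict_mono r" "AE x in lborel. (\<lambda>k. T (g (r k)) x) \<longlonglongrightarrow> T f x"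
    by blast
  show ?thesis
  proof (rule nn_integral_Fatou_bound[where F = "\<lambda>k x. ennreal ((cmod (T (g (r k)) x))\<^sup>2) * ennreal (w x)"])
    have [measurable]: "T (g k) \<in> borel_measurable borel" "T f \<in> borel_measurable borel" for k
      by (rule T_measurable[OF gL], rule T_measurable[OF f])
    show "(\<lambda>x. ennreal ((cmod (T (g (r k)) x))\<^sup>2) * ennreal (w x)) \<in> borel_measurable lborel" for k by measurable
    show "(\<lambda>x. ennreal ((cmod (T f x))\<^sup>2) * ennreal (w x)) \<in> borel_measurable lborel" by measurable
    show "AE x in lborel. (\<lambda>k. ennreal ((cmod (T (g (r k)) x))\<^sup>2) * ennreal (w x)) \<longlonglongrightarrow> ennreal ((cmod (T f x))\<^sup>2) * ennreal (w x)"
      using r(2)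
    proof eventually_elim
      case (elim x)
      then have "(\<lambda>k. ennreal ((cmod (T (g (r k)) x))\<^sup>2)) \<longlonglongrightarrow> ennreal ((cmod (T f x))\<^sup>2)" by (intro tendsto_intros)
      from ennreal_tendsto_cmult[OF _ this, of "ennreal (w x)"] show ?case by (simp add: mult.commute)
    qed
    fix k
    have "weighted_sq w (T (g (r k)))
      \<le> ennreal ((cz_const * enn2real (A2_char w))\<^sup>2) * weighted_sq w (g (r k))"
      by (rule weighted_bounded_support[OF w gL, where r = "real (r k)"]) (auto simp: g_def restr_apply split: if_splits)
    also have "\<dots> \<le> ennreal ((cz_const * enn2real (A2_char w))\<^sup>2) * weighted_sq w f"
      by (intro mult_left_mono nn_integral_mono mult_right_mono) (auto simp: g_def restr_apply)
    finally show "weighted_sq w (T (g (r k)))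
      \<le> ennreal ((cz_const * enn2real (A2_char w))\<^sup>2) * weighted_sq w f" .
  qed
qed

lemma cz_const_nonneg: "0 \<le> cz_const"
proof -
  interpret G: cz_grid T M \<epsilon> K 1 by unfold_locales simp
  show ?thesis unfolding cz_const_def using G.step_const_pos by simp
qed

lemma weighted_opnorm:
  assumes w: "A2_weight w"
  shows "L2_opnorm (weighted w) T \<le> ennreal (cz_const * enn2real (A2_char w))"
proof -
  let ?C = "cz_const * enn2real (A2_char w)"
  have C0: "0 \<le> ?C" using cz_const_nonneg by simp
  have [measurable]: "w \<in> borel_measurable borel" using w by (simp add: A2_weight_def is_weight_def)
  have sqw: "sqnorm (weighted w) g = weighted_sq w g" if [measurable]: "g \<in> borel_measurable borel" for g
    unfolding sqnorm_def weighted_def by (subst nn_integral_density) (auto simp: mult.commute)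
  have "T f \<in> L2_space (weighted w) \<and> L2_norm (weighted w) (T f) \<le> ?C * L2_norm (weighted w) f"
    if f: "f \<in> L2_space lborel" "f \<in> L2_space (weighted w)" for f
  proof -
    have m: "f \<in> borel_measurable borel" "T f \<in> borel_measurable borel" using f T_measurable by auto
    have le: "sqnorm (weighted w) (T f) \<le> ennreal (?C\<^sup>2) * sqnorm (weighted w) f"
      unfolding sqw[OF m(1)] sqw[OF m(2)] by (rule weighted_estimate[OF w f(1)])
    also have "\<dots> < \<infinity>" using f(2) by (simp add: L2_space_iff ennreal_mult_less_top)
    finally have TL: "T f \<in> L2_space (weighted w)" using m(2) by (simp add: L2_space_iff weighted_def)
    have "ennreal ((L2_norm (weighted w) (T f))\<^sup>2) \<le> ennreal (?C\<^sup>2) * ennreal ((L2_norm (weighted w) f)\<^sup>2)"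
      using le by (simp only: sqnorm_eq[OF TL] sqnorm_eq[OF f(2)])
    also have "\<dots> = ennreal ((?C * L2_norm (weighted w) f)\<^sup>2)" by (simp add: power_mult_distrib flip: ennreal_mult')
    finally have "(L2_norm (weighted w) (T f))\<^sup>2 \<le> (?C * L2_norm (weighted w) f)\<^sup>2" by (subst (asm) ennreal_le_iff) auto
    then have "L2_norm (weighted w) (T f) \<le> ?C * L2_norm (weighted w) f"
    proof (rule power2_le_imp_le)
      show "0 \<le> ?C * L2_norm (weighted w) f" unfolding L2_norm_def
        by (intro mult_nonneg_nonneg[OF C0] real_sqrt_ge_zero integral_nonneg_AE) auto
    qed
    with TL show ?thesis by simp
  qed
  with C0 have "?C \<in> {C. 0 \<le> C \<and> (\<forall>f \<in> L2_space lborel \<inter> L2_space (weighted w).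
      T f \<in> L2_space (weighted w) \<and> L2_norm (weighted w) (T f) \<le> C * L2_norm (weighted w) f)}" by blast
  then show ?thesis unfolding L2_opnorm_def by (rule INF_lower)
qed

end

lemma cz_kernel_off_diagonal: "cz_kernel \<epsilon> K \<Longrightarrow> cz_kernel \<epsilon> (\<lambda>x y. if x = y then 0 else K x y)"
proof -
  assume K: "cz_kernel \<epsilon> K"
  have ne: "x' \<noteq> y" if "x \<noteq> y" "norm (x - x') \<le> norm (x - y) / 2" for x x' y :: "real ^ 'a"
    using that by auto
  show ?thesis using K unfolding cz_kernel_def by (auto dest: ne)
qed

text \<open>
  The operator norm is an infimum, so the bound itself is only available for every larger constant,
  here \<open>max N 0 + 1\<close>. The kernel is modified on the diagonal, which the pairing of functions with
  disjoint supports does not see.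
\<close>

lemma cz_operator_exists:
  fixes T :: "(real ^ 'd \<Rightarrow> complex) \<Rightarrow> real ^ 'd \<Rightarrow> complex"
  assumes e: "0 < \<epsilon>" and T: "calderon_zygmund \<epsilon> T" and N: "L2_opnorm lborel T \<le> ennreal N"
  shows "\<exists>K. cz_operator T ((max N 0 + 1)\<^sup>2) \<epsilon> K"
proof -
  obtain K0 where K0: "cz_kernel \<epsilon> K0"
    "\<And>f g. \<lbrakk>continuous_on UNIV f; continuous_on UNIV g; compact (supp f); compact (supp g); supp f \<inter> supp g = {}\<rbrakk>
      \<Longrightarrow> (LINT x|lborel. T f x * g x) = (LINT x|lborel. (LINT y|lborel. K0 x y * f y * g x))"
    using T unfolding calderon_zygmund_def by blast
  let ?K = "\<lambda>x y. if x = y then 0 else K0 x y"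
  let ?N = "max N 0 + 1"
  have "L2_opnorm lborel T < ennreal ?N" using N by (rule order.strict_trans1) (simp add: ennreal_lessI max_def)
  then obtain C where C: "0 \<le> C" "ennreal C < ennreal ?N"
    "\<And>f. f \<in> L2_space lborel \<Longrightarrow> T f \<in> L2_space lborel \<and> L2_norm lborel (T f) \<le> C * L2_norm lborel f"
    unfolding L2_opnorm_def INF_less_iff by auto
  have CN: "C < ?N" using C(2) unfolding ennreal_less_iff[OF C(1)] .
  have "cz_operator T (?N\<^sup>2) \<epsilon> ?K"
  proof
    show "linear_on_L2 T" using T by (simp add: calderon_zygmund_def)
    show "0 \<le> ?N\<^sup>2" by simp
    show "0 < \<epsilon>" by (rule e)
    show "cz_kernel \<epsilon> ?K" using K0(1) by (rule cz_kernel_off_diagonal)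
    show "T f \<in> L2_space lborel" if "f \<in> L2_space lborel" for f using C(3)[OF that] by simp
    show "sqnorm lborel (T f) \<le> ennreal (?N\<^sup>2) * sqnorm lborel f" if f: "f \<in> L2_space lborel" for f
    proof -
      have TL: "T f \<in> L2_space lborel" using C(3)[OF f] by simp
      have n0: "0 \<le> L2_norm lborel g" for g :: "real ^ 'd \<Rightarrow> complex"
        unfolding L2_norm_def by (intro real_sqrt_ge_zero integral_nonneg_AE) auto
      have "L2_norm lborel (T f) \<le> C * L2_norm lborel f" using C(3)[OF f] by simp
      also have "\<dots> \<le> ?N * L2_norm lborel f" using CN n0 by (intro mult_right_mono) auto
      finally have "(L2_norm lborel (T f))\<^sup>2 \<le> (?N * L2_norm lborel f)\<^sup>2" using n0 by (intro power_mono) auto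
      then have "ennreal ((L2_norm lborel (T f))\<^sup>2) \<le> ennreal (?N\<^sup>2 * (L2_norm lborel f)\<^sup>2)" by (simp only: power_mult_distrib ennreal_leI)
      then show ?thesis by (simp only: ennreal_mult'[OF zero_le_power2] sqnorm_eq[OF f] sqnorm_eq[OF TL])
    qed
    show "(if x = x then 0 else K0 x x) = 0" for x by simp
    fix f g :: "real ^ 'd \<Rightarrow> complex"
    assume fg: "continuous_on UNIV f" "continuous_on UNIV g" "compact (supp f)" "compact (supp g)" "supp f \<inter> supp g = {}"
    have "f y * g x = 0" if "x = y" for x y using supp_zero[of x f] supp_zero[of x g] fg(5) that by auto
    then have "?K x y * f y * g x = K0 x y * f y * g x" for x y by auto
    then show "(LINT x|lborel. T f x * g x) = (LINT x|lborel. (LINT y|lborel. ?K x y * f y * g x))"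
      using K0(2)[OF fg] by (simp only:)
  qed
  then show ?thesis by blast
qed

text \<open>
  The maximum in the constant makes it positive even if there is no operator to which it applies.
\<close>

theorem theorem2p5:
  fixes \<epsilon> N :: real
  assumes "0 < \<epsilon>"
  shows "\<exists>c>0. \<forall>T :: (real ^ 'd \<Rightarrow> complex) \<Rightarrow> (real ^ 'd \<Rightarrow> complex).
    calderon_zygmund \<epsilon> T \<and> L2_opnorm lborel T \<le> ennreal N \<longrightarrow>
    (\<forall>w. A2_weight w \<longrightarrow>
      L2_opnorm (weighted w) T
        \<le> ennreal (c * enn2real (A2_char w) * ln (1 + enn2real (A2_char w))))"
proof -
  define k where "k = cz_grid.step_const TYPE('d) ((max N 0 + 1)\<^sup>2) \<epsilon> * 8 * 9 ^ CARD('d)"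
  define c where "c = max 1 (k / ln 2)"
  have "L2_opnorm (weighted w) T \<le> ennreal (c * enn2real (A2_char w) * ln (1 + enn2real (A2_char w)))"
    if T: "calderon_zygmund \<epsilon> T" "L2_opnorm lborel T \<le> ennreal N" and w: "A2_weight w"
    for T :: "(real ^ 'd \<Rightarrow> complex) \<Rightarrow> (real ^ 'd \<Rightarrow> complex)" and w
  proof -
    obtain K where "cz_operator T ((max N 0 + 1)\<^sup>2) \<epsilon> K" using cz_operator_exists[OF assms T] by blast
    then interpret cz_operator T "(max N 0 + 1)\<^sup>2" \<epsilon> K .
    interpret A: A2_grid 1 w by unfold_locales (auto intro: w)
    let ?a = "enn2real (A2_char w)"
    have a: "1 \<le> ?a" using A.A2c_ge_1 by (simp add: A.A2c_def)
    have l: "ln 2 \<le> ln (1 + ?a)" using a by simp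
    have "k \<le> c * ln 2" unfolding c_def by (simp add: pos_divide_le_eq[symmetric])
    also have "\<dots> \<le> c * ln (1 + ?a)" using l by (intro mult_left_mono) (auto simp: c_def)
    finally have "k * ?a \<le> c * ln (1 + ?a) * ?a" by (intro mult_right_mono) auto
    then have "ennreal (k * ?a) \<le> ennreal (c * ?a * ln (1 + ?a))" by (intro ennreal_leI) (simp add: mult_ac)
    moreover have "L2_opnorm (weighted w) T \<le> ennreal (k * ?a)"
      using weighted_opnorm[OF w] by (simp add: cz_const_def k_def)
    ultimately show ?thesis by (rule order.trans[rotated])
  qed
  moreover have "0 < c" by (simp add: c_def)
  ultimately show ?thesis by blast
qed

end
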